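(* (1) Let $T$ be a rosy theory. Any super-rosy type (i.e. any type whose $U^{\mathrm{th}}$-rank is an ordinal) has finite thorn-weight. (2) Let $T$ be super-rosy and $p\in S(A)$. Then the thorn-weight of $p$ equals $n$ for some $n<\omega$, and there exist a set $B\supseteq A$ and tuples $b_1,\dots,b_n$, thorn-independent over $B$, such that $p$ is thorn-equidominant with $\mathrm{tp}(b_1\cdots b_n/B)$ and each $\mathrm{tp}(b_i/B)$ is thorn-regular.
   Context: $T$ is a complete first-order theory with $T=T^{eq}$; everything takes place in a monster model $\mathfrak C$; sets are small subsets of $\mathfrak C$; tuples are finite unless said otherwise. Thorn-forking. A formula $\varphi(x,b)$ strongly divides over $D$ if $b$ is not algebraic over $D$ and $\{\varphi(x,b') : b'\models \mathrm{tp}(b/D)\}$ is $k$-inconsistent for some $k\in\mathbb N$. It thorn-divides over $C$ if it strongly divides over some $D\supseteq C$. It thorn-forks over $C$ if it implies a finite disjunction of formulas each of which thorn-divides over $C$. A type thorn-forks over $A$ if it contains a formula that does. Write $a\downarrow^{\mathrm{th}}_A B$ if $\mathrm{tp}(a/AB)$ does not thorn-fork over $A$. A family $(b_i)_i$ is thorn-independent over $A$ if $b_i\downarrow^{\mathrm{th}}_A \{b_j : j\ne i\}$ for all $i$. $T$ is rosy if it admits no infinite thorn-forking chains, in the sense that thorn-independence has local character: for every finite tuple $a$ and set $B$ there is $B_0\subseteq B$ with $|B_0|\le |T|$ and $a\downarrow^{\mathrm{th}}_{B_0}B$. Rank. The $U^{\mathrm{th}}$-rank is the foundation rank of the thorn-forking-extension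 relation on types: $U^{\mathrm{th}}(p)\ge\alpha+1$ iff $p$ has a thorn-forking extension $q$ with $U^{\mathrm{th}}(q)\ge\alpha$ (with the usual clauses at $0$ and limits). $T$ is super-rosy if the $U^{\mathrm{th}}$-rank of every type is an ordinal. Thorn-weight. For a type $p$ over $A$, the thorn-weight of $p$ is at least $n$ if there are $a\models p$, $B\supseteq A$ with $a\downarrow^{\mathrm{th}}_A B$, and a $B$-thorn-independent $(b_i)_{i=1}^n$ with $a\not\downarrow^{\mathrm{th}}_B b_i$ for all $i$; the thorn-weight of $p$ is the maximal such $n$ (finite if a maximal $n<\omega$ exists). Domination. $a$ thorn-dominates $b$ over $C$ if for every $c$, $b\not\downarrow^{\mathrm{th}}_C c$ implies $a\not\downarrow^{\mathrm{th}}_C c$; $a,b$ are thorn-domination equivalent over $C$ if each thorn-dominates the other over $C$. Types $p$ and $q$ are thorn-equidominant if there are non-thorn-forking extensions $p',q'$ of $p,q$ to a common domain $C$ and realizations $a'\models p'$, $b'\models q'$ which are thorn-domination equivalent over $C$. Regularity. Two types $p,q$ over a common domain $B$ are weakly thorn-orthogonal if $a\downarrow^{\mathrm{th}}_B b$ for all $a\models p$, $b\models q$. A type $r$ over $A$ is thorn-regular if for every $B\supseteq A$, every thorn-forking extension $q\in S(B)$ of $r$ is weakly thorn-orthogonal to every non-thorn-forking extension $p\in S(B)$ of $r$. *)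

theory Defs
  imports Main
begin

unbundle cardinal_syntax

section \<open>Many-sorted first-order logic\<close>

text \<open>
  Formulas are interpreted under a list of elements: \<open>Var i\<close> denotes the \<open>i\<close>-th entry
  and a quantifier prepends an element to the list. A formula \<open>\<phi>(x, y)\<close> is thus a formula that is
  well-sorted in the context \<open>\<Gamma> @ \<Delta>\<close>, where \<open>\<Gamma>\<close> lists the sorts of \<open>x\<close> and \<open>\<Delta>\<close> those of \<open>y\<close>,
  and \<open>\<phi>(a, b)\<close> is evaluated at \<open>a @ b\<close>. Finite tuples are lists.
\<close>

datatype 'f tm = Var nat | Fn 'f "'f tm list"

datatype ('s, 'f, 'r) fm =
    Bot
  | Eq "'f tm" "'f tm"
  | Rel 'r "'f tm list"
  | Neg "('s, 'f, 'r) fm"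
  | Conj "('s, 'f, 'r) fm" "('s, 'f, 'r) fm"
  | Ex 's "('s, 'f, 'r) fm"

text \<open>A symbol belongs to the language iff its signature is not \<open>None\<close>; constants are function
  symbols without arguments.\<close>

record ('s, 'f, 'r) language =
  sorts :: "'s set"
  fun_sig :: "'f \<rightharpoonup> 's list \<times> 's"
  rel_sig :: "'r \<rightharpoonup> 's list"

record ('s, 'f, 'r, 'a) fo_structure = "('s, 'f, 'r) language" +
  univ :: "'a set"
  sort_of :: "'a \<Rightarrow> 's"
  fun_int :: "'f \<Rightarrow> 'a list \<Rightarrow> 'a"
  rel_int :: "'r \<Rightarrow> 'a list \<Rightarrow> bool"

definition wf_language :: "('s, 'f, 'r, 'z) language_scheme \<Rightarrow> bool" where
  "wf_language L \<longleftrightarrow>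
     sorts L \<noteq> {} \<and>
     (\<forall>f \<Delta> s. fun_sig L f = Some (\<Delta>, s) \<longrightarrow> set \<Delta> \<subseteq> sorts L \<and> s \<in> sorts L) \<and>
     (\<forall>R \<Delta>. rel_sig L R = Some \<Delta> \<longrightarrow> set \<Delta> \<subseteq> sorts L)"

inductive has_sort :: "('s, 'f, 'r, 'z) language_scheme \<Rightarrow> 's list \<Rightarrow> 'f tm \<Rightarrow> 's \<Rightarrow> bool"
  for L \<Gamma> where
  "i < length \<Gamma> \<Longrightarrow> has_sort L \<Gamma> (Var i) (\<Gamma> ! i)"
| "fun_sig L f = Some (\<Delta>, s) \<Longrightarrow> list_all2 (has_sort L \<Gamma>) ts \<Delta> \<Longrightarrow> has_sort L \<Gamma> (Fn f ts) s"

primrec wf_fm :: "('s, 'f, 'r, 'z) language_scheme \<Rightarrow> 's list \<Rightarrow> ('s, 'f, 'r) fm \<Rightarrow> bool" where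
  "wf_fm L \<Gamma> Bot \<longleftrightarrow> True"
| "wf_fm L \<Gamma> (Eq t u) \<longleftrightarrow> (\<exists>s. has_sort L \<Gamma> t s \<and> has_sort L \<Gamma> u s)"
| "wf_fm L \<Gamma> (Rel R ts) \<longleftrightarrow> (\<exists>\<Delta>. rel_sig L R = Some \<Delta> \<and> list_all2 (has_sort L \<Gamma>) ts \<Delta>)"
| "wf_fm L \<Gamma> (Neg \<phi>) \<longleftrightarrow> wf_fm L \<Gamma> \<phi>"
| "wf_fm L \<Gamma> (Conj \<phi> \<psi>) \<longleftrightarrow> wf_fm L \<Gamma> \<phi> \<and> wf_fm L \<Gamma> \<psi>"
| "wf_fm L \<Gamma> (Ex s \<phi>) \<longleftrightarrow> s \<in> sorts L \<and> wf_fm L (s # \<Gamma>) \<phi>"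

definition formulas :: "('s, 'f, 'r, 'z) language_scheme \<Rightarrow> ('s, 'f, 'r) fm set" where
  "formulas L = {\<phi>. \<exists>\<Gamma>. set \<Gamma> \<subseteq> sorts L \<and> wf_fm L \<Gamma> \<phi>}"

definition sentences :: "('s, 'f, 'r, 'z) language_scheme \<Rightarrow> ('s, 'f, 'r) fm set" where
  "sentences L = {\<phi>. wf_fm L [] \<phi>}"

text \<open>The tuples of elements of sorts \<open>\<Gamma>\<close>.\<close>

definition tuples :: "('s, 'f, 'r, 'a) fo_structure \<Rightarrow> 's list \<Rightarrow> 'a list set" where
  "tuples M \<Gamma> = {a. set a \<subseteq> univ M \<and> map (sort_of M) a = \<Gamma>}"

definition wf_structure :: "('s, 'f, 'r, 'a) fo_structure \<Rightarrow> bool" where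
  "wf_structure M \<longleftrightarrow>
     wf_language M \<and>
     (\<forall>a\<in>univ M. sort_of M a \<in> sorts M) \<and>
     (\<forall>s\<in>sorts M. \<exists>a\<in>univ M. sort_of M a = s) \<and>
     (\<forall>f \<Delta> s. fun_sig M f = Some (\<Delta>, s) \<longrightarrow>
        (\<forall>a\<in>tuples M \<Delta>. fun_int M f a \<in> univ M \<and> sort_of M (fun_int M f a) = s))"

primrec eval_tm :: "('s, 'f, 'r, 'a) fo_structure \<Rightarrow> 'a list \<Rightarrow> 'f tm \<Rightarrow> 'a" where
  "eval_tm M e (Var i) = e ! i"
| "eval_tm M e (Fn f ts) = fun_int M f (map (eval_tm M e) ts)"

primrec sat :: "('s, 'f, 'r, 'a) fo_structure \<Rightarrow> 'a list \<Rightarrow> ('s, 'f, 'r) fm \<Rightarrow> bool" where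
  "sat M e Bot \<longleftrightarrow> False"
| "sat M e (Eq t u) \<longleftrightarrow> eval_tm M e t = eval_tm M e u"
| "sat M e (Rel R ts) \<longleftrightarrow> rel_int M R (map (eval_tm M e) ts)"
| "sat M e (Neg \<phi>) \<longleftrightarrow> \<not> sat M e \<phi>"
| "sat M e (Conj \<phi> \<psi>) \<longleftrightarrow> sat M e \<phi> \<and> sat M e \<psi>"
| "sat M e (Ex s \<phi>) \<longleftrightarrow> (\<exists>x\<in>univ M. sort_of M x = s \<and> sat M (x # e) \<phi>)"

text \<open>Complete theories are taken to be deductively closed, and hence equal to the set of all
  sentences true in any of their models.\<close>

definition complete_theory ::
  "('s, 'f, 'r, 'z) language_scheme \<Rightarrow> ('s, 'f, 'r) fm set \<Rightarrow> bool" where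
  "complete_theory L T \<longleftrightarrow>
     T \<subseteq> sentences L \<and> (\<forall>\<sigma>\<in>sentences L. \<sigma> \<in> T \<longleftrightarrow> Neg \<sigma> \<notin> T)"

definition models :: "('s, 'f, 'r, 'a) fo_structure \<Rightarrow> ('s, 'f, 'r) fm set \<Rightarrow> bool" where
  "models M T \<longleftrightarrow> (\<forall>\<sigma>\<in>T. sat M [] \<sigma>)"

section \<open>Types and the monster model\<close>

text \<open>A formula \<open>\<phi>(x, b)\<close> with parameters is the pair of \<open>\<phi>\<close> and \<open>b\<close>.\<close>

type_synonym ('s, 'f, 'r, 'a) pfm = "('s, 'f, 'r) fm \<times> 'a list"

definition fms_over ::
  "('s, 'f, 'r, 'a) fo_structure \<Rightarrow> 's list \<Rightarrow> 'a set \<Rightarrow> ('s, 'f, 'r, 'a) pfm set" where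
  "fms_over M \<Gamma> A = {(\<phi>, b). set b \<subseteq> A \<and> wf_fm M (\<Gamma> @ map (sort_of M) b) \<phi>}"

fun holds :: "('s, 'f, 'r, 'a) fo_structure \<Rightarrow> 'a list \<Rightarrow> ('s, 'f, 'r, 'a) pfm \<Rightarrow> bool" where
  "holds M a (\<phi>, b) \<longleftrightarrow> sat M (a @ b) \<phi>"

definition realizes ::
  "('s, 'f, 'r, 'a) fo_structure \<Rightarrow> 's list \<Rightarrow> 'a list \<Rightarrow> ('s, 'f, 'r, 'a) pfm set \<Rightarrow> bool" where
  "realizes M \<Gamma> a p \<longleftrightarrow> a \<in> tuples M \<Gamma> \<and> (\<forall>\<chi>\<in>p. holds M a \<chi>)"

definition tp ::
  "('s, 'f, 'r, 'a) fo_structure \<Rightarrow> 'a list \<Rightarrow> 'a set \<Rightarrow> ('s, 'f, 'r, 'a) pfm set" where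
  "tp M a A = {\<chi> \<in> fms_over M (map (sort_of M) a) A. holds M a \<chi>}"

text \<open>The complete types over \<open>A\<close> in variables of sorts \<open>\<Gamma>\<close>.\<close>

definition ctypes ::
  "('s, 'f, 'r, 'a) fo_structure \<Rightarrow> 's list \<Rightarrow> 'a set \<Rightarrow> ('s, 'f, 'r, 'a) pfm set set" where
  "ctypes M \<Gamma> A = {p. p \<subseteq> fms_over M \<Gamma> A \<and>
     (\<forall>F \<subseteq> p. finite F \<longrightarrow> (\<exists>a. realizes M \<Gamma> a F)) \<and>
     (\<forall>(\<phi>, b) \<in> fms_over M \<Gamma> A. (\<phi>, b) \<in> p \<or> (Neg \<phi>, b) \<in> p)}"

definition small :: "'k rel \<Rightarrow> ('s, 'f, 'r, 'a) fo_structure \<Rightarrow> 'a set \<Rightarrow> bool" where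
  "small \<kappa> M A \<longleftrightarrow> A \<subseteq> univ M \<and> |A| <o \<kappa>"

definition saturated :: "'k rel \<Rightarrow> ('s, 'f, 'r, 'a) fo_structure \<Rightarrow> bool" where
  "saturated \<kappa> M \<longleftrightarrow>
     (\<forall>\<Gamma> A p. small \<kappa> M A \<and> p \<in> ctypes M \<Gamma> A \<longrightarrow> (\<exists>a. realizes M \<Gamma> a p))"

definition automorphism :: "('s, 'f, 'r, 'a) fo_structure \<Rightarrow> ('a \<Rightarrow> 'a) \<Rightarrow> bool" where
  "automorphism M g \<longleftrightarrow>
     bij_betw g (univ M) (univ M) \<and>
     (\<forall>a\<in>univ M. sort_of M (g a) = sort_of M a) \<and>
     (\<forall>f \<Delta> s. fun_sig M f = Some (\<Delta>, s) \<longrightarrow>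
        (\<forall>a\<in>tuples M \<Delta>. g (fun_int M f a) = fun_int M f (map g a))) \<and>
     (\<forall>R \<Delta>. rel_sig M R = Some \<Delta> \<longrightarrow>
        (\<forall>a\<in>tuples M \<Delta>. rel_int M R a \<longleftrightarrow> rel_int M R (map g a)))"

definition elementary_on ::
  "('s, 'f, 'r, 'a) fo_structure \<Rightarrow> 'a set \<Rightarrow> ('a \<Rightarrow> 'a) \<Rightarrow> bool" where
  "elementary_on M A h \<longleftrightarrow>
     h ` A \<subseteq> univ M \<and>
     (\<forall>a\<in>A. sort_of M (h a) = sort_of M a) \<and>
     (\<forall>a \<phi>. set a \<subseteq> A \<and> wf_fm M (map (sort_of M) a) \<phi> \<longrightarrow>
        (sat M a \<phi> \<longleftrightarrow> sat M (map h a) \<phi>))"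

definition strongly_homogeneous :: "'k rel \<Rightarrow> ('s, 'f, 'r, 'a) fo_structure \<Rightarrow> bool" where
  "strongly_homogeneous \<kappa> M \<longleftrightarrow>
     (\<forall>A h. small \<kappa> M A \<and> elementary_on M A h \<longrightarrow>
        (\<exists>g. automorphism M g \<and> (\<forall>a\<in>A. g a = h a)))"

text \<open>
  The cardinality of \<open>T\<close> is that of the set of formulas. The degree of saturation of a monster model
  is customarily only required to be large enough. Here it is any \<open>\<kappa> > 2^|T|\<close>; for \<open>\<kappa> = |T|\<^sup>+\<close> the
  condition \<open>|B\<^sub>0| \<le> |T|\<close> in the definition of rosiness would exclude no subset of a small set.
\<close>

definition monster_model ::
  "'k rel \<Rightarrow> ('s, 'f, 'r) fm set \<Rightarrow> ('s, 'f, 'r, 'a) fo_structure \<Rightarrow> bool" where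
  "monster_model \<kappa> T M \<longleftrightarrow>
     wf_structure M \<and> complete_theory M T \<and> models M T \<and>
     Card_order \<kappa> \<and> |Pow (formulas M)| <o \<kappa> \<and>
     saturated \<kappa> M \<and> strongly_homogeneous \<kappa> M"

text \<open>
  \<open>T = T\<^sup>e\<^sup>q\<close>: every equivalence relation on a finite product of sorts that is definable
  without parameters has a sort \<open>s\<close> as its quotient, with quotient map definable without parameters.
\<close>

definition eq_closed :: "('s, 'f, 'r, 'a) fo_structure \<Rightarrow> bool" where
  "eq_closed M \<longleftrightarrow>
     (\<forall>\<Gamma> E. \<Gamma> \<noteq> [] \<and> set \<Gamma> \<subseteq> sorts M \<and> wf_fm M (\<Gamma> @ \<Gamma>) E \<and>
        equiv (tuples M \<Gamma>) {(a, b). a \<in> tuples M \<Gamma> \<and> b \<in> tuples M \<Gamma> \<and> sat M (a @ b) E} \<longrightarrow>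
        (\<exists>s\<in>sorts M. \<exists>\<pi> f. wf_fm M (\<Gamma> @ [s]) \<pi> \<and>
           f ` tuples M \<Gamma> = {c \<in> univ M. sort_of M c = s} \<and>
           (\<forall>a\<in>tuples M \<Gamma>. \<forall>c\<in>univ M. sort_of M c = s \<longrightarrow> (sat M (a @ [c]) \<pi> \<longleftrightarrow> c = f a)) \<and>
           (\<forall>a\<in>tuples M \<Gamma>. \<forall>b\<in>tuples M \<Gamma>. f a = f b \<longleftrightarrow> sat M (a @ b) E)))"

section \<open>Thorn-forking\<close>

definition algebraic :: "('s, 'f, 'r, 'a) fo_structure \<Rightarrow> 'a set \<Rightarrow> 'a list \<Rightarrow> bool" where
  "algebraic M D b \<longleftrightarrow>
     (\<exists>\<chi> \<in> tp M b D. finite {b' \<in> tuples M (map (sort_of M) b). holds M b' \<chi>})"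

definition k_inconsistent ::
  "('s, 'f, 'r, 'a) fo_structure \<Rightarrow> 's list \<Rightarrow> nat \<Rightarrow> ('s, 'f, 'r, 'a) pfm set \<Rightarrow> bool" where
  "k_inconsistent M \<Gamma> k F \<longleftrightarrow>
     (\<forall>S \<subseteq> F. finite S \<and> card S = k \<longrightarrow> \<not> (\<exists>a. realizes M \<Gamma> a S))"

fun strongly_divides ::
  "('s, 'f, 'r, 'a) fo_structure \<Rightarrow> 's list \<Rightarrow> 'a set \<Rightarrow> ('s, 'f, 'r, 'a) pfm \<Rightarrow> bool" where
  "strongly_divides M \<Gamma> D (\<phi>, b) \<longleftrightarrow>
     \<not> algebraic M D b \<and>
     (\<exists>k. k_inconsistent M \<Gamma> k {(\<phi>, b') | b'. realizes M (map (sort_of M) b) b' (tp M b D)})"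

definition thorn_divides ::
  "'k rel \<Rightarrow> ('s, 'f, 'r, 'a) fo_structure \<Rightarrow> 's list \<Rightarrow> 'a set \<Rightarrow> ('s, 'f, 'r, 'a) pfm \<Rightarrow> bool" where
  "thorn_divides \<kappa> M \<Gamma> C \<chi> \<longleftrightarrow> (\<exists>D. small \<kappa> M D \<and> C \<subseteq> D \<and> strongly_divides M \<Gamma> D \<chi>)"

definition thorn_forks_fm ::
  "'k rel \<Rightarrow> ('s, 'f, 'r, 'a) fo_structure \<Rightarrow> 's list \<Rightarrow> 'a set \<Rightarrow> ('s, 'f, 'r, 'a) pfm \<Rightarrow> bool" where
  "thorn_forks_fm \<kappa> M \<Gamma> C \<chi> \<longleftrightarrow>
     (\<exists>\<Psi>. finite \<Psi> \<and> \<Psi> \<subseteq> fms_over M \<Gamma> (univ M) \<and>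
        (\<forall>\<psi>\<in>\<Psi>. thorn_divides \<kappa> M \<Gamma> C \<psi>) \<and>
        (\<forall>a\<in>tuples M \<Gamma>. holds M a \<chi> \<longrightarrow> (\<exists>\<psi>\<in>\<Psi>. holds M a \<psi>)))"

definition thorn_forks ::
  "'k rel \<Rightarrow> ('s, 'f, 'r, 'a) fo_structure \<Rightarrow> 's list \<Rightarrow> 'a set \<Rightarrow> ('s, 'f, 'r, 'a) pfm set \<Rightarrow> bool" where
  "thorn_forks \<kappa> M \<Gamma> A p \<longleftrightarrow> (\<exists>\<chi>\<in>p. thorn_forks_fm \<kappa> M \<Gamma> A \<chi>)"

text \<open>\<open>thorn_indep \<kappa> M a A B\<close> says that \<open>a\<close> is thorn-independent from \<open>B\<close> over \<open>A\<close>.\<close>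

definition thorn_indep ::
  "'k rel \<Rightarrow> ('s, 'f, 'r, 'a) fo_structure \<Rightarrow> 'a list \<Rightarrow> 'a set \<Rightarrow> 'a set \<Rightarrow> bool" where
  "thorn_indep \<kappa> M a A B \<longleftrightarrow> \<not> thorn_forks \<kappa> M (map (sort_of M) a) A (tp M a (A \<union> B))"

definition thorn_indep_family ::
  "'k rel \<Rightarrow> ('s, 'f, 'r, 'a) fo_structure \<Rightarrow> 'a set \<Rightarrow> 'a list list \<Rightarrow> bool" where
  "thorn_indep_family \<kappa> M A bs \<longleftrightarrow>
     (\<forall>i < length bs.
        thorn_indep \<kappa> M (bs ! i) A (\<Union>j \<in> {..<length bs} - {i}. set (bs ! j)))"

definition rosy :: "'k rel \<Rightarrow> ('s, 'f, 'r, 'a) fo_structure \<Rightarrow> bool" where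
  "rosy \<kappa> M \<longleftrightarrow>
     (\<forall>a B. set a \<subseteq> univ M \<and> small \<kappa> M B \<longrightarrow>
        (\<exists>B\<^sub>0 \<subseteq> B. |B\<^sub>0| \<le>o |formulas M| \<and> thorn_indep \<kappa> M a B\<^sub>0 B))"

definition thorn_forking_ext ::
  "'k rel \<Rightarrow> ('s, 'f, 'r, 'a) fo_structure \<Rightarrow> 's list \<Rightarrow> 'a set \<Rightarrow> ('s, 'f, 'r, 'a) pfm set \<Rightarrow>
   'a set \<Rightarrow> ('s, 'f, 'r, 'a) pfm set \<Rightarrow> bool" where
  "thorn_forking_ext \<kappa> M \<Gamma> A p B q \<longleftrightarrow>
     small \<kappa> M B \<and> A \<subseteq> B \<and> q \<in> ctypes M \<Gamma> B \<and> p \<subseteq> q \<and> thorn_forks \<kappa> M \<Gamma> A q"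

definition thorn_nonforking_ext ::
  "'k rel \<Rightarrow> ('s, 'f, 'r, 'a) fo_structure \<Rightarrow> 's list \<Rightarrow> 'a set \<Rightarrow> ('s, 'f, 'r, 'a) pfm set \<Rightarrow>
   'a set \<Rightarrow> ('s, 'f, 'r, 'a) pfm set \<Rightarrow> bool" where
  "thorn_nonforking_ext \<kappa> M \<Gamma> A p B q \<longleftrightarrow>
     small \<kappa> M B \<and> A \<subseteq> B \<and> q \<in> ctypes M \<Gamma> B \<and> p \<subseteq> q \<and> \<not> thorn_forks \<kappa> M \<Gamma> A q"

section \<open>The thorn U-rank\<close>

text \<open>
  The foundation rank of a relation on a set of cardinality \<open>\<lambda>\<close> takes its values in the ordinals
  below \<open>\<lambda>\<^sup>+\<close>, or is undefined (\<open>\<infinity>\<close>). The well-order \<open>rank_ordinals\<close> has order type \<open>\<lambda>\<^sup>+\<close> for the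
  relevant set, that of all complete types over small sets in variables of sorts \<open>\<Gamma>\<close>, so
  that its elements represent all ordinals needed.
\<close>

definition rank_ordinals ::
  "'k rel \<Rightarrow> ('s, 'f, 'r, 'a) fo_structure \<Rightarrow> 's list \<Rightarrow> ('a set \<times> ('s, 'f, 'r, 'a) pfm set) set rel" where
  "rank_ordinals \<kappa> M \<Gamma> = cardSuc |{(A, p). small \<kappa> M A \<and> p \<in> ctypes M \<Gamma> A}|"

definition lt_in :: "'o rel \<Rightarrow> 'o \<Rightarrow> 'o \<Rightarrow> bool" where
  "lt_in r \<alpha> \<beta> \<longleftrightarrow> (\<alpha>, \<beta>) \<in> r \<and> \<alpha> \<noteq> \<beta>"

definition is_zero_in :: "'o rel \<Rightarrow> 'o \<Rightarrow> bool" where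
  "is_zero_in r \<alpha> \<longleftrightarrow> \<alpha> \<in> Field r \<and> (\<nexists>\<beta>. lt_in r \<beta> \<alpha>)"

definition is_succ_in :: "'o rel \<Rightarrow> 'o \<Rightarrow> 'o \<Rightarrow> bool" where
  "is_succ_in r \<alpha> \<beta> \<longleftrightarrow> lt_in r \<alpha> \<beta> \<and> (\<nexists>\<gamma>. lt_in r \<alpha> \<gamma> \<and> lt_in r \<gamma> \<beta>)"

definition is_limit_in :: "'o rel \<Rightarrow> 'o \<Rightarrow> bool" where
  "is_limit_in r \<beta> \<longleftrightarrow> \<beta> \<in> Field r \<and> \<not> is_zero_in r \<beta> \<and> (\<nexists>\<alpha>. is_succ_in r \<alpha> \<beta>)"

text \<open>\<open>Uth_ge \<kappa> M \<Gamma> \<alpha> A p\<close> says that the type \<open>p\<close> over \<open>A\<close> has thorn U-rank at least \<open>\<alpha>\<close>.\<close>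

inductive Uth_ge ::
  "'k rel \<Rightarrow> ('s, 'f, 'r, 'a) fo_structure \<Rightarrow> 's list \<Rightarrow>
   ('a set \<times> ('s, 'f, 'r, 'a) pfm set) set \<Rightarrow> 'a set \<Rightarrow> ('s, 'f, 'r, 'a) pfm set \<Rightarrow> bool"
  for \<kappa> M \<Gamma> where
  zero: "is_zero_in (rank_ordinals \<kappa> M \<Gamma>) \<alpha> \<Longrightarrow> Uth_ge \<kappa> M \<Gamma> \<alpha> A p"
| succ: "is_succ_in (rank_ordinals \<kappa> M \<Gamma>) \<alpha> \<beta> \<Longrightarrow> thorn_forking_ext \<kappa> M \<Gamma> A p B q \<Longrightarrow>
         Uth_ge \<kappa> M \<Gamma> \<alpha> B q \<Longrightarrow> Uth_ge \<kappa> M \<Gamma> \<beta> A p"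
| limit: "is_limit_in (rank_ordinals \<kappa> M \<Gamma>) \<beta> \<Longrightarrow>
         (\<And>\<alpha>. lt_in (rank_ordinals \<kappa> M \<Gamma>) \<alpha> \<beta> \<Longrightarrow> Uth_ge \<kappa> M \<Gamma> \<alpha> A p) \<Longrightarrow>
         Uth_ge \<kappa> M \<Gamma> \<beta> A p"

definition superrosy_type ::
  "'k rel \<Rightarrow> ('s, 'f, 'r, 'a) fo_structure \<Rightarrow> 's list \<Rightarrow> 'a set \<Rightarrow> ('s, 'f, 'r, 'a) pfm set \<Rightarrow> bool" where
  "superrosy_type \<kappa> M \<Gamma> A p \<longleftrightarrow> (\<exists>\<alpha> \<in> Field (rank_ordinals \<kappa> M \<Gamma>). \<not> Uth_ge \<kappa> M \<Gamma> \<alpha> A p)"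

definition superrosy :: "'k rel \<Rightarrow> ('s, 'f, 'r, 'a) fo_structure \<Rightarrow> bool" where
  "superrosy \<kappa> M \<longleftrightarrow>
     (\<forall>\<Gamma> A p. small \<kappa> M A \<and> p \<in> ctypes M \<Gamma> A \<longrightarrow> superrosy_type \<kappa> M \<Gamma> A p)"

section \<open>Thorn-weight, domination and regularity\<close>

definition thorn_weight_ge ::
  "'k rel \<Rightarrow> ('s, 'f, 'r, 'a) fo_structure \<Rightarrow> 's list \<Rightarrow> 'a set \<Rightarrow> ('s, 'f, 'r, 'a) pfm set \<Rightarrow> nat \<Rightarrow> bool" where
  "thorn_weight_ge \<kappa> M \<Gamma> A p n \<longleftrightarrow>
     (\<exists>a B bs. realizes M \<Gamma> a p \<and> small \<kappa> M B \<and> A \<subseteq> B \<and> thorn_indep \<kappa> M a A B \<and>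
        length bs = n \<and> (\<forall>b\<in>set bs. set b \<subseteq> univ M) \<and> thorn_indep_family \<kappa> M B bs \<and>
        (\<forall>b\<in>set bs. \<not> thorn_indep \<kappa> M a B (set b)))"

definition thorn_weight_eq ::
  "'k rel \<Rightarrow> ('s, 'f, 'r, 'a) fo_structure \<Rightarrow> 's list \<Rightarrow> 'a set \<Rightarrow> ('s, 'f, 'r, 'a) pfm set \<Rightarrow> nat \<Rightarrow> bool" where
  "thorn_weight_eq \<kappa> M \<Gamma> A p n \<longleftrightarrow>
     thorn_weight_ge \<kappa> M \<Gamma> A p n \<and> (\<forall>m. thorn_weight_ge \<kappa> M \<Gamma> A p m \<longrightarrow> m \<le> n)"

definition finite_thorn_weight ::
  "'k rel \<Rightarrow> ('s, 'f, 'r, 'a) fo_structure \<Rightarrow> 's list \<Rightarrow> 'a set \<Rightarrow> ('s, 'f, 'r, 'a) pfm set \<Rightarrow> bool" where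
  "finite_thorn_weight \<kappa> M \<Gamma> A p \<longleftrightarrow> (\<exists>n. thorn_weight_eq \<kappa> M \<Gamma> A p n)"

definition thorn_dominates ::
  "'k rel \<Rightarrow> ('s, 'f, 'r, 'a) fo_structure \<Rightarrow> 'a set \<Rightarrow> 'a list \<Rightarrow> 'a list \<Rightarrow> bool" where
  "thorn_dominates \<kappa> M C a b \<longleftrightarrow>
     (\<forall>c. set c \<subseteq> univ M \<longrightarrow>
        \<not> thorn_indep \<kappa> M b C (set c) \<longrightarrow> \<not> thorn_indep \<kappa> M a C (set c))"

definition thorn_dom_equivalent ::
  "'k rel \<Rightarrow> ('s, 'f, 'r, 'a) fo_structure \<Rightarrow> 'a set \<Rightarrow> 'a list \<Rightarrow> 'a list \<Rightarrow> bool" where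
  "thorn_dom_equivalent \<kappa> M C a b \<longleftrightarrow> thorn_dominates \<kappa> M C a b \<and> thorn_dominates \<kappa> M C b a"

text \<open>Here \<open>p\<close> is a type over \<open>A\<close> in variables of sorts \<open>\<Gamma>\<close>, and \<open>q\<close> one over \<open>B\<close> in variables of
  sorts \<open>\<Delta>\<close>.\<close>

definition thorn_equidominant ::
  "'k rel \<Rightarrow> ('s, 'f, 'r, 'a) fo_structure \<Rightarrow>
   's list \<Rightarrow> 'a set \<Rightarrow> ('s, 'f, 'r, 'a) pfm set \<Rightarrow>
   's list \<Rightarrow> 'a set \<Rightarrow> ('s, 'f, 'r, 'a) pfm set \<Rightarrow> bool" where
  "thorn_equidominant \<kappa> M \<Gamma> A p \<Delta> B q \<longleftrightarrow>
     (\<exists>C p' q' a b. thorn_nonforking_ext \<kappa> M \<Gamma> A p C p' \<and> thorn_nonforking_ext \<kappa> M \<Delta> B q C q' \<and>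
        realizes M \<Gamma> a p' \<and> realizes M \<Delta> b q' \<and> thorn_dom_equivalent \<kappa> M C a b)"

definition weakly_thorn_orthogonal ::
  "'k rel \<Rightarrow> ('s, 'f, 'r, 'a) fo_structure \<Rightarrow> 'a set \<Rightarrow>
   's list \<Rightarrow> ('s, 'f, 'r, 'a) pfm set \<Rightarrow> 's list \<Rightarrow> ('s, 'f, 'r, 'a) pfm set \<Rightarrow> bool" where
  "weakly_thorn_orthogonal \<kappa> M B \<Gamma> p \<Delta> q \<longleftrightarrow>
     (\<forall>a b. realizes M \<Gamma> a p \<and> realizes M \<Delta> b q \<longrightarrow> thorn_indep \<kappa> M a B (set b))"

definition thorn_regular ::
  "'k rel \<Rightarrow> ('s, 'f, 'r, 'a) fo_structure \<Rightarrow> 's list \<Rightarrow> 'a set \<Rightarrow> ('s, 'f, 'r, 'a) pfm set \<Rightarrow> bool" where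
  "thorn_regular \<kappa> M \<Gamma> A r \<longleftrightarrow>
     (\<forall>B p q. thorn_forking_ext \<kappa> M \<Gamma> A r B q \<and> thorn_nonforking_ext \<kappa> M \<Gamma> A r B p \<longrightarrow>
        weakly_thorn_orthogonal \<kappa> M B \<Gamma> q \<Gamma> p)"

end

theory Submission
  imports Defs
begin

text \<open>
  The theorem follows from two facts about thorn-independence, read as a ternary relation between
  small sets: in a rosy theory it is a symmetric and transitive relation with extensions, and on
  superrosy types forking extensions are well-founded. Rank enters only through the second fact
  (\<open>superrosy_accessible\<close>): ordinals give way to elements minimal for forking extension.

  Extension (\<open>extension\<close>) and transitivity on the left (\<open>left_transitivity\<close>) hold in every
  theory. The first is compactness. For the second one extends until the sets \<open>D\<close> and the tuples
  \<open>e\<close> that witness forking lie on the right-hand side, and then uses that algebraic dependence is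
  a case of thorn-forking. Symmetry (\<open>symmetry\<close>) needs rosiness. If \<open>A\<close> is independent from \<open>b\<close>
  over \<open>C\<close> but \<open>b\<close> forks with \<open>A\<close>, then witnesses of this forking can be chosen with \<open>De\<close>
  independent from \<open>b\<close> over \<open>C\<close>. Finitely many independent copies of \<open>De\<close>, read in reverse
  order, are such that no copy of \<open>e\<close> is algebraic over its own copy of \<open>D\<close> and the preceding
  copies. By compactness there is such a sequence of length \<open>|T|\<^sup>+\<close>, and \<open>b\<close> forks at every step
  of it, which contradicts local character.

  A regular type has weight at most one (\<open>regular_weight1\<close>), because a tuple with which it forks
  can be replaced by an independent sequence of its own realizations (\<open>morley_dependence\<close>). A type
  that forks with \<open>a\<close> and is minimal for forking extension is regular (\<open>regular_exists\<close>).

  Finite weight (\<open>weight_bounded\<close>): choose a type of infinite weight, realized by \<open>a\<close>, all of whose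
  forking extensions have finite weight, and a regular \<open>d\<close> with which \<open>a\<close> forks. The weight of \<open>a\<close>
  over \<open>d\<close> is a finite number \<open>m\<close>. Hence, in an independent family whose members all fork with
  \<open>a\<close>, any \<open>m + 1\<close> members together fork with \<open>d\<close>; two disjoint blocks of this kind
  contradict that \<open>d\<close> has weight one.

  Decomposition (\<open>regular_decomposition\<close>): starting from a base over which \<open>a\<close> has its full weight
  \<open>n\<close>, adjoin independent realizations \<open>b\<^sub>i\<close> of regular types that fork with \<open>a\<close>, and enlarge the
  base each time so that \<open>a\<close> dominates \<open>a b\<^sub>1 \<dots> b\<^sub>i\<close>; minimality of the type of \<open>b\<^sub>i\<close> over
  \<open>a\<close> and the earlier \<open>b\<^sub>j\<close> achieves this (\<open>decomp_extend\<close>). The weight bounds the number of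
  steps. When no further step is possible, \<open>b\<^sub>1 \<dots> b\<^sub>m\<close> dominates \<open>a\<close>, so that everything that forks
  with \<open>a\<close> forks with \<open>b\<^sub>1 \<dots> b\<^sub>m\<close>, and additivity of weight (\<open>weight_le_length\<close>) gives \<open>m = n\<close>.
\<close>

section \<open>Renaming of variables\<close>

primrec ren_tm :: "(nat \<Rightarrow> nat) \<Rightarrow> 'f tm \<Rightarrow> 'f tm" where
  "ren_tm \<rho> (Var i) = Var (\<rho> i)"
| "ren_tm \<rho> (Fn f ts) = Fn f (map (ren_tm \<rho>) ts)"

primrec ren_fm :: "(nat \<Rightarrow> nat) \<Rightarrow> ('s, 'f, 'r) fm \<Rightarrow> ('s, 'f, 'r) fm" where
  "ren_fm \<rho> Bot = Bot"
| "ren_fm \<rho> (Eq t u) = Eq (ren_tm \<rho> t) (ren_tm \<rho> u)"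
| "ren_fm \<rho> (Rel R ts) = Rel R (map (ren_tm \<rho>) ts)"
| "ren_fm \<rho> (Neg \<phi>) = Neg (ren_fm \<rho> \<phi>)"
| "ren_fm \<rho> (Conj \<phi> \<psi>) = Conj (ren_fm \<rho> \<phi>) (ren_fm \<rho> \<psi>)"
| "ren_fm \<rho> (Ex s \<phi>) = Ex s (ren_fm (case_nat 0 (\<lambda>i. Suc (\<rho> i))) \<phi>)"

lemma has_sort_ren_tm:
  assumes "has_sort L \<Gamma> t s"
    and "\<And>i. i < length \<Gamma> \<Longrightarrow> \<rho> i < length \<Gamma>' \<and> \<Gamma>' ! \<rho> i = \<Gamma> ! i"
  shows "has_sort L \<Gamma>' (ren_tm \<rho> t) s"
  using assms(1)
proof induction
  case (1 i)
  then show ?case using assms(2)[of i] has_sort.intros(1)[of "\<rho> i" \<Gamma>'] by auto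
next
  case (2 f \<Delta> s ts)
  then show ?case
    by (auto intro!: has_sort.intros(2) simp: list_all2_conv_all_nth)
qed

lemma wf_ren_fm:
  assumes "wf_fm L \<Gamma> \<phi>"
    and "\<And>i. i < length \<Gamma> \<Longrightarrow> \<rho> i < length \<Gamma>' \<and> \<Gamma>' ! \<rho> i = \<Gamma> ! i"
  shows "wf_fm L \<Gamma>' (ren_fm \<rho> \<phi>)"
  using assms
proof (induction \<phi> arbitrary: \<Gamma> \<Gamma>' \<rho>)
  case (Eq t u)
  then show ?case using has_sort_ren_tm by (metis ren_fm.simps(2) wf_fm.simps(2))
next
  case (Rel R ts)
  have "has_sort L \<Gamma>' (ren_tm \<rho> t) s" if "has_sort L \<Gamma> t s" for t s
    using has_sort_ren_tm[OF that Rel.prems(2)] by blast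
  then show ?case using Rel.prems(1) by (auto simp: list_all2_conv_all_nth)
next
  case (Ex s \<phi>)
  let ?\<rho> = "case_nat 0 (\<lambda>i. Suc (\<rho> i))"
  have "?\<rho> i < length (s # \<Gamma>') \<and> (s # \<Gamma>') ! ?\<rho> i = (s # \<Gamma>) ! i" if "i < length (s # \<Gamma>)" for i
    using that Ex.prems(2) by (cases i) auto
  from Ex.IH[OF _ this] Ex.prems(1) show ?case by simp
next
  case (Conj \<phi> \<psi>)
  show ?case using Conj.IH(1)[OF _ Conj.prems(2)] Conj.IH(2)[OF _ Conj.prems(2)] Conj.prems(1) by simp
next
  case (Neg \<phi>)
  show ?case using Neg.IH[OF _ Neg.prems(2)] Neg.prems(1) by simp
qed auto

lemma eval_ren_tm:
  assumes "has_sort L \<Gamma> t s" and "\<And>i. i < length \<Gamma> \<Longrightarrow> e' ! i = e ! \<rho> i"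
  shows "eval_tm M e (ren_tm \<rho> t) = eval_tm M e' t"
  using assms(1)
proof induction
  case (2 f \<Delta> s ts)
  then have "map (eval_tm M e \<circ> ren_tm \<rho>) ts = map (eval_tm M e') ts"
    by (auto simp: list_all2_conv_all_nth list_eq_iff_nth_eq)
  then show ?case by (simp only: ren_tm.simps eval_tm.simps map_map)
qed (use assms(2) in auto)

lemma sat_ren_fm:
  assumes "wf_fm L \<Gamma> \<phi>" and "\<And>i. i < length \<Gamma> \<Longrightarrow> e' ! i = e ! \<rho> i"
  shows "sat M e (ren_fm \<rho> \<phi>) \<longleftrightarrow> sat M e' \<phi>"
  using assms
proof (induction \<phi> arbitrary: \<Gamma> e e' \<rho>)
  case (Eq t u)
  then show ?case using eval_ren_tm by (metis ren_fm.simps(2) sat.simps(2) wf_fm.simps(2))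
next
  case (Rel R ts)
  have "eval_tm M e (ren_tm \<rho> t) = eval_tm M e' t" if "has_sort L \<Gamma> t s" for t s
    using eval_ren_tm[OF that Rel.prems(2)] by blast
  then have "map (eval_tm M e \<circ> ren_tm \<rho>) ts = map (eval_tm M e') ts"
    using Rel.prems(1) by (auto simp: list_all2_conv_all_nth list_eq_iff_nth_eq)
  then show ?case by (simp only: ren_fm.simps sat.simps map_map)
next
  case (Neg \<phi>)
  have "wf_fm L \<Gamma> \<phi>" using Neg.prems(1) by simp
  then show ?case using Neg.IH[OF _ Neg.prems(2)] by simp
next
  case (Conj \<phi> \<psi>)
  have "wf_fm L \<Gamma> \<phi>" "wf_fm L \<Gamma> \<psi>" using Conj.prems(1) by simp_all
  then show ?case using Conj.IH(1)[OF _ Conj.prems(2)] Conj.IH(2)[OF _ Conj.prems(2)] by simp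
next
  case (Ex s \<phi>)
  let ?\<rho> = "case_nat 0 (\<lambda>i. Suc (\<rho> i))"
  have "sat M (x # e) (ren_fm ?\<rho> \<phi>) \<longleftrightarrow> sat M (x # e') \<phi>" for x
  proof (rule Ex.IH)
    show "wf_fm L (s # \<Gamma>) \<phi>" using Ex.prems by simp
    show "(x # e') ! i = (x # e) ! ?\<rho> i" if "i < length (s # \<Gamma>)" for i
      using that Ex.prems(2) by (cases i) auto
  qed
  then show ?case by simp
qed auto

section \<open>Definable sets\<close>

lemma in_tuples_append:
  "a @ b \<in> tuples M (\<Gamma> @ \<Delta>) \<longleftrightarrow> a \<in> tuples M \<Gamma> \<and> b \<in> tuples M \<Delta>"
  if "length a = length \<Gamma>"
  using that by (auto simp: tuples_def)

lemma tuples_Cons: "x # a \<in> tuples M (s # \<Gamma>) \<longleftrightarrow> x \<in> univ M \<and> sort_of M x = s \<and> a \<in> tuples M \<Gamma>"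
  by (auto simp: tuples_def)

lemma tuples_length: "a \<in> tuples M \<Gamma> \<Longrightarrow> length a = length \<Gamma>"
  by (auto simp: tuples_def)

lemma tuples_appendE:
  assumes "c \<in> tuples M (\<Gamma> @ \<Delta>)"
  obtains a b where "c = a @ b" "a \<in> tuples M \<Gamma>" "b \<in> tuples M \<Delta>"
proof
  show "c = take (length \<Gamma>) c @ drop (length \<Gamma>) c" by simp
  show "take (length \<Gamma>) c \<in> tuples M \<Gamma>"
    using assms by (auto simp: tuples_def take_map[symmetric] dest: in_set_takeD)
  show "drop (length \<Gamma>) c \<in> tuples M \<Delta>"
    using assms by (auto simp: tuples_def drop_map[symmetric] dest: in_set_dropD)
qed

lemma in_tuples_self: "set a \<subseteq> univ M \<Longrightarrow> a \<in> tuples M (map (sort_of M) a)"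
  by (simp add: tuples_def)

text \<open>Formulas with parameters are replaced by the sets that they define. The closure properties
  below turn manipulations of formulas into ones of sets.\<close>

definition dfn :: "('s, 'f, 'r, 'a) fo_structure \<Rightarrow> 'a set \<Rightarrow> 's list \<Rightarrow> 'a list set \<Rightarrow> bool" where
  "dfn M A \<Gamma> X \<longleftrightarrow> (\<exists>\<chi> \<in> fms_over M \<Gamma> A. X = {a \<in> tuples M \<Gamma>. holds M a \<chi>})"

lemma dfnE:
  assumes "dfn M A \<Gamma> X"
  obtains \<phi> b where "set b \<subseteq> A" "wf_fm M (\<Gamma> @ map (sort_of M) b) \<phi>"
    "X = {a \<in> tuples M \<Gamma>. sat M (a @ b) \<phi>}"
  using assms unfolding dfn_def fms_over_def by auto

lemma dfnI:
  assumes "set b \<subseteq> A" "wf_fm M (\<Gamma> @ map (sort_of M) b) \<phi>"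
    "X = {a \<in> tuples M \<Gamma>. sat M (a @ b) \<phi>}"
  shows "dfn M A \<Gamma> X"
  unfolding dfn_def fms_over_def using assms by (intro bexI[of _ "(\<phi>, b)"]) auto

lemma dfn_subset_tuples: "dfn M A \<Gamma> X \<Longrightarrow> X \<subseteq> tuples M \<Gamma>"
  by (auto simp: dfn_def)

lemma dfn_mono: "dfn M A \<Gamma> X \<Longrightarrow> A \<subseteq> B \<Longrightarrow> dfn M B \<Gamma> X"
  unfolding dfn_def fms_over_def by blast

lemma dfn_tuples: "dfn M A \<Gamma> (tuples M \<Gamma>)"
  by (rule dfnI[of "[]" _ _ _ "Neg Bot"]) auto

lemma dfn_compl: "dfn M A \<Gamma> X \<Longrightarrow> dfn M A \<Gamma> (tuples M \<Gamma> - X)"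
  by (erule dfnE, rule dfnI[where \<phi> = "Neg _"]) auto

text \<open>Every substitution needed later is an instance of this one: the coordinates of a tuple of
  \<open>X\<close> are read off, at the positions \<open>vs\<close>, from another tuple \<open>a\<close> followed by parameters \<open>c\<close>.\<close>

lemma dfn_subst:
  assumes "dfn M A \<Gamma> X" and A: "A \<subseteq> B" "set c \<subseteq> B" "B \<subseteq> univ M"
    and vs: "\<And>i. i \<in> set vs \<Longrightarrow> i < length \<Gamma>' + length c"
      "map ((!) (\<Gamma>' @ map (sort_of M) c)) vs = \<Gamma>"
  shows "dfn M B \<Gamma>' {a \<in> tuples M \<Gamma>'. map ((!) (a @ c)) vs \<in> X}"
proof -
  from assms(1) obtain \<phi> b where b: "set b \<subseteq> A" "wf_fm M (\<Gamma> @ map (sort_of M) b) \<phi>"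
    "X = {a \<in> tuples M \<Gamma>. sat M (a @ b) \<phi>}" by (rule dfnE)
  let ?n = "length \<Gamma>'" and ?m = "length c"
  have len: "length vs = length \<Gamma>" using vs(2) by auto
  define \<rho> where "\<rho> i = (if i < length \<Gamma> then vs ! i else ?n + ?m + (i - length \<Gamma>))" for i
  have vsn: "(\<Gamma>' @ map (sort_of M) c) ! (vs ! i) = \<Gamma> ! i" if "i < length \<Gamma>" for i
    using vs(2) that len by (metis nth_map)
  have vsl: "vs ! i < ?n + ?m" if "i < length \<Gamma>" for i
    using vs(1) that len by simp
  show ?thesis
  proof (rule dfnI)
    show "set (c @ b) \<subseteq> B" using b A by auto
    show "wf_fm M (\<Gamma>' @ map (sort_of M) (c @ b)) (ren_fm \<rho> \<phi>)"
    proof (rule wf_ren_fm[OF b(2)])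
      fix i assume i: "i < length (\<Gamma> @ map (sort_of M) b)"
      show "\<rho> i < length (\<Gamma>' @ map (sort_of M) (c @ b)) \<and>
        (\<Gamma>' @ map (sort_of M) (c @ b)) ! \<rho> i = (\<Gamma> @ map (sort_of M) b) ! i"
      proof (cases "i < length \<Gamma>")
        case True
        then have "(\<Gamma>' @ map (sort_of M) (c @ b)) ! (vs ! i) = \<Gamma> ! i"
          using vsn[OF True] vsl[OF True]
          by (simp add: nth_append_left flip: append_assoc)
        then show ?thesis using True vsl[OF True] by (simp add: \<rho>_def nth_append)
      next
        case False
        then have "(\<Gamma>' @ map (sort_of M) (c @ b)) ! \<rho> i = map (sort_of M) b ! (i - length \<Gamma>)"
          by (simp add: \<rho>_def nth_append_right flip: append_assoc)
        then show ?thesis using False i by (simp add: \<rho>_def nth_append)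
      qed
    qed
    show "{a \<in> tuples M \<Gamma>'. map ((!) (a @ c)) vs \<in> X} =
        {a \<in> tuples M \<Gamma>'. sat M (a @ (c @ b)) (ren_fm \<rho> \<phi>)}"
    proof (rule Collect_cong, rule conj_cong[OF refl])
      fix a assume a: "a \<in> tuples M \<Gamma>'"
      then have la: "length a = ?n" by (rule tuples_length)
      have sa: "map (sort_of M) a = \<Gamma>'" using a by (simp add: tuples_def)
      have "map ((!) (a @ c)) vs \<in> tuples M \<Gamma>"
      proof -
        have "set (map ((!) (a @ c)) vs) \<subseteq> set (a @ c)"
        proof -
          have "(a @ c) ! j \<in> set (a @ c)" if "j \<in> set vs" for j
            using vs(1)[OF that] la by (intro nth_mem) simp
          then show ?thesis by auto
        qed
        also have "\<dots> \<subseteq> univ M" using a A by (auto simp: tuples_def)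
        finally have 1: "set (map ((!) (a @ c)) vs) \<subseteq> univ M" .
        have "map (sort_of M) (map ((!) (a @ c)) vs) = map ((!) (map (sort_of M) (a @ c))) vs"
          using vs(1) la by (auto simp: nth_append less_diff_conv2 add.commute dest!: vs(1))
        then show ?thesis using 1 vs(2) sa by (simp add: tuples_def)
      qed
      moreover have "sat M (a @ (c @ b)) (ren_fm \<rho> \<phi>) \<longleftrightarrow> sat M (map ((!) (a @ c)) vs @ b) \<phi>"
      proof (rule sat_ren_fm[OF b(2)])
        fix i assume i: "i < length (\<Gamma> @ map (sort_of M) b)"
        show "(map ((!) (a @ c)) vs @ b) ! i = (a @ c @ b) ! \<rho> i"
        proof (cases "i < length \<Gamma>")
          case True
          then show ?thesis using vsl[OF True] la len
            by (simp add: \<rho>_def nth_append_left flip: append_assoc)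
        next
          case False
          then show ?thesis using i la len
            by (simp add: \<rho>_def nth_append_right flip: append_assoc)
        qed
      qed
      ultimately show "map ((!) (a @ c)) vs \<in> X \<longleftrightarrow> sat M (a @ (c @ b)) (ren_fm \<rho> \<phi>)"
        using b(3) by simp
    qed
  qed
qed

lemma dfn_reindex:
  assumes "dfn M A \<Gamma> X" "A \<subseteq> univ M"
    and "\<And>i. i \<in> set vs \<Longrightarrow> i < length \<Gamma>'" "map ((!) \<Gamma>') vs = \<Gamma>"
  shows "dfn M A \<Gamma>' {a \<in> tuples M \<Gamma>'. map ((!) a) vs \<in> X}"
  using dfn_subst[OF assms(1) order_refl, of "[]" vs \<Gamma>'] assms by simp

text \<open>The next two facts move parameters into and out of a definable set.\<close>

lemma dfn_fibre:
  assumes "dfn M A (\<Gamma> @ \<Delta>) Y" "A \<subseteq> B" "B \<subseteq> univ M" "set b \<subseteq> B" "map (sort_of M) b = \<Delta>"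
  shows "dfn M B \<Gamma> {a \<in> tuples M \<Gamma>. a @ b \<in> Y}"
proof -
  have "dfn M B \<Gamma> {a \<in> tuples M \<Gamma>. map ((!) (a @ b)) [0..<length \<Gamma> + length b] \<in> Y}"
  proof (rule dfn_subst[OF assms(1,2,4,3)])
    show "map ((!) (\<Gamma> @ map (sort_of M) b)) [0..<length \<Gamma> + length b] = \<Gamma> @ \<Delta>"
      using map_nth[of "\<Gamma> @ map (sort_of M) b"] assms(5) by (metis length_append length_map)
  qed auto
  also have "{a \<in> tuples M \<Gamma>. map ((!) (a @ b)) [0..<length \<Gamma> + length b] \<in> Y} = {a \<in> tuples M \<Gamma>. a @ b \<in> Y}"
  proof (rule Collect_cong, rule conj_cong[OF refl])
    fix a assume "a \<in> tuples M \<Gamma>"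
    then show "map ((!) (a @ b)) [0..<length \<Gamma> + length b] \<in> Y \<longleftrightarrow> a @ b \<in> Y"
      using map_nth[of "a @ b"] by (simp add: tuples_length)
  qed
  finally show ?thesis .
qed

lemma dfn_fibreE:
  assumes "dfn M A \<Gamma> X" "A \<subseteq> univ M"
  obtains b Y where "set b \<subseteq> A" "dfn M {} (\<Gamma> @ map (sort_of M) b) Y"
    "X = {a \<in> tuples M \<Gamma>. a @ b \<in> Y}"
proof -
  from assms(1) obtain \<phi> b where b: "set b \<subseteq> A" "wf_fm M (\<Gamma> @ map (sort_of M) b) \<phi>"
    "X = {a \<in> tuples M \<Gamma>. sat M (a @ b) \<phi>}" by (rule dfnE)
  show ?thesis
  proof
    show "set b \<subseteq> A" by fact
    show "dfn M {} (\<Gamma> @ map (sort_of M) b) {c \<in> tuples M (\<Gamma> @ map (sort_of M) b). sat M c \<phi>}"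
      using b by (intro dfnI[of "[]" _ _ _ \<phi>]) auto
    show "X = {a \<in> tuples M \<Gamma>. a @ b \<in> {c \<in> tuples M (\<Gamma> @ map (sort_of M) b). sat M c \<phi>}}"
      using b assms(2) by (auto simp: tuples_def)
  qed
qed

lemma dfn_inter:
  assumes "dfn M A \<Gamma> X" "dfn M A \<Gamma> Y"
  shows "dfn M A \<Gamma> (X \<inter> Y)"
proof -
  from assms(1) obtain \<phi> b where b: "set b \<subseteq> A" "wf_fm M (\<Gamma> @ map (sort_of M) b) \<phi>"
    "X = {a \<in> tuples M \<Gamma>. sat M (a @ b) \<phi>}" by (rule dfnE)
  from assms(2) obtain \<psi> c where c: "set c \<subseteq> A" "wf_fm M (\<Gamma> @ map (sort_of M) c) \<psi>"
    "Y = {a \<in> tuples M \<Gamma>. sat M (a @ c) \<psi>}" by (rule dfnE)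
  let ?\<rho> = "\<lambda>i. if i < length \<Gamma> then i else i + length b"
  show ?thesis
  proof (rule dfnI)
    show "set (b @ c) \<subseteq> A" using b c by auto
    have "wf_fm M (\<Gamma> @ map (sort_of M) (b @ c)) (ren_fm id \<phi>)"
      by (rule wf_ren_fm[OF b(2)]) (auto simp: nth_append)
    moreover have "wf_fm M (\<Gamma> @ map (sort_of M) (b @ c)) (ren_fm ?\<rho> \<psi>)"
      by (rule wf_ren_fm[OF c(2)]) (auto simp: nth_append)
    ultimately show "wf_fm M (\<Gamma> @ map (sort_of M) (b @ c)) (Conj (ren_fm id \<phi>) (ren_fm ?\<rho> \<psi>))"
      by simp
    have "sat M (a @ b @ c) (ren_fm id \<phi>) \<longleftrightarrow> sat M (a @ b) \<phi>" if "a \<in> tuples M \<Gamma>" for a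
      by (rule sat_ren_fm[OF b(2)]) (use that in \<open>auto simp: nth_append dest!: tuples_length\<close>)
    moreover have "sat M (a @ b @ c) (ren_fm ?\<rho> \<psi>) \<longleftrightarrow> sat M (a @ c) \<psi>" if "a \<in> tuples M \<Gamma>" for a
      by (rule sat_ren_fm[OF c(2)]) (use that in \<open>auto simp: nth_append dest!: tuples_length\<close>)
    ultimately show "X \<inter> Y = {a \<in> tuples M \<Gamma>. sat M (a @ b @ c) (Conj (ren_fm id \<phi>) (ren_fm ?\<rho> \<psi>))}"
      unfolding b(3) c(3) by auto
  qed
qed

lemma dfn_diff:
  assumes "dfn M A \<Gamma> X" "dfn M A \<Gamma> Y"
  shows "dfn M A \<Gamma> (X - Y)"
proof -
  have "X - Y = X \<inter> (tuples M \<Gamma> - Y)" using dfn_subset_tuples[OF assms(1)] by auto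
  then show ?thesis using dfn_inter[OF assms(1) dfn_compl[OF assms(2)]] by simp
qed

lemma dfn_Inter:
  assumes "finite I" "\<And>i. i \<in> I \<Longrightarrow> dfn M A \<Gamma> (X i)"
  shows "dfn M A \<Gamma> {a \<in> tuples M \<Gamma>. \<forall>i\<in>I. a \<in> X i}"
  using assms
proof (induction I)
  case empty
  show ?case using dfn_tuples by simp
next
  case (insert j I)
  then have "dfn M A \<Gamma> ({a \<in> tuples M \<Gamma>. \<forall>i\<in>I. a \<in> X i} \<inter> X j)" by (intro dfn_inter) auto
  moreover have "X j \<subseteq> tuples M \<Gamma>" using insert.prems dfn_subset_tuples by blast
  then have "{a \<in> tuples M \<Gamma>. \<forall>i\<in>I. a \<in> X i} \<inter> X j = {a \<in> tuples M \<Gamma>. \<forall>i\<in>insert j I. a \<in> X i}" by auto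
  ultimately show ?case by simp
qed

lemma dfn_ex:
  assumes "dfn M A (\<Delta> @ \<Gamma>) X" "set \<Delta> \<subseteq> sorts M"
  shows "dfn M A \<Gamma> {a \<in> tuples M \<Gamma>. \<exists>d \<in> tuples M \<Delta>. d @ a \<in> X}"
  using assms
proof (induction \<Delta> arbitrary: X)
  case Nil
  have "{a \<in> tuples M \<Gamma>. \<exists>d \<in> tuples M []. d @ a \<in> X} = X"
    using dfn_subset_tuples[OF Nil(1)] by (auto simp: tuples_def)
  then show ?case using Nil by simp
next
  case (Cons s \<Delta>)
  from Cons.prems(1) obtain \<phi> b where b: "set b \<subseteq> A" "wf_fm M (s # (\<Delta> @ \<Gamma>) @ map (sort_of M) b) \<phi>"
    "X = {a \<in> tuples M (s # (\<Delta> @ \<Gamma>)). sat M (a @ b) \<phi>}" by (auto elim: dfnE)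
  let ?Y = "{a \<in> tuples M (\<Delta> @ \<Gamma>). \<exists>x. x # a \<in> X}"
  have "dfn M A (\<Delta> @ \<Gamma>) ?Y"
  proof (rule dfnI)
    show "wf_fm M ((\<Delta> @ \<Gamma>) @ map (sort_of M) b) (Ex s \<phi>)" using b Cons.prems(2) by simp
    show "?Y = {a \<in> tuples M (\<Delta> @ \<Gamma>). sat M (a @ b) (Ex s \<phi>)}"
      unfolding b(3) by (auto simp: tuples_Cons)
  qed (rule b(1))
  then have "dfn M A \<Gamma> {a \<in> tuples M \<Gamma>. \<exists>d \<in> tuples M \<Delta>. d @ a \<in> ?Y}"
    using Cons.prems(2) by (intro Cons.IH) auto
  also have "{a \<in> tuples M \<Gamma>. \<exists>d \<in> tuples M \<Delta>. d @ a \<in> ?Y} =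
      {a \<in> tuples M \<Gamma>. \<exists>d \<in> tuples M (s # \<Delta>). d @ a \<in> X}" (is "?L = ?R")
  proof
    show "?L \<subseteq> ?R"
    proof
      fix a assume "a \<in> ?L"
      then obtain d x where d: "a \<in> tuples M \<Gamma>" "d \<in> tuples M \<Delta>" "x # d @ a \<in> X" by auto
      then have "x # d \<in> tuples M (s # \<Delta>)"
        using dfn_subset_tuples[OF Cons.prems(1)] by (auto simp: tuples_Cons)
      then show "a \<in> ?R" using d by force
    qed
    show "?R \<subseteq> ?L"
    proof
      fix a assume "a \<in> ?R"
      then obtain e where e: "a \<in> tuples M \<Gamma>" "e \<in> tuples M (s # \<Delta>)" "e @ a \<in> X" by auto
      then obtain x d where "e = x # d" by (cases e) (auto simp: tuples_def)
      then have "d \<in> tuples M \<Delta>" "x # d @ a \<in> X" using e by (auto simp: tuples_Cons)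
      then show "a \<in> ?L" using e(1) in_tuples_append[OF tuples_length, of d M \<Delta> a M \<Gamma>] by blast
    qed
  qed
  finally show ?case .
qed

lemma dfn_eq_coords:
  assumes "i < length \<Gamma>" "j < length \<Gamma>" "\<Gamma> ! i = \<Gamma> ! j"
  shows "dfn M A \<Gamma> {a \<in> tuples M \<Gamma>. a ! i = a ! j}"
proof (rule dfnI[of "[]"])
  show "wf_fm M (\<Gamma> @ map (sort_of M) []) (Eq (Var i) (Var j))"
    using has_sort.intros(1)[of i \<Gamma> M] has_sort.intros(1)[of j \<Gamma> M] assms by auto
qed auto

lemma dfn_eq_tuples:
  "dfn M A (\<Delta> @ \<Delta> @ \<Gamma>) {c \<in> tuples M (\<Delta> @ \<Delta> @ \<Gamma>). take (length \<Delta>) c = take (length \<Delta>) (drop (length \<Delta>) c)}"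
proof -
  let ?n = "length \<Delta>"
  have "dfn M A (\<Delta> @ \<Delta> @ \<Gamma>)
    {c \<in> tuples M (\<Delta> @ \<Delta> @ \<Gamma>). \<forall>i\<in>{..<?n}. c \<in> {c \<in> tuples M (\<Delta> @ \<Delta> @ \<Gamma>). c ! i = c ! (?n + i)}}"
    by (intro dfn_Inter dfn_eq_coords) (auto simp: nth_append)
  also have "{c \<in> tuples M (\<Delta> @ \<Delta> @ \<Gamma>). \<forall>i\<in>{..<?n}. c \<in> {c \<in> tuples M (\<Delta> @ \<Delta> @ \<Gamma>). c ! i = c ! (?n + i)}} =
    {c \<in> tuples M (\<Delta> @ \<Delta> @ \<Gamma>). take ?n c = take ?n (drop ?n c)}"
  proof (rule Collect_cong, rule conj_cong[OF refl])
    fix c assume c: "c \<in> tuples M (\<Delta> @ \<Delta> @ \<Gamma>)"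
    then have "length c = ?n + (?n + length \<Gamma>)" by (simp add: tuples_length)
    then have l: "length (take ?n c) = ?n" "length (take ?n (drop ?n c)) = ?n" by simp_all
    have "take ?n c = take ?n (drop ?n c) \<longleftrightarrow>
        (\<forall>i<?n. take ?n c ! i = take ?n (drop ?n c) ! i)"
      by (simp only: list_eq_iff_nth_eq[of "take ?n c"] l simp_thms)
    also have "\<dots> \<longleftrightarrow> (\<forall>i<?n. c ! i = c ! (?n + i))"
      using l by (intro all_cong) simp
    finally have "take ?n c = take ?n (drop ?n c) \<longleftrightarrow> (\<forall>i<?n. c ! i = c ! (?n + i))" .
    then show "(\<forall>i\<in>{..<?n}. c \<in> {c \<in> tuples M (\<Delta> @ \<Delta> @ \<Gamma>). c ! i = c ! (?n + i)}) \<longleftrightarrow>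
        take ?n c = take ?n (drop ?n c)"
      using c by auto
  qed
  finally show ?thesis .
qed

lemma dfn_singleton:
  assumes "set b \<subseteq> A" "A \<subseteq> univ M"
  shows "dfn M A (map (sort_of M) b) {b}"
proof -
  let ?\<Delta> = "map (sort_of M) b"
  let ?E = "{c \<in> tuples M (?\<Delta> @ ?\<Delta> @ []). take (length ?\<Delta>) c = take (length ?\<Delta>) (drop (length ?\<Delta>) c)}"
  have "dfn M A (?\<Delta> @ ?\<Delta>) ?E" using dfn_eq_tuples[of M A ?\<Delta> "[]"] by simp
  from dfn_fibre[OF this order_refl assms(2,1) refl]
  have "dfn M A ?\<Delta> {a \<in> tuples M ?\<Delta>. a @ b \<in> ?E}" .
  also have "{a \<in> tuples M ?\<Delta>. a @ b \<in> ?E} = {b}"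
    using assms by (auto simp: tuples_def dest: map_eq_imp_length_eq)
  finally show ?thesis .
qed

lemma map_nth_skip:
  assumes "length d' = n" "length d = n" "length a = m"
  shows "map ((!) (d' @ d @ a)) ([0..<n] @ [n + n..<n + n + m]) = d' @ a"
  using assms by (auto simp: list_eq_iff_nth_eq nth_append)

text \<open>By induction on \<open>n\<close>: there are \<open>n + 1\<close> solutions iff there is a solution \<open>d\<close> for which the
  formula that also excludes \<open>d\<close> has \<open>n\<close> solutions.\<close>

lemma dfn_at_least:
  assumes "dfn M A (\<Delta> @ \<Gamma>) Y" "set \<Delta> \<subseteq> sorts M" "A \<subseteq> univ M"
  shows "dfn M A \<Gamma> {a \<in> tuples M \<Gamma>. \<exists>S \<subseteq> tuples M \<Delta>. finite S \<and> card S = n \<and> (\<forall>d\<in>S. d @ a \<in> Y)}"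
  using assms
proof (induction n arbitrary: \<Gamma> Y)
  case 0
  have "{a \<in> tuples M \<Gamma>. \<exists>S \<subseteq> tuples M \<Delta>. finite S \<and> card S = 0 \<and> (\<forall>d\<in>S. d @ a \<in> Y)} = tuples M \<Gamma>"
    by (auto intro!: exI[of _ "{}"])
  then show ?case using dfn_tuples by metis
next
  case (Suc n)
  let ?n = "length \<Delta>" and ?m = "length \<Gamma>"
  let ?vs = "[0..<?n] @ [?n + ?n..<?n + ?n + ?m]"
  let ?Y1 = "{c \<in> tuples M (\<Delta> @ \<Delta> @ \<Gamma>). map ((!) c) ?vs \<in> Y}"
  have Y1: "dfn M A (\<Delta> @ \<Delta> @ \<Gamma>) ?Y1"
    using Suc.prems by (intro dfn_reindex[OF Suc.prems(1)]) (auto simp: map_nth_skip simp del: map_append)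
  let ?E = "{c \<in> tuples M (\<Delta> @ \<Delta> @ \<Gamma>). take ?n c = take ?n (drop ?n c)}"
  let ?Z = "?Y1 - ?E"
  have Z: "dfn M A (\<Delta> @ (\<Delta> @ \<Gamma>)) ?Z" using dfn_diff[OF Y1 dfn_eq_tuples] by simp
  have inZ: "d' @ d @ a \<in> ?Z \<longleftrightarrow> d' @ a \<in> Y \<and> d' \<noteq> d"
    if "d' \<in> tuples M \<Delta>" "d \<in> tuples M \<Delta>" "a \<in> tuples M \<Gamma>" for d d' a
    using that by (simp add: tuples_length in_tuples_append map_nth_skip del: map_append)
  let ?W = "{c \<in> tuples M (\<Delta> @ \<Gamma>). \<exists>S \<subseteq> tuples M \<Delta>. finite S \<and> card S = n \<and> (\<forall>d\<in>S. d @ c \<in> ?Z)}"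
  have W: "dfn M A (\<Delta> @ \<Gamma>) (?W \<inter> Y)" using Suc.IH[OF Z Suc.prems(2,3)] Suc.prems(1) by (rule dfn_inter)
  have "{a \<in> tuples M \<Gamma>. \<exists>d \<in> tuples M \<Delta>. d @ a \<in> ?W \<inter> Y} =
    {a \<in> tuples M \<Gamma>. \<exists>S \<subseteq> tuples M \<Delta>. finite S \<and> card S = Suc n \<and> (\<forall>d\<in>S. d @ a \<in> Y)}" (is "?L = ?R")
  proof
    show "?L \<subseteq> ?R"
    proof
      fix a assume "a \<in> ?L"
      then obtain d S where a: "a \<in> tuples M \<Gamma>" and d: "d \<in> tuples M \<Delta>" "d @ a \<in> Y"
        and S: "S \<subseteq> tuples M \<Delta>" "finite S" "card S = n" "\<forall>d'\<in>S. d' @ d @ a \<in> ?Z" by blast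
      have S': "d' @ a \<in> Y \<and> d' \<noteq> d" if "d' \<in> S" for d'
        using S(4) that inZ[of d' d a] S(1) a d by blast
      then have "d \<notin> S" by blast
      then have "card (insert d S) = Suc n" using S by simp
      then show "a \<in> ?R" using a d S S' by (intro CollectI conjI exI[of _ "insert d S"]) auto
    qed
    show "?R \<subseteq> ?L"
    proof
      fix a assume "a \<in> ?R"
      then obtain S where a: "a \<in> tuples M \<Gamma>" and S: "S \<subseteq> tuples M \<Delta>" "finite S" "card S = Suc n"
        "\<forall>d\<in>S. d @ a \<in> Y" by blast
      then obtain d where d: "d \<in> S" by (metis card_eq_SucD insertI1)
      have "d \<in> tuples M \<Delta>" using d S by auto
      moreover have "d @ a \<in> Y" using d S by auto
      moreover have "d @ a \<in> ?W"
      proof (intro CollectI conjI exI[of _ "S - {d}"])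
        show "d @ a \<in> tuples M (\<Delta> @ \<Gamma>)" using a \<open>d \<in> tuples M \<Delta>\<close> by (simp add: in_tuples_append tuples_length)
        show "\<forall>d'\<in>S - {d}. d' @ d @ a \<in> ?Z"
        proof
          fix d' assume d': "d' \<in> S - {d}"
          then have "d' \<in> tuples M \<Delta>" "d' @ a \<in> Y" "d' \<noteq> d" using S by auto
          then show "d' @ d @ a \<in> ?Z" using inZ[of d' d a] a \<open>d \<in> tuples M \<Delta>\<close> by blast
        qed
      qed (use S d in auto)
      ultimately show "a \<in> ?L" using a by blast
    qed
  qed
  then show ?case using dfn_ex[OF W Suc.prems(2)] by simp
qed

section \<open>The monster model\<close>

locale monster =
  fixes \<kappa> :: "'k rel" and T :: "('s, 'f, 'r) fm set" and M :: "('s, 'f, 'r, 'a) fo_structure"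
  assumes monster_model: "monster_model \<kappa> T M"
begin

lemma wf_structure: "wf_structure M" and Card_order_kappa: "Card_order \<kappa>"
  and Pow_formulas_less: "|Pow (formulas M)| <o \<kappa>"
  and saturated: "saturated \<kappa> M" and homogeneous: "strongly_homogeneous \<kappa> M"
  using monster_model by (auto simp: monster_model_def)

abbreviation "U \<equiv> univ M"
abbreviation "srt \<equiv> sort_of M"
abbreviation "sml \<equiv> small \<kappa> M"

lemma sort_in: "x \<in> U \<Longrightarrow> srt x \<in> sorts M"
  using wf_structure by (auto simp: wf_structure_def)

section \<open>Small sets\<close>

lemma infinite_formulas: "infinite (formulas M)"
proof -
  have "(Neg ^^ n) Bot \<in> formulas M" for n
    unfolding formulas_def by (induction n) (auto intro: exI[of _ "[]"])
  moreover have "m = n" if "(Neg ^^ m) (Bot :: ('s, 'f, 'r) fm) = (Neg ^^ n) Bot" for m n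
    using that
  proof (induction m arbitrary: n)
    case 0
    then show ?case by (cases n) auto
  next
    case (Suc m)
    then show ?case by (cases n) auto
  qed
  then have "inj (\<lambda>n. (Neg ^^ n) (Bot :: ('s, 'f, 'r) fm))" by (rule injI)
  ultimately show ?thesis using infinite_iff_countable_subset by blast
qed

lemma infinite_kappa: "infinite (Field \<kappa>)"
proof
  assume "finite (Field \<kappa>)"
  moreover have "|Pow (formulas M)| \<le>o |Field \<kappa>|"
    using Pow_formulas_less Card_order_kappa
    by (meson card_of_Field_ordIso ordIso_symmetric ordLess_imp_ordLeq ordLeq_ordIso_trans)
  ultimately have "finite (Pow (formulas M))" using card_of_ordLeq_finite by blast
  then show False using infinite_formulas by simp
qed

lemma finite_less_kappa: "finite A \<Longrightarrow> |A| <o \<kappa>"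
  using infinite_kappa Card_order_kappa
  by (metis card_of_Well_order card_order_on_well_order_on finite_ordLess_infinite Field_card_of)

lemma smallD: "sml A \<Longrightarrow> A \<subseteq> U" and small_less: "sml A \<Longrightarrow> |A| <o \<kappa>"
  by (auto simp: small_def)

lemma small_finite: "finite A \<Longrightarrow> A \<subseteq> U \<Longrightarrow> sml A"
  using finite_less_kappa by (auto simp: small_def)

lemma small_set: "set a \<subseteq> U \<Longrightarrow> sml (set a)"
  by (simp add: small_finite)

lemma small_subset: "sml A \<Longrightarrow> B \<subseteq> A \<Longrightarrow> sml B"
  unfolding small_def by (meson card_of_mono1 ordLeq_ordLess_trans order_trans)

lemma small_Un: "sml A \<Longrightarrow> sml B \<Longrightarrow> sml (A \<union> B)"
  unfolding small_def
  using card_of_Un_ordLess_infinite_Field[OF infinite_kappa Card_order_kappa] by auto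

lemma small_Un_iff: "sml (A \<union> B) \<longleftrightarrow> sml A \<and> sml B"
  using small_Un small_subset by (meson Un_upper1 Un_upper2)

lemma small_UN_finite: "finite I \<Longrightarrow> (\<And>i. i \<in> I \<Longrightarrow> sml (A i)) \<Longrightarrow> sml (\<Union>i\<in>I. A i)"
  by (induction I rule: finite_induct) (auto intro: small_Un small_finite)

lemma less_kappa_image: "|A| <o \<kappa> \<Longrightarrow> |f ` A| <o \<kappa>"
  by (meson card_of_image ordLeq_ordLess_trans)

lemma less_kappa_Times:
  assumes "|A| <o \<kappa>" "|B| <o \<kappa>"
  shows "|A \<times> B| <o \<kappa>"
proof (cases "finite A \<and> finite B")
  case True
  then show ?thesis by (simp add: finite_less_kappa)
next
  case False
  consider "|A| \<le>o |B|" | "|B| \<le>o |A|" 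
    using ordLeq_total[OF card_of_Well_order[of A] card_of_Well_order[of B]] by blast
  then show ?thesis
  proof cases
    case 1
    then have "infinite B" using False card_of_ordLeq_finite by blast
    then have "|A \<times> B| \<le>o |B|"
      by (rule card_of_Sigma_ordLeq_infinite[OF _ 1]) (intro ballI card_of_mono1 order_refl)
    then show ?thesis using assms(2) by (rule ordLeq_ordLess_trans)
  next
    case 2
    then have "infinite A" using False card_of_ordLeq_finite by blast
    then have "|A \<times> B| \<le>o |A|"
      by (rule card_of_Sigma_ordLeq_infinite[OF _ card_of_mono1[OF order_refl]]) (intro ballI 2)
    then show ?thesis using assms(1) by (rule ordLeq_ordLess_trans)
  qed
qed

section \<open>Automorphisms\<close>

lemma map_in_tuples:
  assumes "length ts = length \<Delta>" "\<And>i. i < length ts \<Longrightarrow> f (ts ! i) \<in> U \<and> srt (f (ts ! i)) = \<Delta> ! i"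
  shows "map f ts \<in> tuples M \<Delta>"
proof -
  have "map srt (map f ts) = \<Delta>" by (rule nth_equalityI) (use assms in auto)
  moreover have "set (map f ts) \<subseteq> U" using assms(2) by (auto simp: in_set_conv_nth)
  ultimately show ?thesis by (simp add: tuples_def)
qed

lemma eval_tm_in:
  assumes "has_sort M \<Gamma> t s" "e \<in> tuples M \<Gamma>"
  shows "eval_tm M e t \<in> U \<and> srt (eval_tm M e t) = s"
  using assms
proof induction
  case (1 i)
  then show ?case by (auto simp: tuples_def)
next
  case (2 f \<Delta> s ts)
  then have "map (eval_tm M e) ts \<in> tuples M \<Delta>"
    by (intro map_in_tuples) (auto simp: list_all2_conv_all_nth)
  then show ?case using wf_structure 2(1) unfolding wf_structure_def by auto
qed

lemma eval_tms_in:
  assumes "list_all2 (has_sort M \<Gamma>) ts \<Delta>" "e \<in> tuples M \<Gamma>"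
  shows "map (eval_tm M e) ts \<in> tuples M \<Delta>"
proof (rule map_in_tuples)
  show "length ts = length \<Delta>" using assms(1) by (rule list_all2_lengthD)
  show "eval_tm M e (ts ! i) \<in> U \<and> srt (eval_tm M e (ts ! i)) = \<Delta> ! i" if "i < length ts" for i
    using eval_tm_in[OF list_all2_nthD[OF assms(1) that] assms(2)] .
qed

lemma automorphismD:
  assumes "automorphism M g"
  shows "bij_betw g U U" "x \<in> U \<Longrightarrow> g x \<in> U" "x \<in> U \<Longrightarrow> srt (g x) = srt x" "inj_on g U" "g ` U = U"
  using assms by (auto simp: automorphism_def bij_betw_def)

lemma eval_tm_automorphism:
  assumes "has_sort M \<Gamma> t s" "automorphism M g" "e \<in> tuples M \<Gamma>"
  shows "eval_tm M (map g e) t = g (eval_tm M e t)"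
  using assms
proof induction
  case (1 i)
  then show ?case by (auto simp: tuples_def)
next
  case (2 f \<Delta> s ts)
  have "list_all2 (has_sort M \<Gamma>) ts \<Delta>" using 2(2) by (rule list_all2_mono) auto
  from eval_tms_in[OF this 2(4)]
  have "g (fun_int M f (map (eval_tm M e) ts)) = fun_int M f (map g (map (eval_tm M e) ts))"
    using 2(1,3) unfolding automorphism_def by blast
  moreover have "map (eval_tm M (map g e)) ts = map g (map (eval_tm M e) ts)"
    using 2(2-4) by (auto simp: list_all2_conv_all_nth in_set_conv_nth)
  ultimately show ?case by (simp only: eval_tm.simps)
qed

lemma sat_automorphism:
  assumes "automorphism M g" "wf_fm M \<Gamma> \<phi>" "e \<in> tuples M \<Gamma>"
  shows "sat M (map g e) \<phi> \<longleftrightarrow> sat M e \<phi>"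
  using assms(2,3)
proof (induction \<phi> arbitrary: \<Gamma> e)
  case (Eq t u)
  then obtain s where s: "has_sort M \<Gamma> t s" "has_sort M \<Gamma> u s" by auto
  have "g (eval_tm M e t) = g (eval_tm M e u) \<longleftrightarrow> eval_tm M e t = eval_tm M e u"
    using automorphismD(4)[OF assms(1)] eval_tm_in[OF s(1) Eq(2)] eval_tm_in[OF s(2) Eq(2)]
    by (intro inj_on_eq_iff) auto
  then show ?case using eval_tm_automorphism[OF s(1) assms(1) Eq(2)] eval_tm_automorphism[OF s(2) assms(1) Eq(2)]
    by simp
next
  case (Rel R ts)
  then obtain \<Delta> where d: "rel_sig M R = Some \<Delta>" "list_all2 (has_sort M \<Gamma>) ts \<Delta>" by auto
  have "map (eval_tm M (map g e)) ts = map g (map (eval_tm M e) ts)"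
    using eval_tm_automorphism[OF list_all2_nthD[OF d(2)] assms(1) Rel(2)]
    by (auto simp: in_set_conv_nth)
  moreover have "rel_int M R (map (eval_tm M e) ts) \<longleftrightarrow> rel_int M R (map g (map (eval_tm M e) ts))"
    using assms(1) d(1) eval_tms_in[OF d(2) Rel(2)] unfolding automorphism_def by blast
  ultimately show ?case by (simp only: sat.simps)
next
  case (Ex s \<phi>)
  have IH: "sat M (map g (x # e)) \<phi> \<longleftrightarrow> sat M (x # e) \<phi>" if "x \<in> U" "srt x = s" for x
    using Ex that by (intro Ex.IH[of "s # \<Gamma>"]) (auto simp: tuples_Cons)
  show ?case
  proof
    assume "sat M (map g e) (Ex s \<phi>)"
    then obtain y where y: "y \<in> U" "srt y = s" "sat M (y # map g e) \<phi>" by auto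
    then obtain x where x: "x \<in> U" "y = g x" using automorphismD(5)[OF assms(1)] by blast
    then have "srt x = s" using y automorphismD(3)[OF assms(1)] by auto
    then show "sat M e (Ex s \<phi>)" using IH[OF x(1)] x y by auto
  next
    assume "sat M e (Ex s \<phi>)"
    then obtain x where x: "x \<in> U" "srt x = s" "sat M (x # e) \<phi>" by auto
    then show "sat M (map g e) (Ex s \<phi>)"
      using IH[OF x(1,2)] automorphismD(2,3)[OF assms(1) x(1)] by auto
  qed
qed auto

lemma automorphism_id: "automorphism M id"
  by (auto simp: automorphism_def)

lemma tuples_automorphism: "automorphism M g \<Longrightarrow> a \<in> tuples M \<Gamma> \<Longrightarrow> map g a \<in> tuples M \<Gamma>"
  using automorphismD(2,3) by (fastforce simp: tuples_def)

lemma automorphism_comp: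
  assumes "automorphism M g" "automorphism M h"
  shows "automorphism M (h \<circ> g)"
  unfolding automorphism_def
proof (intro conjI allI impI ballI)
  show "bij_betw (h \<circ> g) U U" using assms automorphismD(1) bij_betw_trans by blast
  show "srt ((h \<circ> g) a) = srt a" if "a \<in> U" for a using assms that automorphismD(2,3) by auto
  fix f \<Delta> s a assume f: "fun_sig M f = Some (\<Delta>, s)" and a: "a \<in> tuples M \<Delta>"
  have "g (fun_int M f a) = fun_int M f (map g a)"
    using assms(1) f a unfolding automorphism_def by blast
  moreover have "h (fun_int M f (map g a)) = fun_int M f (map h (map g a))"
    using assms(2) f tuples_automorphism[OF assms(1) a] unfolding automorphism_def by blast
  ultimately show "(h \<circ> g) (fun_int M f a) = fun_int M f (map (h \<circ> g) a)" by simp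
next
  fix R \<Delta> a assume f: "rel_sig M R = Some \<Delta>" and a: "a \<in> tuples M \<Delta>"
  have "rel_int M R a = rel_int M R (map g a)"
    using assms(1) f a unfolding automorphism_def by blast
  moreover have "rel_int M R (map g a) = rel_int M R (map h (map g a))"
    using assms(2) f tuples_automorphism[OF assms(1) a] unfolding automorphism_def by blast
  ultimately show "rel_int M R a = rel_int M R (map (h \<circ> g) a)" by simp
qed

lemma automorphism_inverse:
  assumes g: "automorphism M g"
  obtains h where "automorphism M h" "\<And>x. x \<in> U \<Longrightarrow> h (g x) = x" "\<And>x. x \<in> U \<Longrightarrow> g (h x) = x"
proof
  let ?h = "inv_into U g"
  show hg: "?h (g x) = x" if "x \<in> U" for x using that automorphismD(4)[OF g] by simp
  show gh: "g (?h x) = x" if "x \<in> U" for x using that automorphismD(5)[OF g] by (simp add: f_inv_into_f)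
  have hU: "?h x \<in> U" if "x \<in> U" for x using that automorphismD(5)[OF g] by (simp add: inv_into_into)
  have hs: "srt (?h x) = srt x" if "x \<in> U" for x
    using automorphismD(3)[OF g hU[OF that]] gh[OF that] by simp
  have ht: "map ?h a \<in> tuples M \<Delta>" if "a \<in> tuples M \<Delta>" for a \<Delta>
    using that hU hs by (auto simp: tuples_def subset_iff)
  have gha: "map g (map ?h a) = a" if "a \<in> tuples M \<Delta>" for a \<Delta>
    using that gh by (auto simp: tuples_def subset_iff intro!: map_idI)
  show "automorphism M ?h"
    unfolding automorphism_def
  proof (intro conjI allI impI ballI)
    show "bij_betw ?h U U" using automorphismD(1)[OF g] bij_betw_inv_into by blast
    show "srt (?h a) = srt a" if "a \<in> U" for a using hs that .
    fix f \<Delta> s a assume f: "fun_sig M f = Some (\<Delta>, s)" and a: "a \<in> tuples M \<Delta>"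
    have "g (fun_int M f (map ?h a)) = fun_int M f (map g (map ?h a))"
      using g f ht[OF a] unfolding automorphism_def by blast
    then have "?h (fun_int M f a) = ?h (g (fun_int M f (map ?h a)))" using gha[OF a] by simp
    also have "\<dots> = fun_int M f (map ?h a)"
      using wf_structure f ht[OF a] unfolding wf_structure_def by (intro hg) blast
    finally show "?h (fun_int M f a) = fun_int M f (map ?h a)" .
  next
    fix R \<Delta> a assume f: "rel_sig M R = Some \<Delta>" and a: "a \<in> tuples M \<Delta>"
    have "rel_int M R (map ?h a) = rel_int M R (map g (map ?h a))"
      using g f ht[OF a] unfolding automorphism_def by blast
    then show "rel_int M R a = rel_int M R (map ?h a)" using gha[OF a] by simp
  qed
qed

lemma dfn_automorphism:
  assumes "dfn M A \<Gamma> X" "automorphism M g" "\<And>x. x \<in> A \<Longrightarrow> g x = x" "A \<subseteq> U" "a \<in> tuples M \<Gamma>"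
  shows "map g a \<in> X \<longleftrightarrow> a \<in> X"
proof -
  from assms(1) obtain \<phi> b where b: "set b \<subseteq> A" "wf_fm M (\<Gamma> @ map srt b) \<phi>"
    "X = {a \<in> tuples M \<Gamma>. sat M (a @ b) \<phi>}" by (rule dfnE)
  have "map g b = b" using b(1) assms(3) by (intro map_idI) auto
  moreover have "sat M (map g (a @ b)) \<phi> \<longleftrightarrow> sat M (a @ b) \<phi>"
    using b assms by (intro sat_automorphism[OF assms(2) b(2)]) (auto simp: in_tuples_append tuples_length in_tuples_self)
  ultimately show ?thesis using b(3) assms(2,5) tuples_automorphism by simp
qed

section \<open>Saturation\<close>

text \<open>Saturation in terms of definable sets. The formulas defining the members of \<open>\<X>\<close> are extended to
  a maximal finitely satisfiable set of formulas, which is a complete type.\<close>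

lemma realize_tuple:
  assumes A: "sml A" and dfn: "\<And>X. X \<in> \<X> \<Longrightarrow> dfn M A \<Gamma> X"
    and fip: "\<And>F. F \<subseteq> \<X> \<Longrightarrow> finite F \<Longrightarrow> \<exists>a \<in> tuples M \<Gamma>. \<forall>X\<in>F. a \<in> X"
  shows "\<exists>a \<in> tuples M \<Gamma>. \<forall>X\<in>\<X>. a \<in> X"
proof -
  define sol where "sol \<chi> = {a \<in> tuples M \<Gamma>. holds M a \<chi>}" for \<chi>
  define p0 where "p0 = {\<chi> \<in> fms_over M \<Gamma> A. sol \<chi> \<in> \<X>}"
  define FS where "FS p \<longleftrightarrow> (\<forall>F \<subseteq> p. finite F \<longrightarrow> (\<exists>a. realizes M \<Gamma> a F))" for p
  define S where "S = {p. p0 \<subseteq> p \<and> p \<subseteq> fms_over M \<Gamma> A \<and> FS p}"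
  have "FS p0"
    unfolding FS_def
  proof (intro allI impI)
    fix F assume F: "F \<subseteq> p0" "finite F"
    then have "\<exists>a \<in> tuples M \<Gamma>. \<forall>X\<in>sol ` F. a \<in> X" by (intro fip) (auto simp: p0_def)
    then show "\<exists>a. realizes M \<Gamma> a F" by (auto simp: realizes_def sol_def)
  qed
  then have "p0 \<in> S" by (auto simp: S_def p0_def)
  have "\<exists>p\<in>S. \<forall>q\<in>S. p \<subseteq> q \<longrightarrow> q = p"
  proof (rule subset_Zorn_nonempty)
    show "S \<noteq> {}" using \<open>p0 \<in> S\<close> by auto
    fix \<C> assume C: "\<C> \<noteq> {}" "subset.chain S \<C>"
    then have CS: "\<C> \<subseteq> S" by (auto simp: subset.chain_def)
    have "FS (\<Union>\<C>)"
      unfolding FS_def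
    proof (intro allI impI)
      fix F assume F: "F \<subseteq> \<Union>\<C>" "finite F"
      from finite_subset_Union_chain[OF F(2,1) C] obtain p where "p \<in> \<C>" "F \<subseteq> p" by blast
      then show "\<exists>a. realizes M \<Gamma> a F" using F CS by (auto simp: S_def FS_def)
    qed
    then show "\<Union>\<C> \<in> S" using C(1) CS by (fastforce simp: S_def)
  qed
  then obtain p where p: "p \<in> S" "\<And>q. q \<in> S \<Longrightarrow> p \<subseteq> q \<Longrightarrow> q = p" by blast
  have pf: "p \<subseteq> fms_over M \<Gamma> A" "FS p" "p0 \<subseteq> p" using p(1) by (auto simp: S_def)
  have complete: "(\<phi>, b) \<in> p \<or> (Neg \<phi>, b) \<in> p" if \<phi>: "(\<phi>, b) \<in> fms_over M \<Gamma> A" for \<phi> b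
  proof (rule ccontr)
    assume neg: "\<not> ?thesis"
    have Neg: "(Neg \<phi>, b) \<in> fms_over M \<Gamma> A" using \<phi> by (auto simp: fms_over_def)
    have ex: "\<exists>F. F \<subseteq> p \<and> finite F \<and> \<not> (\<exists>a. realizes M \<Gamma> a (insert \<chi> F))"
      if \<chi>: "\<chi> \<in> fms_over M \<Gamma> A" "\<chi> \<notin> p" for \<chi>
    proof -
      have "insert \<chi> p \<notin> S" using p(2)[of "insert \<chi> p"] \<chi>(2) by auto
      then have "\<not> FS (insert \<chi> p)" using pf \<chi>(1) by (auto simp: S_def)
      then obtain F where F: "F \<subseteq> insert \<chi> p" "finite F" "\<not> (\<exists>a. realizes M \<Gamma> a F)" by (auto simp: FS_def)
      then have "F - {\<chi>} \<subseteq> p" "finite (F - {\<chi>})" "\<not> (\<exists>a. realizes M \<Gamma> a (insert \<chi> (F - {\<chi>})))"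
        by (auto simp: realizes_def)
      then show ?thesis by blast
    qed
    obtain F1 where F1: "F1 \<subseteq> p" "finite F1" "\<not> (\<exists>a. realizes M \<Gamma> a (insert (\<phi>, b) F1))"
      using ex[OF \<phi>] neg by blast
    obtain F2 where F2: "F2 \<subseteq> p" "finite F2" "\<not> (\<exists>a. realizes M \<Gamma> a (insert (Neg \<phi>, b) F2))"
      using ex[OF Neg] neg by blast
    obtain a where a: "realizes M \<Gamma> a (F1 \<union> F2)" using pf(2) F1 F2 unfolding FS_def by (meson Un_least finite_UnI)
    show False
    proof (cases "sat M (a @ b) \<phi>")
      case True
      then have "realizes M \<Gamma> a (insert (\<phi>, b) F1)" using a by (auto simp: realizes_def)
      then show False using F1 by blast
    next
      case False
      then have "realizes M \<Gamma> a (insert (Neg \<phi>, b) F2)" using a by (auto simp: realizes_def)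
      then show False using F2 by blast
    qed
  qed
  have "\<forall>(\<phi>, b) \<in> fms_over M \<Gamma> A. (\<phi>, b) \<in> p \<or> (Neg \<phi>, b) \<in> p"
    using complete by blast
  then have "p \<in> ctypes M \<Gamma> A" using pf unfolding ctypes_def FS_def by blast
  then obtain a where a: "realizes M \<Gamma> a p" using saturated A unfolding saturated_def by blast
  have "a \<in> X" if "X \<in> \<X>" for X
  proof -
    from dfn[OF that] obtain \<chi> where \<chi>: "\<chi> \<in> fms_over M \<Gamma> A" "X = sol \<chi>" by (auto simp: dfn_def sol_def)
    then have "\<chi> \<in> p" using that pf(3) by (auto simp: p0_def)
    then show ?thesis using a \<chi>(2) by (auto simp: realizes_def sol_def)
  qed
  then show ?thesis using a by (auto simp: realizes_def)
qed

text \<open>Compactness for fewer than \<open>\<kappa>\<close> variables, whereas saturation is about finite tuples. A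
  constraint \<open>(vs, X)\<close> requires the values of the variables \<open>vs\<close> to form a tuple in \<open>X\<close>. By Zorn's
  lemma there is a maximal partial assignment \<open>G\<close> that can be continued to a solution of every
  finite set of constraints. It is total: for a variable \<open>v\<close> outside its domain, the values of \<open>v\<close>
  that belong to solutions of a finite set \<open>F\<close> form a definable set \<open>P F\<close>, and some value lies
  in all of these.\<close>

lemma realize_family:
  fixes V :: "'i set" and \<sigma> :: "'i \<Rightarrow> 's" and \<Sigma> :: "('i list \<times> 'a list set) set"
  assumes A: "sml A" and V: "|V| <o \<kappa>"
    and \<Sigma>: "\<And>vs X. (vs, X) \<in> \<Sigma> \<Longrightarrow> set vs \<subseteq> V \<and> dfn M A (map \<sigma> vs) X"
    and fs: "\<And>F. F \<subseteq> \<Sigma> \<Longrightarrow> finite F \<Longrightarrow>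
      \<exists>h. (\<forall>v\<in>V. h v \<in> U \<and> srt (h v) = \<sigma> v) \<and> (\<forall>(vs, X)\<in>F. map h vs \<in> X)"
  shows "\<exists>h. (\<forall>v\<in>V. h v \<in> U \<and> srt (h v) = \<sigma> v) \<and> (\<forall>(vs, X)\<in>\<Sigma>. map h vs \<in> X)"
proof -
  define typed where "typed h \<longleftrightarrow> (\<forall>v\<in>V. h v \<in> U \<and> srt (h v) = \<sigma> v)" for h
  define solves where "solves h F \<longleftrightarrow> (\<forall>(vs, X)\<in>F. map h vs \<in> X)" for h :: "'i \<Rightarrow> 'a" and F
  define ext where "ext h G \<longleftrightarrow> (\<forall>(v, x)\<in>G. h v = x)" for h :: "'i \<Rightarrow> 'a" and G
  define good where "good = {G. Domain G \<subseteq> V \<and>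
    (\<forall>F \<subseteq> \<Sigma>. finite F \<longrightarrow> (\<exists>h. typed h \<and> ext h G \<and> solves h F))}"
  have goodD: "\<exists>h. typed h \<and> ext h G \<and> solves h F" if "G \<in> good" "F \<subseteq> \<Sigma>" "finite F" for G F
    using that by (auto simp: good_def)
  have "{} \<in> good" using fs by (fastforce simp: good_def typed_def solves_def ext_def)
  have single: "x = y" if G: "G \<in> good" "(v, x) \<in> G" "(v, y) \<in> G" for G v x y
  proof -
    obtain h where "ext h G" using goodD[OF G(1), of "{}"] by auto
    then have "h v = x" "h v = y" using G(2,3) by (auto simp: ext_def)
    then show ?thesis by simp
  qed
  have "\<exists>G\<in>good. \<forall>H\<in>good. G \<subseteq> H \<longrightarrow> H = G"
  proof (rule subset_Zorn_nonempty)
    show "good \<noteq> {}" using \<open>{} \<in> good\<close> by auto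
    fix \<C> assume C: "\<C> \<noteq> {}" "subset.chain good \<C>"
    then have CS: "\<C> \<subseteq> good" by (auto simp: subset.chain_def)
    have sv: "x = y" if "(v, x) \<in> \<Union>\<C>" "(v, y) \<in> \<Union>\<C>" for v x y
    proof -
      have "\<exists>G\<in>\<C>. {(v, x), (v, y)} \<subseteq> G"
        using finite_subset_Union_chain[OF _ _ C, of "{(v, x), (v, y)}"] that by blast
      then obtain G where "G \<in> \<C>" "(v, x) \<in> G" "(v, y) \<in> G" by blast
      then show ?thesis using single[of G v x y] CS by blast
    qed
    show "\<Union>\<C> \<in> good"
      unfolding good_def
    proof (intro CollectI conjI allI impI)
      show "Domain (\<Union>\<C>) \<subseteq> V" using CS by (fastforce simp: good_def)
      fix F assume F: "F \<subseteq> \<Sigma>" "finite F"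
      define W where "W = (\<Union>(vs, X)\<in>F. set vs)"
      have "finite W" using F(2) by (auto simp: W_def)
      define H where "H = {(v, x) \<in> \<Union>\<C>. v \<in> W}"
      have "inj_on fst H" using sv by (auto simp: inj_on_def H_def)
      moreover have "fst ` H \<subseteq> W" by (auto simp: H_def)
      ultimately have "finite H" using \<open>finite W\<close> by (meson finite_imageD finite_subset)
      then obtain G where G: "G \<in> \<C>" "H \<subseteq> G"
        using finite_subset_Union_chain[OF _ _ C, of H] by (auto simp: H_def)
      then obtain h where h: "typed h" "ext h G" "solves h F" using goodD[of G F] CS F by blast
      obtain h0 where h0: "typed h0" using goodD[OF \<open>{} \<in> good\<close>, of "{}"] by auto
      have typC: "x \<in> U \<and> srt x = \<sigma> v" if vx: "(v, x) \<in> \<Union>\<C>" for v x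
      proof -
        obtain G' where G': "G' \<in> \<C>" "(v, x) \<in> G'" using vx by blast
        then obtain h' where "typed h'" "ext h' G'" using goodD[of G' "{}"] CS by blast
        moreover have "v \<in> V" using G' CS by (force simp: good_def)
        ultimately show ?thesis using G'(2) by (auto simp: typed_def ext_def)
      qed
      define h' where "h' v = (if v \<in> Domain (\<Union>\<C>) then (THE x. (v, x) \<in> \<Union>\<C>) else h v)" for v
      have h'C: "h' v = x" if "(v, x) \<in> \<Union>\<C>" for v x
      proof -
        have "(THE x. (v, x) \<in> \<Union>\<C>) = x" using that sv by (intro the_equality) auto
        then show ?thesis using that unfolding h'_def by (auto simp del: Union_iff)
      qed
      have h'W: "h' v = h v" if "v \<in> W" for v
      proof (cases "v \<in> Domain (\<Union>\<C>)")
        case True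
        then obtain x where x: "(v, x) \<in> \<Union>\<C>" by blast
        then have "(v, x) \<in> G" using that G by (auto simp: H_def)
        then show ?thesis using h(2) h'C[OF x] by (auto simp: ext_def)
      next
        case False
        then show ?thesis by (simp add: h'_def)
      qed
      have "typed h'"
        unfolding typed_def
      proof
        fix v assume v: "v \<in> V"
        show "h' v \<in> U \<and> srt (h' v) = \<sigma> v"
        proof (cases "v \<in> Domain (\<Union>\<C>)")
          case True
          then obtain x where x: "(v, x) \<in> \<Union>\<C>" by (rule DomainE)
          then show ?thesis using h'C[OF x] typC[OF x] by simp
        next
          case False
          then show ?thesis using h(1) v by (simp add: h'_def typed_def)
        qed
      qed
      moreover have "ext h' (\<Union>\<C>)" using h'C unfolding ext_def by blast
      moreover have "solves h' F"
        unfolding solves_def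
      proof (intro ballI, clarify)
        fix vs X assume vs: "(vs, X) \<in> F"
        then have "map h' vs = map h vs" using h'W by (auto simp: W_def)
        moreover have "map h vs \<in> X" using h(3) vs by (auto simp: solves_def)
        ultimately show "map h' vs \<in> X" by (simp only:)
      qed
      ultimately show "\<exists>h. typed h \<and> ext h (\<Union>\<C>) \<and> solves h F" by blast
    qed
  qed
  then obtain G where G: "G \<in> good" "\<And>H. H \<in> good \<Longrightarrow> G \<subseteq> H \<Longrightarrow> H = G" by blast
  have DG: "Domain G \<subseteq> V" using G(1) by (auto simp: good_def)
  obtain h0 where h0: "typed h0" "ext h0 G" using goodD[OF G(1), of "{}"] by auto
  have G_eq: "(v, x) \<in> G \<Longrightarrow> x = h0 v" for v x using h0(2) by (auto simp: ext_def)
  have "V \<subseteq> Domain G"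
  proof (rule ccontr)
    assume "\<not> V \<subseteq> Domain G"
    then obtain v where v: "v \<in> V" "v \<notin> Domain G" by blast
    let ?B = "A \<union> h0 ` Domain G"
    have B: "sml ?B"
    proof (rule small_Un[OF A])
      have "|Domain G| <o \<kappa>" using DG V by (meson card_of_mono1 ordLeq_ordLess_trans)
      then show "sml (h0 ` Domain G)"
        using less_kappa_image h0(1) DG by (auto simp: small_def typed_def)
    qed
    define P where "P F = {a \<in> tuples M [\<sigma> v]. \<exists>h. typed h \<and> ext h G \<and> h v = a ! 0 \<and> solves h F}" for F
    \<comment> \<open>The variables occurring in \<open>F\<close> are \<open>v\<close>, those in \<open>ps\<close>, whose values are parameters, and
      those in \<open>ws\<close>, which are quantified away.\<close>
    have P_dfn: "dfn M ?B [\<sigma> v] (P F)" if F: "F \<subseteq> \<Sigma>" "finite F" for F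
    proof -
      define W where "W = (\<Union>(vs, X)\<in>F. set vs)"
      have "finite W" using F(2) by (auto simp: W_def)
      have WV: "W \<subseteq> V" using F(1) \<Sigma> by (auto simp: W_def)
      obtain ps where ps: "set ps = W \<inter> Domain G" "distinct ps"
        using finite_distinct_list[of "W \<inter> Domain G"] \<open>finite W\<close> by blast
      obtain ws where ws: "set ws = W - Domain G - {v}" "distinct ws"
        using finite_distinct_list[of "W - Domain G - {v}"] \<open>finite W\<close> by blast
      let ?us = "ws @ [v]" let ?all = "ws @ [v] @ ps"
      define pos where "pos u = (SOME i. i < length ?all \<and> ?all ! i = u)" for u
      have pos: "pos u < length ?all \<and> ?all ! pos u = u" if "u \<in> set ?all" for u
        unfolding pos_def by (rule someI_ex) (use that in \<open>simp only: in_set_conv_nth\<close>)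
      let ?c = "map h0 ps" let ?\<Gamma> = "map \<sigma> ?us"
      have cs: "map srt ?c = map \<sigma> ps" using h0(1) ps(1) DG by (auto simp: typed_def)
      have Wall: "W \<subseteq> set ?all" using ps ws by auto
      have Ddfn: "dfn M ?B ?\<Gamma> {t \<in> tuples M ?\<Gamma>. map ((!) (t @ ?c)) (map pos vs) \<in> X}"
        if vs: "(vs, X) \<in> F" for vs X
      proof (rule dfn_subst)
        have vsall: "set vs \<subseteq> set ?all" using vs Wall by (auto simp: W_def)
        show "dfn M A (map \<sigma> vs) X" using \<Sigma> vs F by blast
        show "set ?c \<subseteq> ?B" using ps by auto
        show "?B \<subseteq> U" using B by (rule smallD)
        show "i < length ?\<Gamma> + length ?c" if "i \<in> set (map pos vs)" for i
          using that vsall pos by force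
        have "map ((!) (?\<Gamma> @ map srt ?c)) (map pos vs) = map ((!) (map \<sigma> ?all)) (map pos vs)"
          by (simp only: cs map_append append_assoc)
        also have "\<dots> = map \<sigma> vs"
          unfolding map_map
        proof (rule map_cong[OF refl])
          fix u assume "u \<in> set vs"
          then have "pos u < length ?all \<and> ?all ! pos u = u" using vsall pos by blast
          then show "((!) (map \<sigma> ?all) \<circ> pos) u = \<sigma> u" by (simp only: comp_apply nth_map)
        qed
        finally show "map ((!) (?\<Gamma> @ map srt ?c)) (map pos vs) = map \<sigma> vs" .
      qed simp
      let ?D = "\<lambda>(vs, X). {t \<in> tuples M ?\<Gamma>. map ((!) (t @ ?c)) (map pos vs) \<in> X}"
      have "dfn M ?B (map \<sigma> ws @ [\<sigma> v]) {t \<in> tuples M ?\<Gamma>. \<forall>i\<in>F. t \<in> ?D i}"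
        using dfn_Inter[OF F(2), of M ?B ?\<Gamma> ?D] Ddfn by auto
      moreover have "set (map \<sigma> ws) \<subseteq> sorts M"
      proof -
        have "\<sigma> u \<in> sorts M" if "u \<in> V" for u
          using h0(1) sort_in[of "h0 u"] that unfolding typed_def by metis
        then show ?thesis using ws(1) WV by auto
      qed
      ultimately have "dfn M ?B [\<sigma> v] {a \<in> tuples M [\<sigma> v]. \<exists>d \<in> tuples M (map \<sigma> ws).
          d @ a \<in> {t \<in> tuples M ?\<Gamma>. \<forall>i\<in>F. t \<in> ?D i}}"
        by (rule dfn_ex)
      also have "{a \<in> tuples M [\<sigma> v]. \<exists>d \<in> tuples M (map \<sigma> ws).
          d @ a \<in> {t \<in> tuples M ?\<Gamma>. \<forall>i\<in>F. t \<in> ?D i}} = P F" (is "?L = _")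
      proof
        have key: "map ((!) (map h ?us @ ?c)) (map pos vs) = map h vs"
          if "(vs, X) \<in> F" "ext h G" for h vs X
        proof -
          have "map h0 ps = map h ps" using that(2) h0(2) ps(1) by (auto simp: ext_def)
          then have "map h ?us @ ?c = map h ?all" by simp
          moreover have "map ((!) (map h ?all)) (map pos vs) = map h vs"
            unfolding map_map
          proof (rule map_cong[OF refl])
            fix u assume "u \<in> set vs"
            then have "pos u < length ?all \<and> ?all ! pos u = u" using that(1) Wall pos by (auto simp: W_def)
            then show "((!) (map h ?all) \<circ> pos) u = h u" by (simp only: comp_apply nth_map)
          qed
          ultimately show ?thesis by metis
        qed
        show "?L \<subseteq> P F"
        proof
          fix a assume "a \<in> ?L"
          then obtain d where a: "a \<in> tuples M [\<sigma> v]" and d: "d \<in> tuples M (map \<sigma> ws)"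
            and D: "\<forall>i\<in>F. d @ a \<in> ?D i" by auto
          obtain x where x: "a = [x]" using a by (auto simp: tuples_def)
          define h where "h u = (if u = v then x else if u \<in> set ws then the (map_of (zip ws d) u) else h0 u)" for u
          have ld: "length d = length ws" using d tuples_length by fastforce
          have vws: "v \<notin> set ws" using ws by auto
          have hws: "map h ws = d"
          proof (rule nth_equalityI)
            show "length (map h ws) = length d" using ld by simp
            fix i assume i: "i < length (map h ws)"
            then have "map_of (zip ws d) (ws ! i) = Some (d ! i)"
              using ws(2) ld by (simp add: map_of_zip_nth)
            then show "map h ws ! i = d ! i" using i vws by (auto simp: h_def)
          qed
          have hu: "map h ?us = d @ a" using hws x by (simp add: h_def)
          have "typed h"
            unfolding typed_def
          proof
            fix u assume u: "u \<in> V"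
            show "h u \<in> U \<and> srt (h u) = \<sigma> u"
            proof (cases "u \<in> set ?us")
              case True
              then obtain i where i: "i < length ?us" "u = ?us ! i" by (metis in_set_conv_nth)
              have "d @ a \<in> tuples M ?\<Gamma>" using a d ld by (simp add: in_tuples_append)
              then have t: "map h ?us \<in> tuples M (map \<sigma> ?us)" unfolding hu .
              have "h u \<in> set (map h ?us)" using True by (simp only: set_map) (rule imageI)
              moreover have "srt (h u) = \<sigma> u"
                using t True unfolding tuples_def mem_Collect_eq map_map
                by (metis (no_types, lifting) comp_apply map_eq_conv)
              ultimately show ?thesis using t by (auto simp: tuples_def)
            next
              case False
              then have "h u = h0 u" by (auto simp: h_def)
              then show ?thesis using u h0(1) by (simp add: typed_def)
            qed
          qed
          moreover have eG: "ext h G"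
            using h0(2) v(2) ws(1) by (fastforce simp: ext_def h_def)
          moreover have "solves h F"
            unfolding solves_def
          proof (intro ballI, clarify)
            fix vs X assume vs: "(vs, X) \<in> F"
            then have "map ((!) ((d @ a) @ ?c)) (map pos vs) \<in> X" using D by auto
            then show "map h vs \<in> X" using key[OF vs eG] unfolding hu by (simp only:)
          qed
          moreover have "h v = a ! 0" using x by (simp add: h_def)
          ultimately show "a \<in> P F" using a by (auto simp: P_def)
        qed
        show "P F \<subseteq> ?L"
        proof
          fix a assume "a \<in> P F"
          then obtain h where a: "a \<in> tuples M [\<sigma> v]" and h: "typed h" "ext h G" "h v = a ! 0" "solves h F"
            by (auto simp: P_def)
          have a': "a = [h v]" using a h(3) by (auto simp: tuples_def)
          have d: "map h ws \<in> tuples M (map \<sigma> ws)" using h(1) ws(1) WV by (auto simp: typed_def tuples_def)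
          moreover have da: "map h ws @ a \<in> tuples M ?\<Gamma>" using d a by (simp add: in_tuples_append)
          moreover have "map h ws @ a \<in> ?D i" if "i \<in> F" for i
          proof -
            obtain vs X where i: "i = (vs, X)" by force
            have "map ((!) ((map h ws @ a) @ ?c)) (map pos vs) = map h vs"
              using key[of vs X h] that h(2) a' i by simp
            also have "\<dots> \<in> X" using h(4) that i by (auto simp: solves_def)
            finally show ?thesis using i da by simp
          qed
          ultimately show "a \<in> ?L" using a by blast
        qed
      qed
      finally show ?thesis .
    qed
    have "\<exists>a \<in> tuples M [\<sigma> v]. \<forall>X\<in>{P F | F. F \<subseteq> \<Sigma> \<and> finite F}. a \<in> X"
    proof (rule realize_tuple[OF B])
      show "dfn M ?B [\<sigma> v] X" if "X \<in> {P F | F. F \<subseteq> \<Sigma> \<and> finite F}" for X using that P_dfn by auto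
      fix Q assume Q: "Q \<subseteq> {P F | F. F \<subseteq> \<Sigma> \<and> finite F}" "finite Q"
      then have "\<exists>f. \<forall>X\<in>Q. X = P (f X) \<and> f X \<subseteq> \<Sigma> \<and> finite (f X)" by (intro bchoice) auto
      then obtain f where f: "\<forall>X\<in>Q. X = P (f X) \<and> f X \<subseteq> \<Sigma> \<and> finite (f X)" by blast
      then have "(\<Union>X\<in>Q. f X) \<subseteq> \<Sigma>" "finite (\<Union>X\<in>Q. f X)" using Q by auto
      from goodD[OF G(1) this] obtain h where h: "typed h" "ext h G" "solves h (\<Union>X\<in>Q. f X)" by blast
      have "[h v] \<in> tuples M [\<sigma> v]" using h(1) v(1) by (auto simp: tuples_def typed_def)
      moreover have "[h v] \<in> P (f X)" if "X \<in> Q" for X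
        using calculation h that by (auto simp: P_def solves_def)
      then have "\<forall>X\<in>Q. [h v] \<in> X" using f by auto
      ultimately show "\<exists>a \<in> tuples M [\<sigma> v]. \<forall>X\<in>Q. a \<in> X" by blast
    qed
    then obtain a where "a \<in> tuples M [\<sigma> v]" "\<forall>X\<in>{P F | F. F \<subseteq> \<Sigma> \<and> finite F}. a \<in> X" ..
    then have a: "a \<in> tuples M [\<sigma> v]" "a \<in> P F" if "F \<subseteq> \<Sigma>" "finite F" for F
      using that by auto
    have "insert (v, a ! 0) G \<in> good"
      unfolding good_def
    proof (intro CollectI conjI allI impI)
      show "Domain (insert (v, a ! 0) G) \<subseteq> V" using DG v by auto
      fix F assume "F \<subseteq> \<Sigma>" "finite F"
      then show "\<exists>h. typed h \<and> ext h (insert (v, a ! 0) G) \<and> solves h F"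
        using a(2)[of F] by (fastforce simp: P_def ext_def)
    qed
    then have "insert (v, a ! 0) G = G" using G(2) by blast
    then show False using v(2) by auto
  qed
  have "solves h0 \<Sigma>"
    unfolding solves_def
  proof (intro ballI, clarify)
    fix vs X assume vs: "(vs, X) \<in> \<Sigma>"
    then obtain h where h: "ext h G" "solves h {(vs, X)}" using goodD[OF G(1), of "{(vs, X)}"] by auto
    have "h u = h0 u" if u: "u \<in> set vs" for u
    proof -
      have "u \<in> Domain G" using u \<Sigma>[OF vs] \<open>V \<subseteq> Domain G\<close> by blast
      then obtain x where x: "(u, x) \<in> G" by (rule DomainE)
      then have "h u = x" using h(1) by (auto simp: ext_def)
      then show ?thesis using G_eq[OF x] by simp
    qed
    then have "map h vs = map h0 vs" by simp
    moreover have "map h vs \<in> X" using h(2) by (simp add: solves_def)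
    ultimately show "map h0 vs \<in> X" by (simp only:)
  qed
  then show ?thesis using h0(1) unfolding typed_def solves_def by blast
qed

end

lemma sublist_positions:
  assumes "set l \<subseteq> set xs"
  obtains vs where "\<And>i. i \<in> set vs \<Longrightarrow> i < length xs" "map ((!) xs) vs = l"
proof -
  define pos where "pos x = (SOME i. i < length xs \<and> xs ! i = x)" for x
  have pos: "pos x < length xs \<and> xs ! pos x = x" if "x \<in> set l" for x
  proof -
    have "\<exists>i. i < length xs \<and> xs ! i = x" using that assms by (metis in_set_conv_nth subsetD)
    then show ?thesis unfolding pos_def by (rule someI_ex)
  qed
  show ?thesis
  proof (rule that)
    show "i < length xs" if "i \<in> set (map pos l)" for i using that pos by auto
    show "map ((!) xs) (map pos l) = l" using pos by (simp add: map_idI)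
  qed
qed

lemma map_nth_transport:
  assumes "\<And>i. i \<in> set vs \<Longrightarrow> i < length xs" "length ys = length xs"
    and "\<And>i. i < length xs \<Longrightarrow> f (xs ! i) = ys ! i"
  shows "map f (map ((!) xs) vs) = map ((!) ys) vs"
  using assms by simp

lemma map_nth_map:
  assumes "\<And>i. i \<in> set vs \<Longrightarrow> i < length xs"
  shows "map ((!) (map f xs)) vs = map f (map ((!) xs) vs)"
  using assms by simp

lemma map_nth_rotate:
  assumes "length a = n" "length e = m" "length c = l"
  shows "map ((!) ((a @ e) @ c)) ([0..<n] @ [n + m..<n + m + l] @ [n..<n + m]) = (a @ c) @ e"
proof -
  have "map ((!) ((a @ e) @ c)) [0..<n] = a"
    using assms by (intro nth_equalityI) (auto simp: nth_append)
  moreover have "map ((!) ((a @ e) @ c)) [n + m..<n + m + l] = c"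
    using assms by (intro nth_equalityI) (auto simp: nth_append)
  moreover have "map ((!) ((a @ e) @ c)) [n..<n + m] = e"
    using assms by (intro nth_equalityI) (auto simp: nth_append)
  ultimately show ?thesis by (simp only: map_append append_assoc)
qed

context monster
begin

section \<open>Conjugate tuples\<close>

text \<open>Over a small set, having the same type is the same as being conjugate under automorphisms
  (\<open>realizes_tp_iff\<close>), so that types over small sets are handled as orbits.\<close>

definition aut :: "'a set \<Rightarrow> ('a \<Rightarrow> 'a) \<Rightarrow> bool" where
  "aut C g \<longleftrightarrow> automorphism M g \<and> (\<forall>x\<in>C. g x = x)"

definition conjugate :: "'a set \<Rightarrow> 'a list \<Rightarrow> 'a list \<Rightarrow> bool" where
  "conjugate C a b \<longleftrightarrow> (\<exists>g. aut C g \<and> b = map g a)"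

lemma aut_automorphism: "aut C g \<Longrightarrow> automorphism M g"
  by (simp add: aut_def)

lemma aut_fix: "aut C g \<Longrightarrow> x \<in> C \<Longrightarrow> g x = x"
  by (simp add: aut_def)

lemma aut_image: "aut C g \<Longrightarrow> B \<subseteq> C \<Longrightarrow> g ` B = B"
  by (force simp: aut_def)

lemma aut_map: "aut C g \<Longrightarrow> set l \<subseteq> C \<Longrightarrow> map g l = l"
  by (auto simp: aut_def intro: map_idI)

lemma aut_mono: "aut C g \<Longrightarrow> B \<subseteq> C \<Longrightarrow> aut B g"
  by (auto simp: aut_def)

lemma aut_id: "aut C id"
  by (simp add: aut_def automorphism_id)

lemma aut_comp: "aut C g \<Longrightarrow> aut C h \<Longrightarrow> aut C (h \<circ> g)"
  by (simp add: aut_def automorphism_comp)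

lemma aut_inverse:
  assumes "aut C g" "C \<subseteq> U"
  obtains h where "aut C h" "\<And>x. x \<in> U \<Longrightarrow> h (g x) = x" "\<And>x. x \<in> U \<Longrightarrow> g (h x) = x"
proof -
  from assms(1) have "automorphism M g" by (simp add: aut_def)
  then obtain h where h: "automorphism M h" "\<And>x. x \<in> U \<Longrightarrow> h (g x) = x" "\<And>x. x \<in> U \<Longrightarrow> g (h x) = x"
    by (rule automorphism_inverse) blast
  have "h x = x" if "x \<in> C" for x
  proof -
    have "g x = x" using assms(1) that by (rule aut_fix)
    moreover have "h (g x) = x" using h(2) that assms(2) by auto
    ultimately show ?thesis by simp
  qed
  then have "aut C h" using h(1) by (simp add: aut_def)
  from that[OF this h(2,3)] show ?thesis by blast
qed

lemma automorphism_subset: "automorphism M g \<Longrightarrow> A \<subseteq> U \<Longrightarrow> g ` A \<subseteq> U"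
  using automorphismD(2) by blast

lemma small_image: "automorphism M g \<Longrightarrow> sml A \<Longrightarrow> sml (g ` A)"
  using less_kappa_image automorphism_subset by (auto simp: small_def)

lemma map_sort_automorphism: "automorphism M g \<Longrightarrow> set a \<subseteq> U \<Longrightarrow> map srt (map g a) = map srt a"
  using automorphismD(3) by auto

lemma automorphism_set: "automorphism M g \<Longrightarrow> set a \<subseteq> U \<Longrightarrow> set (map g a) \<subseteq> U"
  using automorphismD(2) by auto

text \<open>Homogeneity in terms of definable sets. Complements turn the implication assumed of \<open>h\<close> into an
  equivalence.\<close>

lemma copy_extends:
  assumes A: "sml A" and h: "\<And>x. x \<in> A \<Longrightarrow> h x \<in> U \<and> srt (h x) = srt x"
    and tp: "\<And>l X. set l \<subseteq> A \<Longrightarrow> dfn M {} (map srt l) X \<Longrightarrow> l \<in> X \<Longrightarrow> map h l \<in> X"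
  obtains g where "automorphism M g" "\<And>x. x \<in> A \<Longrightarrow> g x = h x"
proof -
  have AU: "A \<subseteq> U" using A by (rule smallD)
  have imp: "sat M (map h a) \<phi>" if a: "set a \<subseteq> A" "wf_fm M (map srt a) \<phi>" "sat M a \<phi>" for a \<phi>
  proof -
    let ?X = "{t \<in> tuples M (map srt a). sat M (t @ []) \<phi>}"
    have "dfn M {} (map srt a) ?X" using a(2) by (intro dfnI[of "[]"]) auto
    moreover have "a \<in> ?X" using a AU in_tuples_self[of a M] by auto
    ultimately have "map h a \<in> ?X" using tp a(1) by blast
    then show ?thesis by simp
  qed
  have "elementary_on M A h"
    unfolding elementary_on_def
  proof (intro conjI ballI allI impI)
    show "h ` A \<subseteq> U" using h by auto
    show "srt (h a) = srt a" if "a \<in> A" for a using h that by auto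
    fix a \<phi> assume a: "set a \<subseteq> A \<and> wf_fm M (map srt a) \<phi>"
    show "sat M a \<phi> \<longleftrightarrow> sat M (map h a) \<phi>"
    proof
      show "sat M a \<phi> \<Longrightarrow> sat M (map h a) \<phi>" using imp a by blast
      show "sat M (map h a) \<phi> \<Longrightarrow> sat M a \<phi>" using imp[of a "Neg \<phi>"] a by auto
    qed
  qed
  then obtain g where "automorphism M g" "\<forall>x\<in>A. g x = h x"
    using homogeneous A unfolding strongly_homogeneous_def by blast
  then show ?thesis using that by blast
qed

text \<open>If \<open>b\<close> lies in every \<open>C\<close>-definable set that contains \<open>a\<close>, then the map that sends \<open>a\<close> to \<open>b\<close> and
  fixes \<open>C\<close> is well defined, since equality of two entries of \<open>a\<close>, or of an entry with an element
  of \<open>C\<close>, is definable. It is elementary for the same reason.\<close>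

lemma conjugate_iff:
  assumes C: "sml C" and a: "set a \<subseteq> U"
  shows "conjugate C a b \<longleftrightarrow>
    b \<in> tuples M (map srt a) \<and> (\<forall>X. dfn M C (map srt a) X \<longrightarrow> a \<in> X \<longrightarrow> b \<in> X)"
proof
  have CU: "C \<subseteq> U" using C by (rule smallD)
  assume "conjugate C a b"
  then obtain g where g: "automorphism M g" "\<And>x. x \<in> C \<Longrightarrow> g x = x" "b = map g a"
    by (auto simp: conjugate_def aut_def)
  show "b \<in> tuples M (map srt a) \<and> (\<forall>X. dfn M C (map srt a) X \<longrightarrow> a \<in> X \<longrightarrow> b \<in> X)"
  proof (intro conjI allI impI)
    show "b \<in> tuples M (map srt a)" using g(3) tuples_automorphism[OF g(1) in_tuples_self[OF a]] by simp
    fix X assume "dfn M C (map srt a) X" "a \<in> X"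
    then show "b \<in> X" using dfn_automorphism[OF _ g(1,2) CU in_tuples_self[OF a]] g(3) by blast
  qed
next
  have CU: "C \<subseteq> U" using C by (rule smallD)
  assume b: "b \<in> tuples M (map srt a) \<and> (\<forall>X. dfn M C (map srt a) X \<longrightarrow> a \<in> X \<longrightarrow> b \<in> X)"
  then have bt: "b \<in> tuples M (map srt a)" and bX: "\<And>X. dfn M C (map srt a) X \<Longrightarrow> a \<in> X \<Longrightarrow> b \<in> X"
    by blast+
  have len: "length b = length a" using tuples_length[OF bt] by simp
  have at: "a \<in> tuples M (map srt a)" using a by (rule in_tuples_self)
  have bU: "set b \<subseteq> U" and bs: "map srt b = map srt a" using bt by (auto simp: tuples_def)
  have bs': "srt (b ! i) = srt (a ! i)" if "i < length a" for i
  proof -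
    have "map srt b ! i = map srt a ! i" by (simp only: bs)
    then show ?thesis using that len by simp
  qed
  have eq: "b ! i = b ! j" if "i < length a" "j < length a" "a ! i = a ! j" for i j
  proof -
    have "dfn M C (map srt a) {t \<in> tuples M (map srt a). t ! i = t ! j}"
      using that by (intro dfn_eq_coords) auto
    then show ?thesis using bX[of "{t \<in> tuples M (map srt a). t ! i = t ! j}"] at that(3) by auto
  qed
  have eqc: "b ! i = a ! i" if i: "i < length a" "a ! i \<in> C" for i
  proof -
    have "dfn M C (map srt [a ! i]) {[a ! i]}" using i CU by (intro dfn_singleton) auto
    then have "dfn M C (map srt a) {t \<in> tuples M (map srt a). map ((!) t) [i] \<in> {[a ! i]}}"
      using i CU by (intro dfn_reindex) auto
    then have "b \<in> {t \<in> tuples M (map srt a). map ((!) t) [i] \<in> {[a ! i]}}"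
      using at by (intro bX) auto
    then show ?thesis by simp
  qed
  define h where "h x = (if x \<in> set a then b ! (SOME i. i < length a \<and> a ! i = x) else x)" for x
  have ha: "h (a ! i) = b ! i" if "i < length a" for i
  proof -
    let ?j = "SOME j. j < length a \<and> a ! j = a ! i"
    have "?j < length a \<and> a ! ?j = a ! i" by (rule someI[of _ i]) (use that in simp)
    then have "b ! ?j = b ! i" using eq that by blast
    then show ?thesis using that by (simp add: h_def)
  qed
  have hC: "h x = x" if "x \<in> C" for x
  proof (cases "x \<in> set a")
    case True
    then obtain i where i: "i < length a" "a ! i = x" by (auto simp: in_set_conv_nth)
    then show ?thesis using ha[OF i(1)] eqc[OF i(1)] that by simp
  next
    case False
    then show ?thesis by (simp add: h_def)
  qed
  have hmap: "map h a = b" using ha len by (intro nth_equalityI) auto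
  have "sml (set a \<union> C)" using small_Un[OF small_set[OF a] C] .
  moreover have "h x \<in> U \<and> srt (h x) = srt x" if "x \<in> set a \<union> C" for x
  proof (cases "x \<in> C")
    case True
    then show ?thesis using hC CU by auto
  next
    case False
    then have "x \<in> set a" using that by blast
    then obtain i where i: "i < length a" "a ! i = x" by (auto simp: in_set_conv_nth)
    then have "h x = b ! i" using ha by blast
    moreover have "b ! i \<in> U" using bU i len by (metis nth_mem subsetD)
    moreover have "srt (b ! i) = srt x" using bs' i by auto
    ultimately show ?thesis by simp
  qed
  moreover have "map h l \<in> X" if l: "set l \<subseteq> set a \<union> C" "dfn M {} (map srt l) X" "l \<in> X" for l X
  proof -
    define c where "c = filter (\<lambda>x. x \<notin> set a) l"
    have c: "set c \<subseteq> C" "set l \<subseteq> set (a @ c)" using l(1) by (auto simp: c_def)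
    obtain vs where vs: "\<And>i. i \<in> set vs \<Longrightarrow> i < length (a @ c)" "map ((!) (a @ c)) vs = l"
      by (rule sublist_positions[OF c(2)]) blast
    let ?Y = "{t \<in> tuples M (map srt a). map ((!) (t @ c)) vs \<in> X}"
    have "dfn M C (map srt a) ?Y"
    proof (rule dfn_subst[OF l(2) _ c(1) CU])
      show "map ((!) (map srt a @ map srt c)) vs = map srt l"
        using map_nth_map[of vs "a @ c" srt, OF vs(1)] vs(2) by (simp only: map_append)
    qed (use vs in auto)
    moreover have "a \<in> ?Y" using at vs(2) l(3) by simp
    ultimately have "b \<in> ?Y" by (rule bX)
    moreover have "map h l = map ((!) (b @ c)) vs"
      unfolding vs(2)[symmetric]
    proof (rule map_nth_transport[OF vs(1)])
      show "length (b @ c) = length (a @ c)" using len by simp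
      fix i assume i: "i < length (a @ c)"
      show "h ((a @ c) ! i) = (b @ c) ! i"
      proof (cases "i < length a")
        case True
        then show ?thesis using ha len by (simp add: nth_append)
      next
        case False
        then have "c ! (i - length a) \<in> set c" using i by simp
        then have "c ! (i - length a) \<in> C" using c(1) by blast
        then show ?thesis using False len hC by (simp add: nth_append)
      qed
    qed
    ultimately show ?thesis by (simp only: mem_Collect_eq)
  qed
  ultimately obtain g where g: "automorphism M g" "\<And>x. x \<in> set a \<union> C \<Longrightarrow> g x = h x"
    using copy_extends[of "set a \<union> C" h] by blast
  have "aut C g" using g hC by (auto simp: aut_def)
  moreover have "map g a = b" using g(2) hmap by auto
  ultimately show "conjugate C a b" by (auto simp: conjugate_def)
qed

abbreviation sol :: "'s list \<Rightarrow> ('s, 'f, 'r, 'a) pfm \<Rightarrow> 'a list set" where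
  "sol \<Gamma> \<chi> \<equiv> {a \<in> tuples M \<Gamma>. holds M a \<chi>}"

lemma tp_ball:
  assumes "a \<in> tuples M (map srt a)"
  shows "(\<forall>\<chi>\<in>tp M a B. P (sol (map srt a) \<chi>)) \<longleftrightarrow>
    (\<forall>X. dfn M B (map srt a) X \<longrightarrow> a \<in> X \<longrightarrow> P X)"
proof
  assume L: "\<forall>\<chi>\<in>tp M a B. P (sol (map srt a) \<chi>)"
  show "\<forall>X. dfn M B (map srt a) X \<longrightarrow> a \<in> X \<longrightarrow> P X"
  proof (intro allI impI)
    fix X assume "dfn M B (map srt a) X" "a \<in> X"
    then obtain \<chi> where "\<chi> \<in> fms_over M (map srt a) B" "X = sol (map srt a) \<chi>" "holds M a \<chi>"
      by (auto simp: dfn_def)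
    then have "\<chi> \<in> tp M a B" unfolding tp_def by blast
    then show "P X" using L \<open>X = sol (map srt a) \<chi>\<close> by blast
  qed
next
  assume R: "\<forall>X. dfn M B (map srt a) X \<longrightarrow> a \<in> X \<longrightarrow> P X"
  show "\<forall>\<chi>\<in>tp M a B. P (sol (map srt a) \<chi>)"
  proof
    fix \<chi> assume "\<chi> \<in> tp M a B"
    then have "dfn M B (map srt a) (sol (map srt a) \<chi>)" "a \<in> sol (map srt a) \<chi>"
      using assms by (auto simp: tp_def dfn_def)
    then show "P (sol (map srt a) \<chi>)" using R by blast
  qed
qed

lemma realizes_tp_iff:
  assumes C: "sml C" and a: "set a \<subseteq> U"
  shows "realizes M (map srt a) b (tp M a C) \<longleftrightarrow> conjugate C a b"
proof -
  have at: "a \<in> tuples M (map srt a)" using a by (rule in_tuples_self)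
  have "(\<forall>\<chi>\<in>tp M a C. holds M b \<chi>) \<longleftrightarrow> (\<forall>X. dfn M C (map srt a) X \<longrightarrow> a \<in> X \<longrightarrow> b \<in> X)"
    if b: "b \<in> tuples M (map srt a)"
    using tp_ball[OF at, of C "\<lambda>X. b \<in> X"] b by simp
  then show ?thesis unfolding realizes_def conjugate_iff[OF assms] by blast
qed

lemma conjugate_refl: "conjugate C a a"
  by (metis aut_id conjugate_def list.map_id)

lemma conjugate_set: "conjugate C a b \<Longrightarrow> set a \<subseteq> U \<Longrightarrow> set b \<subseteq> U"
  unfolding conjugate_def aut_def using automorphism_set by blast

lemma conjugate_sort: "conjugate C a b \<Longrightarrow> set a \<subseteq> U \<Longrightarrow> map srt b = map srt a"
  unfolding conjugate_def aut_def using map_sort_automorphism by blast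

lemma conjugate_mono: "conjugate C a b \<Longrightarrow> B \<subseteq> C \<Longrightarrow> conjugate B a b"
  unfolding conjugate_def using aut_mono by blast

lemma conjugate_trans: "conjugate C a b \<Longrightarrow> conjugate C b c \<Longrightarrow> conjugate C a c"
  unfolding conjugate_def using aut_comp by (metis map_map)

lemma conjugate_sym:
  assumes "conjugate C a b" "C \<subseteq> U" "set a \<subseteq> U"
  shows "conjugate C b a"
proof -
  from assms(1) obtain g where g: "aut C g" "b = map g a" by (auto simp: conjugate_def)
  obtain h where h: "aut C h" "\<And>x. x \<in> U \<Longrightarrow> h (g x) = x" by (rule aut_inverse[OF g(1) assms(2)]) blast
  have "map h b = a" using g(2) h(2) assms(3) by (auto intro!: map_idI)
  then show ?thesis using h(1) by (auto simp: conjugate_def)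
qed

section \<open>Strong dividing of definable sets\<close>

lemma algebraic_iff:
  "algebraic M D e \<longleftrightarrow> (\<exists>X. dfn M D (map srt e) X \<and> e \<in> X \<and> finite X)" if "set e \<subseteq> U"
proof -
  have "algebraic M D e \<longleftrightarrow> (\<exists>\<chi>\<in>tp M e D. finite (sol (map srt e) \<chi>))"
    unfolding algebraic_def by simp
  also have "\<dots> \<longleftrightarrow> \<not> (\<forall>\<chi>\<in>tp M e D. infinite (sol (map srt e) \<chi>))" by blast
  also have "\<dots> \<longleftrightarrow> (\<exists>X. dfn M D (map srt e) X \<and> e \<in> X \<and> finite X)"
    unfolding tp_ball[OF in_tuples_self[OF that], of D "\<lambda>X. infinite X"] by blast
  finally show ?thesis .
qed

abbreviation k_incons :: "'a set \<Rightarrow> 's list \<Rightarrow> 'a list \<Rightarrow> nat \<Rightarrow> 'a list set \<Rightarrow> bool" where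
  "k_incons D \<Gamma> e k Y \<equiv> \<forall>S \<subseteq> {e'. conjugate D e e'}. finite S \<and> card S = k \<longrightarrow>
     \<not> (\<exists>a \<in> tuples M \<Gamma>. \<forall>e'\<in>S. a @ e' \<in> Y)"

text \<open>Strong dividing as a property of the set \<open>X\<close> that a formula defines, with the parameter tuple \<open>e\<close>
  as its witness. The set \<open>Y\<close> may itself use parameters from \<open>D\<close>; then entries of a tuple
  that come from \<open>D\<close> can be turned into parameters (\<open>sdiv_fibre\<close>).\<close>

definition sdiv_by :: "'a set \<Rightarrow> 's list \<Rightarrow> 'a list set \<Rightarrow> 'a list \<Rightarrow> bool" where
  "sdiv_by D \<Gamma> X e \<longleftrightarrow> (\<exists>Y k. set e \<subseteq> U \<and> dfn M D (\<Gamma> @ map srt e) Y \<and>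
     X = {a \<in> tuples M \<Gamma>. a @ e \<in> Y} \<and> \<not> algebraic M D e \<and>
     (k_incons D \<Gamma> e k Y))"

definition sdiv :: "'a set \<Rightarrow> 's list \<Rightarrow> 'a list set \<Rightarrow> bool" where
  "sdiv D \<Gamma> X \<longleftrightarrow> (\<exists>e. sdiv_by D \<Gamma> X e)"

definition tdiv :: "'a set \<Rightarrow> 's list \<Rightarrow> 'a list set \<Rightarrow> bool" where
  "tdiv C \<Gamma> X \<longleftrightarrow> (\<exists>D. sml D \<and> C \<subseteq> D \<and> sdiv D \<Gamma> X)"

definition tfork :: "'a set \<Rightarrow> 's list \<Rightarrow> 'a list set \<Rightarrow> bool" where
  "tfork C \<Gamma> X \<longleftrightarrow> (\<exists>\<Y>. finite \<Y> \<and> (\<forall>Y\<in>\<Y>. tdiv C \<Gamma> Y) \<and> X \<subseteq> \<Union>\<Y>)"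

lemma sdiv_sol:
  assumes "strongly_divides M \<Gamma> D \<chi>" "\<chi> \<in> fms_over M \<Gamma> U" "sml D"
  shows "sdiv D \<Gamma> (sol \<Gamma> \<chi>)"
proof -
  obtain \<phi> e where \<chi>: "\<chi> = (\<phi>, e)" by force
  have e: "set e \<subseteq> U" "wf_fm M (\<Gamma> @ map srt e) \<phi>" using assms(2) by (auto simp: \<chi> fms_over_def)
  obtain k where na: "\<not> algebraic M D e"
    and k: "k_inconsistent M \<Gamma> k {(\<phi>, b') | b'. realizes M (map srt e) b' (tp M e D)}"
    using assms(1) by (auto simp: \<chi>)
  let ?Y = "{c \<in> tuples M (\<Gamma> @ map srt e). sat M (c @ []) \<phi>}"
  have inY: "a @ e' \<in> ?Y \<longleftrightarrow> sat M (a @ e') \<phi>" if "a \<in> tuples M \<Gamma>" "e' \<in> tuples M (map srt e)" for a e'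
    using that by (simp add: in_tuples_append tuples_length)
  show ?thesis
    unfolding sdiv_def sdiv_by_def
  proof (intro exI conjI)
    show "set e \<subseteq> U" by fact
    show "dfn M D (\<Gamma> @ map srt e) ?Y" using e(2) by (intro dfnI[of "[]"]) auto
    show "sol \<Gamma> \<chi> = {a \<in> tuples M \<Gamma>. a @ e \<in> ?Y}"
      using inY[OF _ in_tuples_self[OF e(1)]] unfolding \<chi> by auto
    show "\<not> algebraic M D e" by fact
    show "k_incons D \<Gamma> e k ?Y"
    proof (intro allI impI notI)
      fix S assume S: "S \<subseteq> {e'. conjugate D e e'}" "finite S \<and> card S = k"
        and "\<exists>a \<in> tuples M \<Gamma>. \<forall>e'\<in>S. a @ e' \<in> ?Y"
      then obtain a where a: "a \<in> tuples M \<Gamma>" "\<forall>e'\<in>S. a @ e' \<in> ?Y" by blast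
      have "Pair \<phi> ` S \<subseteq> {(\<phi>, b') | b'. realizes M (map srt e) b' (tp M e D)}"
        using S(1) realizes_tp_iff[OF assms(3) e(1)] by auto
      moreover have "finite (Pair \<phi> ` S) \<and> card (Pair \<phi> ` S) = k"
        using S(2) by (auto simp: card_image inj_on_def)
      moreover have "realizes M \<Gamma> a (Pair \<phi> ` S)" using a by (auto simp: realizes_def)
      ultimately show False using k unfolding k_inconsistent_def by blast
    qed
  qed
qed

text \<open>The parameters \<open>d\<close> of \<open>Y\<close> are appended to \<open>e\<close>. As they come from \<open>D\<close>, the conjugates of \<open>e @ d\<close>
  over \<open>D\<close> are the tuples \<open>e' @ d\<close> with \<open>e'\<close> conjugate to \<open>e\<close>.\<close>

lemma sol_of_sdiv:
  assumes "sdiv D \<Gamma> X" "sml D"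
  obtains \<chi> where "\<chi> \<in> fms_over M \<Gamma> U" "strongly_divides M \<Gamma> D \<chi>" "X = sol \<Gamma> \<chi>"
proof -
  have DU: "D \<subseteq> U" using assms(2) by (rule smallD)
  from assms(1) obtain e Y k where e: "set e \<subseteq> U" and Y: "dfn M D (\<Gamma> @ map srt e) Y"
    and X: "X = {a \<in> tuples M \<Gamma>. a @ e \<in> Y}" and na: "\<not> algebraic M D e"
    and k: "k_incons D \<Gamma> e k Y"
    unfolding sdiv_def sdiv_by_def by blast
  from Y obtain \<phi> d where d: "set d \<subseteq> D" "wf_fm M ((\<Gamma> @ map srt e) @ map srt d) \<phi>"
    "Y = {c \<in> tuples M (\<Gamma> @ map srt e). sat M (c @ d) \<phi>}" by (rule dfnE)
  have inY: "a @ e' \<in> Y \<longleftrightarrow> sat M (a @ e' @ d) \<phi>" if "a \<in> tuples M \<Gamma>" "e' \<in> tuples M (map srt e)" for a e'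
    using that d(3) by (simp add: in_tuples_append tuples_length)
  have edU: "set (e @ d) \<subseteq> U" using e d(1) DU by auto
  have et: "e \<in> tuples M (map srt e)" using e by (rule in_tuples_self)
  show ?thesis
  proof (rule that)
    show "(\<phi>, e @ d) \<in> fms_over M \<Gamma> U" using d edU by (simp add: fms_over_def)
    show "X = sol \<Gamma> (\<phi>, e @ d)" using X inY[OF _ et] by auto
    have "\<not> algebraic M D (e @ d)"
    proof
      assume "algebraic M D (e @ d)"
      then obtain Z where Z: "dfn M D (map srt e @ map srt d) Z" "e @ d \<in> Z" "finite Z"
        using algebraic_iff[OF edU] by auto
      let ?Z = "{z \<in> tuples M (map srt e). z @ d \<in> Z}"
      have "dfn M D (map srt e) ?Z" by (rule dfn_fibre[OF Z(1) order_refl DU d(1) refl])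
      moreover have "e \<in> ?Z" using et Z(2) by simp
      moreover have "finite ?Z"
      proof (rule finite_imageD[of "\<lambda>z. z @ d"])
        show "finite ((\<lambda>z. z @ d) ` ?Z)" by (rule finite_subset[OF _ Z(3)]) auto
      qed (simp add: inj_on_def)
      ultimately show False using na algebraic_iff[OF e] by blast
    qed
    moreover have "k_inconsistent M \<Gamma> k {(\<phi>, b') | b'. realizes M (map srt (e @ d)) b' (tp M (e @ d) D)}"
      unfolding k_inconsistent_def
    proof (intro allI impI notI)
      fix S assume S: "S \<subseteq> {(\<phi>, b') | b'. realizes M (map srt (e @ d)) b' (tp M (e @ d) D)}"
        and fin: "finite S \<and> card S = k" and "\<exists>a. realizes M \<Gamma> a S"
      then obtain a where a: "realizes M \<Gamma> a S" by blast
      have Sform: "\<exists>e'. \<chi> = (\<phi>, e' @ d) \<and> conjugate D e e'" if \<chi>: "\<chi> \<in> S" for \<chi>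
      proof -
        obtain b' where b': "\<chi> = (\<phi>, b')" "conjugate D (e @ d) b'"
          using \<chi> S unfolding realizes_tp_iff[OF assms(2) edU] by blast
        then obtain g where g: "aut D g" "b' = map g (e @ d)" by (auto simp: conjugate_def)
        then have "b' = map g e @ d" using aut_map[OF g(1) d(1)] by simp
        then show ?thesis using b'(1) g(1) by (auto simp: conjugate_def)
      qed
      then obtain f where f: "\<And>\<chi>. \<chi> \<in> S \<Longrightarrow> \<chi> = (\<phi>, f \<chi> @ d) \<and> conjugate D e (f \<chi>)" by metis
      have "inj_on f S" by (intro inj_onI) (metis f)
      then have "card (f ` S) = k" "finite (f ` S)" using fin by (auto simp: card_image)
      moreover have "f ` S \<subseteq> {e'. conjugate D e e'}" using f by auto
      moreover have "a \<in> tuples M \<Gamma>" using a by (simp add: realizes_def)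
      moreover have "a @ f \<chi> \<in> Y" if "\<chi> \<in> S" for \<chi>
      proof -
        have "holds M a \<chi>" using a that by (simp add: realizes_def)
        then have "sat M (a @ f \<chi> @ d) \<phi>" using f[OF that] by (metis holds.simps)
        moreover have "f \<chi> \<in> tuples M (map srt e)"
          using f[OF that] conjugate_iff[OF assms(2) e] by blast
        ultimately show ?thesis using inY \<open>a \<in> tuples M \<Gamma>\<close> by blast
      qed
      ultimately show False using k by blast
    qed
    ultimately show "strongly_divides M \<Gamma> D (\<phi>, e @ d)" by auto
  qed
qed

lemma thorn_forks_fm_iff: "thorn_forks_fm \<kappa> M \<Gamma> C \<chi> \<longleftrightarrow> tfork C \<Gamma> (sol \<Gamma> \<chi>)"
proof
  assume "thorn_forks_fm \<kappa> M \<Gamma> C \<chi>"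
  then obtain \<Psi> where \<Psi>: "finite \<Psi>" "\<Psi> \<subseteq> fms_over M \<Gamma> U" "\<And>\<psi>. \<psi> \<in> \<Psi> \<Longrightarrow> thorn_divides \<kappa> M \<Gamma> C \<psi>"
    "\<And>a. a \<in> tuples M \<Gamma> \<Longrightarrow> holds M a \<chi> \<Longrightarrow> \<exists>\<psi>\<in>\<Psi>. holds M a \<psi>"
    unfolding thorn_forks_fm_def by blast
  show "tfork C \<Gamma> (sol \<Gamma> \<chi>)"
    unfolding tfork_def
  proof (intro exI[of _ "sol \<Gamma> ` \<Psi>"] conjI ballI)
    fix Y assume "Y \<in> sol \<Gamma> ` \<Psi>"
    then obtain \<psi> where \<psi>: "\<psi> \<in> \<Psi>" "Y = sol \<Gamma> \<psi>" by blast
    then obtain D where D: "sml D" "C \<subseteq> D" "strongly_divides M \<Gamma> D \<psi>"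
      using \<Psi>(3) unfolding thorn_divides_def by blast
    have "sdiv D \<Gamma> Y" unfolding \<psi>(2) using D(3) \<Psi>(2) \<psi>(1) D(1) by (intro sdiv_sol) auto
    then show "tdiv C \<Gamma> Y" using D unfolding tdiv_def by blast
  next
    show "sol \<Gamma> \<chi> \<subseteq> \<Union> (sol \<Gamma> ` \<Psi>)" using \<Psi>(4) by auto
  qed (use \<Psi>(1) in simp)
next
  assume "tfork C \<Gamma> (sol \<Gamma> \<chi>)"
  then obtain \<Y> where \<Y>: "finite \<Y>" "\<And>Y. Y \<in> \<Y> \<Longrightarrow> tdiv C \<Gamma> Y" "sol \<Gamma> \<chi> \<subseteq> \<Union>\<Y>"
    unfolding tfork_def by blast
  have "\<exists>\<psi>. \<psi> \<in> fms_over M \<Gamma> U \<and> thorn_divides \<kappa> M \<Gamma> C \<psi> \<and> Y = sol \<Gamma> \<psi>" if "Y \<in> \<Y>" for Y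
  proof -
    have "tdiv C \<Gamma> Y" using \<Y>(2) that .
    then obtain D where D: "sml D" "C \<subseteq> D" "sdiv D \<Gamma> Y" unfolding tdiv_def by blast
    obtain \<psi> where "\<psi> \<in> fms_over M \<Gamma> U" "strongly_divides M \<Gamma> D \<psi>" "Y = sol \<Gamma> \<psi>"
      by (rule sol_of_sdiv[OF D(3,1)])
    then show ?thesis using D unfolding thorn_divides_def by blast
  qed
  then obtain f where f: "\<And>Y. Y \<in> \<Y> \<Longrightarrow> f Y \<in> fms_over M \<Gamma> U \<and> thorn_divides \<kappa> M \<Gamma> C (f Y) \<and> Y = sol \<Gamma> (f Y)"
    by metis
  show "thorn_forks_fm \<kappa> M \<Gamma> C \<chi>"
    unfolding thorn_forks_fm_def
  proof (intro exI[of _ "f ` \<Y>"] conjI ballI impI)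
    show "finite (f ` \<Y>)" "f ` \<Y> \<subseteq> fms_over M \<Gamma> U" using \<Y>(1) f by auto
    show "thorn_divides \<kappa> M \<Gamma> C \<psi>" if "\<psi> \<in> f ` \<Y>" for \<psi> using that f by blast
    fix a assume a: "a \<in> tuples M \<Gamma>" "holds M a \<chi>"
    then obtain Y where Y: "Y \<in> \<Y>" "a \<in> Y" using \<Y>(3) by blast
    then have "a \<in> sol \<Gamma> (f Y)" using f by blast
    then show "\<exists>\<psi>\<in>f ` \<Y>. holds M a \<psi>" using Y(1) by blast
  qed
qed

lemma thorn_indep_iff:
  assumes "set a \<subseteq> U"
  shows "thorn_indep \<kappa> M a C B \<longleftrightarrow>
    (\<forall>X. dfn M (C \<union> B) (map srt a) X \<longrightarrow> a \<in> X \<longrightarrow> \<not> tfork C (map srt a) X)"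
  unfolding thorn_indep_def thorn_forks_def thorn_forks_fm_iff
  using tp_ball[OF in_tuples_self[OF assms], of "C \<union> B" "\<lambda>X. \<not> tfork C (map srt a) X"] by blast

lemma tdiv_mono: "tdiv C \<Gamma> X \<Longrightarrow> C' \<subseteq> C \<Longrightarrow> tdiv C' \<Gamma> X"
  unfolding tdiv_def by blast

lemma tfork_mono: "tfork C \<Gamma> X \<Longrightarrow> C' \<subseteq> C \<Longrightarrow> tfork C' \<Gamma> X"
  unfolding tfork_def by (meson tdiv_mono)

lemma tfork_Union:
  assumes "finite \<X>" "\<And>X. X \<in> \<X> \<Longrightarrow> tfork C \<Gamma> X" "Z \<subseteq> \<Union>\<X>"
  shows "tfork C \<Gamma> Z"
proof -
  have "\<forall>X\<in>\<X>. \<exists>\<Y>. finite \<Y> \<and> (\<forall>Y\<in>\<Y>. tdiv C \<Gamma> Y) \<and> X \<subseteq> \<Union>\<Y>"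
    using assms(2) unfolding tfork_def by (rule ballI)
  from bchoice[OF this]
  obtain f where f: "\<forall>X\<in>\<X>. finite (f X) \<and> (\<forall>Y\<in>f X. tdiv C \<Gamma> Y) \<and> X \<subseteq> \<Union>(f X)" ..
  show ?thesis
    unfolding tfork_def
  proof (intro exI[of _ "\<Union>(f ` \<X>)"] conjI)
    show "finite (\<Union>(f ` \<X>))" using assms(1) f by auto
    show "\<forall>Y\<in>\<Union>(f ` \<X>). tdiv C \<Gamma> Y"
    proof
      fix Y assume "Y \<in> \<Union>(f ` \<X>)"
      then obtain X where X: "X \<in> \<X>" "Y \<in> f X" by (rule UN_E)
      show "tdiv C \<Gamma> Y" using bspec[OF f X(1)] X(2) by simp
    qed
    show "Z \<subseteq> \<Union>(\<Union>(f ` \<X>))"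
    proof
      fix z assume "z \<in> Z"
      then obtain X where X: "X \<in> \<X>" "z \<in> X" using assms(3) by (meson UnionE subsetD)
      have "z \<in> \<Union>(f X)" using bspec[OF f X(1)] X(2) by (meson subsetD)
      then show "z \<in> \<Union>(\<Union>(f ` \<X>))" using X(1) by auto
    qed
  qed
qed

lemma tfork_tdiv: "tdiv C \<Gamma> X \<Longrightarrow> tfork C \<Gamma> X"
  unfolding tfork_def by (intro exI[of _ "{X}"]) auto

lemma thorn_indep_mono:
  assumes "thorn_indep \<kappa> M a C B" "set a \<subseteq> U" "C \<subseteq> C'" "C' \<union> B' \<subseteq> C \<union> B"
  shows "thorn_indep \<kappa> M a C' B'"
  using assms(1) unfolding thorn_indep_iff[OF assms(2)]
  using dfn_mono[OF _ assms(4)] tfork_mono[OF _ assms(3)] by blast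

lemma sdiv_byD:
  assumes "sdiv_by D \<Gamma> X e"
  shows "set e \<subseteq> U" "\<not> algebraic M D e" "D \<subseteq> U \<Longrightarrow> dfn M (D \<union> set e) \<Gamma> X"
proof -
  from assms obtain Y where e: "set e \<subseteq> U" and Y: "dfn M D (\<Gamma> @ map srt e) Y"
    and X: "X = {a \<in> tuples M \<Gamma>. a @ e \<in> Y}" and na: "\<not> algebraic M D e"
    unfolding sdiv_by_def by blast
  show "set e \<subseteq> U" "\<not> algebraic M D e" by fact+
  show "dfn M (D \<union> set e) \<Gamma> X" if "D \<subseteq> U"
    unfolding X using e that dfn_fibre[OF Y, of "D \<union> set e" e] by auto
qed

text \<open>A larger base leaves fewer conjugates of \<open>e\<close>, so only its non-algebraicity can get lost.\<close>

lemma sdiv_by_mono: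
  assumes "sdiv_by D \<Gamma> X e" and D': "D \<subseteq> D'" "\<not> algebraic M D' e"
  shows "sdiv_by D' \<Gamma> X e"
proof -
  from assms obtain Y k where e: "set e \<subseteq> U" and Y: "dfn M D (\<Gamma> @ map srt e) Y"
    and X: "X = {a \<in> tuples M \<Gamma>. a @ e \<in> Y}"
    and k: "k_incons D \<Gamma> e k Y"
    unfolding sdiv_by_def by blast
  have "k_incons D' \<Gamma> e k Y"
  proof (intro allI impI)
    fix S assume S: "S \<subseteq> {e'. conjugate D' e e'}" "finite S \<and> card S = k"
    then have "S \<subseteq> {e'. conjugate D e e'}" using conjugate_mono D'(1) by blast
    then show "\<not> (\<exists>a \<in> tuples M \<Gamma>. \<forall>e'\<in>S. a @ e' \<in> Y)" using k S(2) by blast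
  qed
  then show ?thesis unfolding sdiv_by_def using e dfn_mono[OF Y D'(1)] X D'(2) by blast
qed

lemma map_nth_append_shift:
  assumes "length a = n" "length c = m" "\<And>i. i \<in> set vs \<Longrightarrow> i < n"
  shows "map ((!) (a @ c)) (vs @ [n..<n + m]) = map ((!) a) vs @ c"
proof -
  have "map ((!) (a @ c)) vs = map ((!) a) vs" using assms by (auto simp: nth_append)
  moreover have "map ((!) (a @ c)) [n..<n + m] = c" using assms by (intro nth_equalityI) (auto simp: nth_append)
  ultimately show ?thesis by simp
qed

lemma sdiv_reindex:
  assumes "sdiv D \<Gamma> X" "D \<subseteq> U" and vs: "\<And>i. i \<in> set vs \<Longrightarrow> i < length \<Gamma>'" "map ((!) \<Gamma>') vs = \<Gamma>"
  shows "sdiv D \<Gamma>' {a \<in> tuples M \<Gamma>'. map ((!) a) vs \<in> X}"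
proof -
  from assms(1) obtain e Y k where e: "set e \<subseteq> U" and Y: "dfn M D (\<Gamma> @ map srt e) Y"
    and X: "X = {a \<in> tuples M \<Gamma>. a @ e \<in> Y}" and na: "\<not> algebraic M D e"
    and k: "k_incons D \<Gamma> e k Y"
    unfolding sdiv_def sdiv_by_def by blast
  let ?n = "length \<Gamma>'" let ?ws = "vs @ [?n..<?n + length e]"
  let ?Y = "{c \<in> tuples M (\<Gamma>' @ map srt e). map ((!) c) ?ws \<in> Y}"
  have "dfn M D (\<Gamma>' @ map srt e) ?Y"
  proof (rule dfn_reindex[OF Y assms(2)])
    show "map ((!) (\<Gamma>' @ map srt e)) ?ws = \<Gamma> @ map srt e"
      using map_nth_append_shift[OF refl, of "map srt e" "length e" vs \<Gamma>'] vs by simp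
  qed (use vs(1) in fastforce)
  moreover have sub: "map ((!) a) vs \<in> tuples M \<Gamma>" if "a \<in> tuples M \<Gamma>'" for a
  proof -
    have "set (map ((!) a) vs) \<subseteq> U"
    proof -
      have "a ! i \<in> U" if "i \<in> set vs" for i
        using vs(1)[OF that] \<open>a \<in> tuples M \<Gamma>'\<close> by (auto simp: tuples_def)
      then show ?thesis by auto
    qed
    moreover have "map srt (map ((!) a) vs) = map ((!) (map srt a)) vs"
      by (rule map_nth_map[symmetric]) (use vs(1) tuples_length[OF that] in simp)
    moreover have "map srt a = \<Gamma>'" using that by (simp add: tuples_def)
    ultimately show ?thesis using vs(2) by (simp only: tuples_def mem_Collect_eq simp_thms)
  qed
  have inY: "a @ e' \<in> ?Y \<longleftrightarrow> map ((!) a) vs @ e' \<in> Y"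
    if a: "a \<in> tuples M \<Gamma>'" and e': "e' \<in> tuples M (map srt e)" for a e'
  proof -
    have "map ((!) (a @ e')) ?ws = map ((!) a) vs @ e'"
      using tuples_length[OF a] tuples_length[OF e'] vs(1) by (intro map_nth_append_shift) auto
    then show ?thesis using a e' by (simp only: mem_Collect_eq in_tuples_append[OF tuples_length[OF a]] simp_thms)
  qed
  have "{a \<in> tuples M \<Gamma>'. map ((!) a) vs \<in> X} = {a \<in> tuples M \<Gamma>'. a @ e \<in> ?Y}"
  proof (rule Collect_cong, rule conj_cong[OF refl])
    fix a assume a: "a \<in> tuples M \<Gamma>'"
    show "map ((!) a) vs \<in> X \<longleftrightarrow> a @ e \<in> ?Y"
      unfolding inY[OF a in_tuples_self[OF e]] X using sub[OF a] by blast
  qed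
  moreover have "k_incons D \<Gamma>' e k ?Y"
  proof (intro allI impI notI)
    fix S assume S: "S \<subseteq> {e'. conjugate D e e'}" "finite S \<and> card S = k"
      and "\<exists>a \<in> tuples M \<Gamma>'. \<forall>e'\<in>S. a @ e' \<in> ?Y"
    then obtain a where a: "a \<in> tuples M \<Gamma>'" "\<And>e'. e' \<in> S \<Longrightarrow> a @ e' \<in> ?Y" by blast
    have "map ((!) a) vs @ e' \<in> Y" if "e' \<in> S" for e'
    proof -
      have "conjugate D e e'" using S(1) that by blast
      then have "e' \<in> tuples M (map srt e)"
        using conjugate_set[OF _ e] conjugate_sort[OF _ e] by (simp add: tuples_def)
      then show ?thesis using a inY that by blast
    qed
    then show False using k S sub[OF a(1)] by blast
  qed
  ultimately show ?thesis unfolding sdiv_def sdiv_by_def using e na by blast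
qed

lemma sdiv_fibre:
  assumes "sdiv D (\<Gamma> @ map srt c) X" "D \<subseteq> U" "set c \<subseteq> D"
  shows "sdiv D \<Gamma> {a \<in> tuples M \<Gamma>. a @ c \<in> X}"
proof -
  from assms(1) obtain e Y k where e: "set e \<subseteq> U" and Y: "dfn M D ((\<Gamma> @ map srt c) @ map srt e) Y"
    and X: "X = {a \<in> tuples M (\<Gamma> @ map srt c). a @ e \<in> Y}" and na: "\<not> algebraic M D e"
    and k: "k_incons D (\<Gamma> @ map srt c) e k Y"
    unfolding sdiv_def sdiv_by_def by blast
  have ct: "c \<in> tuples M (map srt c)" using assms in_tuples_self[of c M] by blast
  let ?n = "length \<Gamma>" and ?m = "length e" and ?l = "length c"
  let ?ws = "[0..<?n] @ [?n + ?m..<?n + ?m + ?l] @ [?n..<?n + ?m]"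
  let ?Y = "{t \<in> tuples M (\<Gamma> @ map srt e). map ((!) (t @ c)) ?ws \<in> Y}"
  have "dfn M D (\<Gamma> @ map srt e) ?Y"
  proof (rule dfn_subst[OF Y order_refl assms(3,2)])
    show "map ((!) ((\<Gamma> @ map srt e) @ map srt c)) ?ws = (\<Gamma> @ map srt c) @ map srt e"
      by (rule map_nth_rotate) simp_all
  qed auto
  moreover have inY: "a @ e' \<in> ?Y \<longleftrightarrow> (a @ c) @ e' \<in> Y"
    if a: "a \<in> tuples M \<Gamma>" and e': "e' \<in> tuples M (map srt e)" for a e'
  proof -
    have "map ((!) ((a @ e') @ c)) ?ws = (a @ c) @ e'"
      using tuples_length[OF a] tuples_length[OF e'] by (intro map_nth_rotate) simp_all
    then show ?thesis using a e' by (simp only: mem_Collect_eq in_tuples_append[OF tuples_length[OF a]] simp_thms)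
  qed
  have ac: "a @ c \<in> tuples M (\<Gamma> @ map srt c)" if "a \<in> tuples M \<Gamma>" for a
    using that ct by (simp add: in_tuples_append tuples_length)
  have "{a \<in> tuples M \<Gamma>. a @ c \<in> X} = {a \<in> tuples M \<Gamma>. a @ e \<in> ?Y}"
  proof (rule Collect_cong, rule conj_cong[OF refl])
    fix a assume a: "a \<in> tuples M \<Gamma>"
    show "a @ c \<in> X \<longleftrightarrow> a @ e \<in> ?Y"
      unfolding inY[OF a in_tuples_self[OF e]] X using ac[OF a] by blast
  qed
  moreover have "k_incons D \<Gamma> e k ?Y"
  proof (intro allI impI notI)
    fix S assume S: "S \<subseteq> {e'. conjugate D e e'}" "finite S \<and> card S = k"
      and "\<exists>a \<in> tuples M \<Gamma>. \<forall>e'\<in>S. a @ e' \<in> ?Y"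
    then obtain a where a: "a \<in> tuples M \<Gamma>" "\<And>e'. e' \<in> S \<Longrightarrow> a @ e' \<in> ?Y" by blast
    have "(a @ c) @ e' \<in> Y" if "e' \<in> S" for e'
    proof -
      have "conjugate D e e'" using S(1) that by blast
      then have "e' \<in> tuples M (map srt e)"
        using conjugate_set[OF _ e] conjugate_sort[OF _ e] by (simp add: tuples_def)
      then show ?thesis using a inY that by blast
    qed
    then show False using k S ac[OF a(1)] by blast
  qed
  ultimately show ?thesis unfolding sdiv_def sdiv_by_def using e na by blast
qed

end

lemma list_of_image:
  assumes "set l \<subseteq> g ` A"
  obtains l' where "set l' \<subseteq> A" "l = map g l'"
proof -
  have "l \<in> map g ` lists A" unfolding lists_image[symmetric] using assms by auto
  then show ?thesis using that by auto
qed

lemma replace_entries: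
  assumes "distinct a" "length t = length a" "set c \<inter> set a = {}"
  obtains h where "\<And>j. j < length a \<Longrightarrow> h (a ! j) = t ! j"
    "\<And>j. j < length (a @ c) \<Longrightarrow> h ((a @ c) ! j) = (t @ c) ! j" "\<And>x. x \<notin> set a \<Longrightarrow> h x = x"
proof
  define h where "h x = (if x \<in> set a then the (map_of (zip a t) x) else x)" for x
  show h: "h (a ! j) = t ! j" if "j < length a" for j
    using that assms(2) map_of_zip_nth[of a t j] assms(1) by (simp add: h_def)
  show "h ((a @ c) ! j) = (t @ c) ! j" if "j < length (a @ c)" for j
  proof (cases "j < length a")
    case True
    then show ?thesis using h assms(2) by (simp add: nth_append)
  next
    case False
    then have "c ! (j - length a) \<in> set c" using that by simp
    then have "c ! (j - length a) \<notin> set a" using assms(3) by blast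
    then show ?thesis using False assms(2) by (simp add: nth_append h_def)
  qed
  show "h x = x" if "x \<notin> set a" for x using that by (simp add: h_def)
qed

context monster
begin

section \<open>Invariance under automorphisms\<close>

lemma map_inverse: "set y \<subseteq> U \<Longrightarrow> (\<And>x. x \<in> U \<Longrightarrow> h (g x) = x) \<Longrightarrow> map h (map g y) = y"
  by (auto intro!: map_idI)

lemma image_inverse: "A \<subseteq> U \<Longrightarrow> (\<And>x. x \<in> U \<Longrightarrow> h (g x) = x) \<Longrightarrow> h ` g ` A = A"
  by force

lemma dfn_image:
  assumes "dfn M A \<Gamma> X" "automorphism M g" "A \<subseteq> U"
  shows "dfn M (g ` A) \<Gamma> (map g ` X)"
proof -
  from assms(1) obtain \<phi> b where b: "set b \<subseteq> A" "wf_fm M (\<Gamma> @ map srt b) \<phi>"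
    "X = {a \<in> tuples M \<Gamma>. sat M (a @ b) \<phi>}" by (rule dfnE)
  have bU: "set b \<subseteq> U" using b(1) assms(3) by blast
  obtain h where h: "automorphism M h" "\<And>x. x \<in> U \<Longrightarrow> h (g x) = x" "\<And>x. x \<in> U \<Longrightarrow> g (h x) = x"
    using assms(2) by (rule automorphism_inverse) blast
  have eq: "sat M (map g a @ map g b) \<phi> \<longleftrightarrow> sat M (a @ b) \<phi>" if "a \<in> tuples M \<Gamma>" for a
    using sat_automorphism[OF assms(2) b(2), of "a @ b"] that in_tuples_self[OF bU]
    by (simp add: in_tuples_append tuples_length)
  show ?thesis
  proof (rule dfnI)
    show "set (map g b) \<subseteq> g ` A" using b(1) by auto
    show "wf_fm M (\<Gamma> @ map srt (map g b)) \<phi>" unfolding map_sort_automorphism[OF assms(2) bU] by (rule b(2))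
    show "map g ` X = {a \<in> tuples M \<Gamma>. sat M (a @ map g b) \<phi>}"
    proof
      show "map g ` X \<subseteq> {a \<in> tuples M \<Gamma>. sat M (a @ map g b) \<phi>}"
        using eq tuples_automorphism[OF assms(2)] unfolding b(3) by auto
      show "{a \<in> tuples M \<Gamma>. sat M (a @ map g b) \<phi>} \<subseteq> map g ` X"
      proof
        fix a assume "a \<in> {a \<in> tuples M \<Gamma>. sat M (a @ map g b) \<phi>}"
        then have a: "a \<in> tuples M \<Gamma>" "sat M (a @ map g b) \<phi>" by auto
        have gh: "map g (map h a) = a" using a(1) h(3) by (intro map_inverse) (auto simp: tuples_def)
        have ha: "map h a \<in> tuples M \<Gamma>" using tuples_automorphism[OF h(1) a(1)] .
        have "sat M (map h a @ b) \<phi>" using eq[OF ha] a(2) unfolding gh by simp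
        then have "map h a \<in> X" using ha b(3) by simp
        then show "a \<in> map g ` X" using gh by (metis image_eqI)
      qed
    qed
  qed
qed

lemma algebraic_image:
  assumes "algebraic M D e" "automorphism M g" "D \<subseteq> U" "set e \<subseteq> U"
  shows "algebraic M (g ` D) (map g e)"
proof -
  obtain X where X: "dfn M D (map srt e) X" "e \<in> X" "finite X"
    using assms(1) algebraic_iff[OF assms(4)] by blast
  have "dfn M (g ` D) (map srt (map g e)) (map g ` X)"
    using dfn_image[OF X(1) assms(2,3)] unfolding map_sort_automorphism[OF assms(2,4)] .
  moreover have "map g e \<in> map g ` X" "finite (map g ` X)" using X by auto
  ultimately show ?thesis using algebraic_iff[OF automorphism_set[OF assms(2,4)]] by blast
qed

lemma conjugate_image:
  assumes "conjugate D e e'" "automorphism M g" "D \<subseteq> U" "set e \<subseteq> U"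
  shows "conjugate (g ` D) (map g e) (map g e')"
proof -
  obtain f where f: "aut D f" "e' = map f e" using assms(1) by (auto simp: conjugate_def)
  obtain h where h: "automorphism M h" "\<And>x. x \<in> U \<Longrightarrow> h (g x) = x" "\<And>x. x \<in> U \<Longrightarrow> g (h x) = x"
    using assms(2) by (rule automorphism_inverse) blast
  have "automorphism M (g \<circ> (f \<circ> h))"
    using automorphism_comp[OF automorphism_comp[OF h(1) aut_automorphism[OF f(1)]] assms(2)] .
  moreover have "(g \<circ> (f \<circ> h)) x = x" if "x \<in> g ` D" for x
    using that h(2) assms(3) aut_fix[OF f(1)] by auto
  ultimately have "aut (g ` D) (g \<circ> (f \<circ> h))" by (simp add: aut_def)
  moreover have "map g e' = map (g \<circ> (f \<circ> h)) (map g e)"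
    unfolding f(2) using h(2) assms(4) by auto
  ultimately show ?thesis unfolding conjugate_def by blast
qed

lemma sdiv_by_image:
  assumes "sdiv_by D \<Gamma> X e" "automorphism M g" "D \<subseteq> U"
  shows "sdiv_by (g ` D) \<Gamma> (map g ` X) (map g e)"
proof -
  from assms(1) obtain Y k where e: "set e \<subseteq> U" and Y: "dfn M D (\<Gamma> @ map srt e) Y"
    and X: "X = {a \<in> tuples M \<Gamma>. a @ e \<in> Y}" and na: "\<not> algebraic M D e"
    and k: "k_incons D \<Gamma> e k Y"
    unfolding sdiv_by_def by blast
  obtain h where h: "automorphism M h" "\<And>x. x \<in> U \<Longrightarrow> h (g x) = x" "\<And>x. x \<in> U \<Longrightarrow> g (h x) = x"
    using assms(2) by (rule automorphism_inverse) blast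
  have hgD: "h ` g ` D = D" using assms(3) h(2) by (rule image_inverse)
  have hge: "map h (map g e) = e" using e h(2) by (rule map_inverse)
  have geU: "set (map g e) \<subseteq> U" by (rule automorphism_set[OF assms(2) e])
  have gDU: "g ` D \<subseteq> U" by (rule automorphism_subset[OF assms(2,3)])
  have hY: "map h y \<in> Y" if y: "y \<in> map g ` Y" for y
  proof -
    obtain z where z: "z \<in> Y" "y = map g z" using y by blast
    then have "set z \<subseteq> U" using dfn_subset_tuples[OF Y] by (auto simp: tuples_def)
    then have "map h y = z" unfolding z(2) using h(2) by (rule map_inverse)
    then show ?thesis using z(1) by simp
  qed
  show ?thesis
    unfolding sdiv_by_def
  proof (intro exI conjI)
    show "set (map g e) \<subseteq> U" by fact
    show "dfn M (g ` D) (\<Gamma> @ map srt (map g e)) (map g ` Y)"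
      using dfn_image[OF Y assms(2,3)] unfolding map_sort_automorphism[OF assms(2) e] .
    show "map g ` X = {a \<in> tuples M \<Gamma>. a @ map g e \<in> map g ` Y}"
    proof
      show "map g ` X \<subseteq> {a \<in> tuples M \<Gamma>. a @ map g e \<in> map g ` Y}"
      proof
        fix a assume "a \<in> map g ` X"
        then obtain a' where a': "a' \<in> tuples M \<Gamma>" "a' @ e \<in> Y" "a = map g a'" using X by blast
        then have "map g (a' @ e) \<in> map g ` Y" by blast
        then show "a \<in> {a \<in> tuples M \<Gamma>. a @ map g e \<in> map g ` Y}"
          using a' tuples_automorphism[OF assms(2) a'(1)] by simp
      qed
      show "{a \<in> tuples M \<Gamma>. a @ map g e \<in> map g ` Y} \<subseteq> map g ` X"
      proof
        fix a assume "a \<in> {a \<in> tuples M \<Gamma>. a @ map g e \<in> map g ` Y}"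
        then have a: "a \<in> tuples M \<Gamma>" "a @ map g e \<in> map g ` Y" by auto
        have "map h a @ e \<in> Y" using hY[OF a(2)] unfolding map_append hge .
        then have "map h a \<in> X" using X tuples_automorphism[OF h(1) a(1)] by simp
        moreover have "map g (map h a) = a"
          using a(1) h(3) by (intro map_inverse) (auto simp: tuples_def)
        ultimately show "a \<in> map g ` X" by (metis image_eqI)
      qed
    qed
    show "\<not> algebraic M (g ` D) (map g e)"
      using algebraic_image[OF _ h(1) gDU geU] na unfolding hgD hge by blast
    show "k_incons (g ` D) \<Gamma> (map g e) k (map g ` Y)"
    proof (intro allI impI notI)
      fix S assume S: "S \<subseteq> {e'. conjugate (g ` D) (map g e) e'}" "finite S \<and> card S = k"
        and "\<exists>a \<in> tuples M \<Gamma>. \<forall>e'\<in>S. a @ e' \<in> map g ` Y"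
      then obtain a where a: "a \<in> tuples M \<Gamma>" "\<forall>e'\<in>S. a @ e' \<in> map g ` Y" by blast
      have SU: "set e' \<subseteq> U" if "e' \<in> S" for e' using that S(1) conjugate_set[OF _ geU] by blast
      have "inj_on (map h) S"
      proof (rule inj_on_inverseI)
        show "map g (map h e') = e'" if "e' \<in> S" for e' using SU[OF that] h(3) by (rule map_inverse)
      qed
      then have "finite (map h ` S) \<and> card (map h ` S) = k" using S(2) by (simp add: card_image)
      moreover have "map h ` S \<subseteq> {e'. conjugate D e e'}"
        using conjugate_image[OF _ h(1) gDU geU] S(1) unfolding hgD hge by blast
      moreover have "map h a \<in> tuples M \<Gamma>" using tuples_automorphism[OF h(1) a(1)] .
      moreover have "\<forall>e'\<in>map h ` S. map h a @ e' \<in> Y"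
      proof (rule ballI, erule imageE)
        fix e' s assume s: "s \<in> S" "e' = map h s"
        have "map h (a @ s) \<in> Y" using a(2) s(1) by (intro hY) blast
        then show "map h a @ e' \<in> Y" by (simp add: s(2))
      qed
      ultimately show False using k by blast
    qed
  qed
qed

lemma sdiv_image:
  assumes "sdiv D \<Gamma> X" "automorphism M g" "D \<subseteq> U"
  shows "sdiv (g ` D) \<Gamma> (map g ` X)"
  using assms(1) sdiv_by_image[OF _ assms(2,3)] unfolding sdiv_def by blast

lemma tfork_image:
  assumes "tfork C \<Gamma> X" "automorphism M g"
  shows "tfork (g ` C) \<Gamma> (map g ` X)"
proof -
  obtain \<Y> where \<Y>: "finite \<Y>" "\<forall>Y\<in>\<Y>. tdiv C \<Gamma> Y" "X \<subseteq> \<Union>\<Y>"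
    using assms(1) unfolding tfork_def by blast
  have "tdiv (g ` C) \<Gamma> (map g ` Y)" if Y: "Y \<in> \<Y>" for Y
  proof -
    obtain D where "sml D" "C \<subseteq> D" "sdiv D \<Gamma> Y" using bspec[OF \<Y>(2) Y] unfolding tdiv_def by blast
    then have "sml (g ` D)" "g ` C \<subseteq> g ` D" "sdiv (g ` D) \<Gamma> (map g ` Y)"
      using small_image[OF assms(2)] sdiv_image[OF _ assms(2) smallD] by auto
    then show ?thesis unfolding tdiv_def by blast
  qed
  then have "\<forall>Z\<in>(`) (map g) ` \<Y>. tdiv (g ` C) \<Gamma> Z" by blast
  moreover have "map g ` X \<subseteq> \<Union>((`) (map g) ` \<Y>)" using \<Y>(3) by blast
  moreover have "finite ((`) (map g) ` \<Y>)" using \<Y>(1) by simp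
  ultimately show ?thesis unfolding tfork_def by blast
qed

lemma thorn_indep_image:
  assumes "thorn_indep \<kappa> M a C B" "automorphism M g" "set a \<subseteq> U" "C \<subseteq> U" "B \<subseteq> U"
  shows "thorn_indep \<kappa> M (map g a) (g ` C) (g ` B)"
  unfolding thorn_indep_iff[OF automorphism_set[OF assms(2,3)]]
proof (intro allI impI notI)
  obtain h where h: "automorphism M h" "\<And>x. x \<in> U \<Longrightarrow> h (g x) = x"
    using assms(2) by (rule automorphism_inverse) blast
  fix X assume X: "dfn M (g ` C \<union> g ` B) (map srt (map g a)) X" "map g a \<in> X"
    "tfork (g ` C) (map srt (map g a)) X"
  have s: "map srt (map g a) = map srt a" by (rule map_sort_automorphism[OF assms(2,3)])
  have hC: "h ` g ` C = C" "h ` (g ` C \<union> g ` B) = C \<union> B"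
    using image_inverse[of _ h g] h(2) assms(4,5) by (simp_all add: image_Un)
  have "dfn M (C \<union> B) (map srt a) (map h ` X)"
    using dfn_image[OF X(1) h(1)] automorphism_subset[OF assms(2)] assms(4,5) unfolding s hC by blast
  moreover have "map h (map g a) = a" using assms(3) h(2) by (rule map_inverse)
  then have "a \<in> map h ` X" using X(2) by (metis image_eqI)
  moreover have "tfork C (map srt a) (map h ` X)" using tfork_image[OF X(3) h(1)] unfolding s hC .
  ultimately show False using assms(1) unfolding thorn_indep_iff[OF assms(3)] by blast
qed

section \<open>Independence of sets\<close>

text \<open>Independence of sets, of finite character on the left by definition.\<close>

definition ind :: "'a set \<Rightarrow> 'a set \<Rightarrow> 'a set \<Rightarrow> bool" where
  "ind A C B \<longleftrightarrow> (\<forall>a. set a \<subseteq> A \<longrightarrow> thorn_indep \<kappa> M a C B)"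

lemma indD: "ind A C B \<Longrightarrow> set a \<subseteq> A \<Longrightarrow> thorn_indep \<kappa> M a C B"
  by (simp add: ind_def)

lemma tfork_reindex:
  assumes "tfork C \<Gamma> X" and vs: "\<And>i. i \<in> set vs \<Longrightarrow> i < length \<Gamma>'" "map ((!) \<Gamma>') vs = \<Gamma>"
  shows "tfork C \<Gamma>' {a \<in> tuples M \<Gamma>'. map ((!) a) vs \<in> X}"
proof -
  obtain \<Y> where \<Y>: "finite \<Y>" "\<forall>Y\<in>\<Y>. tdiv C \<Gamma> Y" "X \<subseteq> \<Union>\<Y>"
    using assms(1) unfolding tfork_def by blast
  let ?f = "\<lambda>Y. {a \<in> tuples M \<Gamma>'. map ((!) a) vs \<in> Y}"
  have "tdiv C \<Gamma>' (?f Y)" if Y: "Y \<in> \<Y>" for Y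
  proof -
    obtain D where "sml D" "C \<subseteq> D" "sdiv D \<Gamma> Y" using bspec[OF \<Y>(2) Y] unfolding tdiv_def by blast
    moreover from this have "sdiv D \<Gamma>' (?f Y)" by (intro sdiv_reindex[OF _ smallD vs])
    ultimately show ?thesis unfolding tdiv_def by blast
  qed
  then have "\<forall>Z\<in>?f ` \<Y>. tdiv C \<Gamma>' Z" by blast
  moreover have "?f X \<subseteq> \<Union>(?f ` \<Y>)" using \<Y>(3) by blast
  moreover have "finite (?f ` \<Y>)" using \<Y>(1) by simp
  ultimately show ?thesis unfolding tfork_def by blast
qed

text \<open>A forking formula in some of the variables still forks when the others are added as dummy
  variables.\<close>

lemma thorn_indep_subtuple:
  assumes "thorn_indep \<kappa> M a C B" "set b \<subseteq> set a" "set a \<subseteq> U" "C \<union> B \<subseteq> U"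
  shows "thorn_indep \<kappa> M b C B"
proof -
  have bU: "set b \<subseteq> U" using assms by blast
  obtain vs where vs: "\<And>i. i \<in> set vs \<Longrightarrow> i < length a" "map ((!) a) vs = b"
    by (rule sublist_positions[OF assms(2)]) blast
  have vs': "map ((!) (map srt a)) vs = map srt b" using map_nth_map[of vs a srt, OF vs(1)] vs(2) by simp
  show ?thesis
    unfolding thorn_indep_iff[OF bU]
  proof (intro allI impI notI)
    fix X assume X: "dfn M (C \<union> B) (map srt b) X" "b \<in> X" "tfork C (map srt b) X"
    let ?X = "{t \<in> tuples M (map srt a). map ((!) t) vs \<in> X}"
    have "dfn M (C \<union> B) (map srt a) ?X" using vs vs' by (intro dfn_reindex[OF X(1) assms(4)]) auto
    moreover have "a \<in> ?X" using in_tuples_self[OF assms(3)] vs(2) X(2) by simp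
    moreover have "tfork C (map srt a) ?X" using vs vs' by (intro tfork_reindex[OF X(3)]) auto
    ultimately show False using assms(1) unfolding thorn_indep_iff[OF assms(3)] by blast
  qed
qed

lemma ind_set_iff:
  assumes "set a \<subseteq> U" "C \<union> B \<subseteq> U"
  shows "ind (set a) C B \<longleftrightarrow> thorn_indep \<kappa> M a C B"
  using thorn_indep_subtuple[OF _ _ assms] unfolding ind_def by blast

lemma ind_mono:
  assumes "ind A C B" "A \<subseteq> U" "A' \<subseteq> A" "C \<subseteq> C'" "C' \<union> B' \<subseteq> C \<union> B"
  shows "ind A' C' B'"
  unfolding ind_def
proof (intro allI impI)
  fix a assume a: "set a \<subseteq> A'"
  then have "thorn_indep \<kappa> M a C B" using assms(1,3) unfolding ind_def by blast
  then show "thorn_indep \<kappa> M a C' B'"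
    by (rule thorn_indep_mono) (use assms a in auto)
qed

lemma ind_image:
  assumes "ind A C B" "automorphism M g" "A \<subseteq> U" "C \<subseteq> U" "B \<subseteq> U"
  shows "ind (g ` A) (g ` C) (g ` B)"
  unfolding ind_def
proof (intro allI impI)
  fix l assume l: "set l \<subseteq> g ` A"
  obtain l' where l': "set l' \<subseteq> A" "l = map g l'" by (rule list_of_image[OF l])
  then have "set l' \<subseteq> U" using assms(3) by blast
  then show "thorn_indep \<kappa> M l (g ` C) (g ` B)"
    unfolding l'(2) using l'(1) assms by (intro thorn_indep_image) (auto simp: ind_def)
qed

lemma ind_image_iff:
  assumes g: "automorphism M g" and U: "A \<subseteq> U" "C \<subseteq> U" "B \<subseteq> U"
  shows "ind (g ` A) (g ` C) (g ` B) \<longleftrightarrow> ind A C B"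
proof
  obtain h where h: "automorphism M h" "\<And>x. x \<in> U \<Longrightarrow> h (g x) = x"
    using g by (rule automorphism_inverse) blast
  have inv: "h ` g ` Z = Z" if "Z \<subseteq> U" for Z using that h(2) by (rule image_inverse)
  assume "ind (g ` A) (g ` C) (g ` B)"
  from ind_image[OF this h(1)] show "ind A C B"
    using automorphism_subset[OF g] U by (simp add: inv)
qed (rule ind_image[OF _ g U])

text \<open>The conditions on a copy of \<open>A\<close> are to have the same type over \<open>C \<union> B\<close> (the constraints \<open>\<Sigma>1\<close>) and
  to avoid all sets definable over \<open>C \<union> B'\<close> that fork over \<open>C\<close> (the constraints \<open>\<Sigma>2\<close>). If finitely
  many of them were inconsistent, some set in the type of a finite tuple of \<open>A\<close> over \<open>C \<union> B\<close>
  would be covered by finitely many forking sets and hence would fork itself.\<close>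

lemma extension:
  assumes ind: "ind A C B" and sml: "sml A" "sml C" "sml B" "sml B'" and B': "B \<subseteq> B'"
  obtains g where "aut (C \<union> B) g" "ind (g ` A) C B'"
proof -
  let ?V = "A \<union> (C \<union> B)"
  have V: "sml ?V" using sml small_Un by blast
  have VU: "?V \<subseteq> U" using V by (rule smallD)
  have AU: "A \<subseteq> U" and CBU: "C \<union> B \<subseteq> U" using VU by auto
  have P: "sml (C \<union> B')" using sml small_Un by blast
  define \<Sigma>1 where "\<Sigma>1 = {(l, X). set l \<subseteq> ?V \<and> dfn M (C \<union> B) (map srt l) X \<and> l \<in> X}"
  define \<Sigma>2 where "\<Sigma>2 = {(l, tuples M (map srt l) - X) | l X.
    set l \<subseteq> A \<and> dfn M (C \<union> B') (map srt l) X \<and> tfork C (map srt l) X}"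
  have "\<exists>h. (\<forall>v\<in>?V. h v \<in> U \<and> srt (h v) = srt v) \<and> (\<forall>(vs, X)\<in>\<Sigma>1 \<union> \<Sigma>2. map h vs \<in> X)"
  proof (rule realize_family[OF P small_less[OF V]])
    show "set vs \<subseteq> ?V \<and> dfn M (C \<union> B') (map srt vs) X" if "(vs, X) \<in> \<Sigma>1 \<union> \<Sigma>2" for vs X
    proof (cases "(vs, X) \<in> \<Sigma>1")
      case True
      then show ?thesis using dfn_mono[of M "C \<union> B" "map srt vs" X "C \<union> B'"] B' by (auto simp: \<Sigma>1_def)
    next
      case False
      then show ?thesis using that dfn_compl by (auto simp: \<Sigma>2_def)
    qed
    fix F assume F: "F \<subseteq> \<Sigma>1 \<union> \<Sigma>2" "finite F"
    define F1 where "F1 = F \<inter> \<Sigma>1"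
    define F2 where "F2 = F \<inter> \<Sigma>2"
    have fin: "finite F1" "finite F2" using F(2) by (auto simp: F1_def F2_def)
    define W where "W = (\<Union>(vs, X)\<in>F. set vs)"
    have "finite W" using F(2) by (auto simp: W_def)
    have WV: "W \<subseteq> ?V" using F(1) by (force simp: W_def \<Sigma>1_def \<Sigma>2_def)
    obtain a where a: "set a = W \<inter> A" "distinct a"
      using finite_distinct_list[of "W \<inter> A"] \<open>finite W\<close> by blast
    obtain c where c: "set c = W - A" using finite_list[of "W - A"] \<open>finite W\<close> by blast
    have ac: "set c \<inter> set a = {}" using a(1) c by blast
    let ?\<Gamma> = "map srt a"
    have aU: "set a \<subseteq> U" and cU: "set c \<subseteq> U" using a c WV VU by auto
    have cCB: "set c \<subseteq> C \<union> B" using c WV by auto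
    have at: "a \<in> tuples M ?\<Gamma>" using aU by (rule in_tuples_self)
    have "\<exists>ps. \<forall>vs X. (vs, X) \<in> F \<longrightarrow> (\<forall>i\<in>set (ps vs). i < length (a @ c)) \<and> map ((!) (a @ c)) (ps vs) = vs"
    proof -
      have "\<exists>p. (\<forall>i\<in>set p. i < length (a @ c)) \<and> map ((!) (a @ c)) p = vs" if "set vs \<subseteq> W" for vs
        using sublist_positions[of vs "a @ c"] that a c by (metis Un_Diff_Int Un_commute set_append)
      then obtain ps where "\<And>vs. set vs \<subseteq> W \<Longrightarrow> (\<forall>i\<in>set (ps vs). i < length (a @ c)) \<and> map ((!) (a @ c)) (ps vs) = vs"
        by metis
      moreover have "set vs \<subseteq> W" if "(vs, X) \<in> F" for vs X using that by (auto simp: W_def)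
      ultimately show ?thesis by blast
    qed
    then obtain ps where ps: "\<And>vs X i. (vs, X) \<in> F \<Longrightarrow> i \<in> set (ps vs) \<Longrightarrow> i < length (a @ c)"
      "\<And>vs X. (vs, X) \<in> F \<Longrightarrow> map ((!) (a @ c)) (ps vs) = vs" by blast
    let ?f = "\<lambda>(vs, X). {t \<in> tuples M ?\<Gamma>. map ((!) (t @ c)) (ps vs) \<in> X}"
    let ?Z = "{t \<in> tuples M ?\<Gamma>. \<forall>i\<in>F1. t \<in> ?f i}"
    have "dfn M (C \<union> B) ?\<Gamma> ?Z"
    proof (rule dfn_Inter[OF fin(1)])
      fix i assume i: "i \<in> F1"
      obtain vs X where iv: "i = (vs, X)" by force
      have vF: "(vs, X) \<in> F" using i by (simp add: iv F1_def)
      have "dfn M (C \<union> B) ?\<Gamma> {t \<in> tuples M ?\<Gamma>. map ((!) (t @ c)) (ps vs) \<in> X}"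
      proof (rule dfn_subst[OF _ order_refl cCB CBU])
        show "dfn M (C \<union> B) (map srt vs) X" using i by (simp add: iv F1_def \<Sigma>1_def)
        show "map ((!) (?\<Gamma> @ map srt c)) (ps vs) = map srt vs"
          using map_nth_map[of "ps vs" "a @ c" srt, OF ps(1)[OF vF]] ps(2)[OF vF] by (simp only: map_append)
      qed (use ps(1)[OF vF] in auto)
      then show "dfn M (C \<union> B) ?\<Gamma> (?f i)" by (simp add: iv)
    qed
    moreover have "a \<in> ?f i" if "i \<in> F1" for i
    proof -
      obtain vs X where iv: "i = (vs, X)" by force
      have "(vs, X) \<in> F" "vs \<in> X" using that by (auto simp: iv F1_def \<Sigma>1_def)
      then show ?thesis using ps(2)[of vs X] at by (simp add: iv)
    qed
    then have "a \<in> ?Z" using at by blast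
    moreover have "thorn_indep \<kappa> M a C B" using ind a(1) by (auto simp: ind_def)
    ultimately have nf: "\<not> tfork C ?\<Gamma> ?Z" unfolding thorn_indep_iff[OF aU] by blast
    let ?bad = "\<lambda>(vs, X). {t \<in> tuples M ?\<Gamma>. map ((!) (t @ c)) (ps vs) \<notin> X}"
    have bad: "tfork C ?\<Gamma> (?bad i)" if i: "i \<in> F2" for i
    proof -
      obtain vs X' where iv: "i = (vs, X')" by force
      have vF: "(vs, X') \<in> F" using i by (simp add: iv F2_def)
      obtain X where X: "X' = tuples M (map srt vs) - X" "set vs \<subseteq> A" "tfork C (map srt vs) X"
        using i by (auto simp: iv F2_def \<Sigma>2_def)
      have "set vs \<subseteq> set a" using X(2) vF a(1) by (auto simp: W_def)
      then obtain qs where qs: "\<And>j. j \<in> set qs \<Longrightarrow> j < length a" "map ((!) a) qs = vs"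
        by (rule sublist_positions) blast
      have qs': "map ((!) ?\<Gamma>) qs = map srt vs" using map_nth_map[of qs a srt, OF qs(1)] qs(2) by simp
      have same: "map ((!) (t @ c)) (ps vs) = map ((!) t) qs" if t: "t \<in> tuples M ?\<Gamma>" for t
      proof -
        have lt: "length t = length a" using tuples_length[OF t] by simp
        obtain h where ha: "\<And>j. j < length a \<Longrightarrow> h (a ! j) = t ! j"
          and hac: "\<And>j. j < length (a @ c) \<Longrightarrow> h ((a @ c) ! j) = (t @ c) ! j"
          by (rule replace_entries[OF a(2) lt ac]) blast
        have "map h (map ((!) (a @ c)) (ps vs)) = map ((!) (t @ c)) (ps vs)"
          by (rule map_nth_transport[OF ps(1)[OF vF] _ hac]) (simp_all add: lt)
        moreover have "map h (map ((!) a) qs) = map ((!) t) qs"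
          by (rule map_nth_transport[OF qs(1) lt ha])
        ultimately show ?thesis unfolding ps(2)[OF vF] qs(2) by (simp only:)
      qed
      have "{t \<in> tuples M ?\<Gamma>. map ((!) (t @ c)) (ps vs) \<notin> X'} \<subseteq> {t \<in> tuples M ?\<Gamma>. map ((!) t) qs \<in> X}"
      proof
        fix t assume "t \<in> {t \<in> tuples M ?\<Gamma>. map ((!) (t @ c)) (ps vs) \<notin> X'}"
        then have t: "t \<in> tuples M ?\<Gamma>" "map ((!) t) qs \<notin> X'" using same by auto
        have "map ((!) t) qs \<in> tuples M (map srt vs)"
        proof -
          have lt: "length t = length a" using tuples_length[OF t(1)] by simp
          have "map srt (map ((!) t) qs) = map ((!) (map srt t)) qs"
            by (rule map_nth_map[symmetric]) (use qs(1) lt in simp)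
          moreover have "map srt t = ?\<Gamma>" using t(1) by (simp add: tuples_def)
          moreover have "set (map ((!) t) qs) \<subseteq> U"
          proof -
            have "t ! j \<in> U" if "j \<in> set qs" for j using qs(1)[OF that] lt t(1) by (auto simp: tuples_def)
            then show ?thesis by auto
          qed
          ultimately show ?thesis using qs' by (simp only: tuples_def mem_Collect_eq simp_thms)
        qed
        then show "t \<in> {t \<in> tuples M ?\<Gamma>. map ((!) t) qs \<in> X}" using t X(1) by auto
      qed
      moreover have "tfork C ?\<Gamma> {t \<in> tuples M ?\<Gamma>. map ((!) t) qs \<in> X}"
        by (rule tfork_reindex[OF X(3)]) (use qs qs' in auto)
      ultimately show ?thesis unfolding iv prod.case
        using tfork_Union[of "{{t \<in> tuples M ?\<Gamma>. map ((!) t) qs \<in> X}}" C ?\<Gamma>] by simp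
    qed
    \<comment> \<open>The set \<open>?Z\<close> of the copies satisfying the constraints in \<open>F1\<close> contains \<open>a\<close> and so does not
      fork; each constraint in \<open>F2\<close> excludes a forking set.\<close>
    have "\<not> ?Z \<subseteq> \<Union>(?bad ` F2)"
    proof
      assume "?Z \<subseteq> \<Union>(?bad ` F2)"
      moreover have "finite (?bad ` F2)" using fin(2) by simp
      moreover have "tfork C ?\<Gamma> Y" if "Y \<in> ?bad ` F2" for Y using that bad by blast
      ultimately show False using nf tfork_Union[of "?bad ` F2" C ?\<Gamma> ?Z] by blast
    qed
    then obtain t where t: "t \<in> ?Z" "t \<notin> \<Union>(?bad ` F2)" by blast
    have tt: "t \<in> tuples M ?\<Gamma>" using t(1) by blast
    have lt: "length t = length a" using tuples_length[OF tt] by simp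
    obtain h where ha: "\<And>j. j < length a \<Longrightarrow> h (a ! j) = t ! j"
      and hac: "\<And>j. j < length (a @ c) \<Longrightarrow> h ((a @ c) ! j) = (t @ c) ! j"
      and hout: "\<And>x. x \<notin> set a \<Longrightarrow> h x = x"
      by (rule replace_entries[OF a(2) lt ac]) blast
    have hmap: "map h vs = map ((!) (t @ c)) (ps vs)" if "(vs, X) \<in> F" for vs X
    proof -
      have "map h (map ((!) (a @ c)) (ps vs)) = map ((!) (t @ c)) (ps vs)"
        by (rule map_nth_transport[OF ps(1)[OF that] _ hac]) (simp_all add: lt)
      then show ?thesis unfolding ps(2)[OF that] .
    qed
    show "\<exists>h. (\<forall>v\<in>?V. h v \<in> U \<and> srt (h v) = srt v) \<and> (\<forall>(vs, X)\<in>F. map h vs \<in> X)"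
    proof (intro exI[of _ h] conjI ballI)
      fix v assume v: "v \<in> ?V"
      show "h v \<in> U" "srt (h v) = srt v"
      proof -
        have "h v \<in> U \<and> srt (h v) = srt v"
        proof (cases "v \<in> set a")
          case True
          then obtain j where j: "j < length a" "a ! j = v" by (auto simp: in_set_conv_nth)
          have "map srt t ! j = map srt a ! j" using tt by (simp add: tuples_def)
          then have "srt (t ! j) = srt v" using j lt by simp
          moreover have "t ! j \<in> U" using tt j(1) lt by (auto simp: tuples_def)
          ultimately show ?thesis using ha[OF j(1)] j(2) by simp
        next
          case False
          then show ?thesis using v VU hout by auto
        qed
        then show "h v \<in> U" "srt (h v) = srt v" by auto
      qed
    next
      fix i assume i: "i \<in> F"
      obtain vs X where iv: "i = (vs, X)" by force
      have vF: "(vs, X) \<in> F" using i iv by simp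
      have "map ((!) (t @ c)) (ps vs) \<in> X"
      proof (cases "i \<in> \<Sigma>1")
        case True
        then have "t \<in> ?f i" using t(1) i by (simp add: F1_def)
        then show ?thesis by (simp add: iv)
      next
        case False
        then have "i \<in> F2" using i F(1) by (auto simp: F2_def)
        then have "t \<notin> ?bad i" using t(2) by blast
        then show ?thesis using tt by (simp add: iv)
      qed
      then show "case i of (vs, X) \<Rightarrow> map h vs \<in> X" unfolding iv prod.case hmap[OF vF] .
    qed
  qed
  then obtain h where h: "\<And>v. v \<in> ?V \<Longrightarrow> h v \<in> U \<and> srt (h v) = srt v"
    and h1: "\<And>vs X. (vs, X) \<in> \<Sigma>1 \<Longrightarrow> map h vs \<in> X" and h2: "\<And>vs X. (vs, X) \<in> \<Sigma>2 \<Longrightarrow> map h vs \<in> X"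
    by blast
  have copy: "map h l \<in> X" if "set l \<subseteq> ?V" "dfn M {} (map srt l) X" "l \<in> X" for l X
    using that dfn_mono[OF that(2), of "C \<union> B"] by (intro h1) (auto simp: \<Sigma>1_def)
  have "\<exists>g. automorphism M g \<and> (\<forall>x\<in>?V. g x = h x)"
    by (rule copy_extends[OF V h copy]) auto
  then obtain g where g: "automorphism M g" "\<And>x. x \<in> ?V \<Longrightarrow> g x = h x" by blast
  have hfix: "h x = x" if "x \<in> C \<union> B" for x
  proof -
    have "dfn M (C \<union> B) (map srt [x]) {[x]}" using that CBU by (intro dfn_singleton) auto
    then have "map h [x] \<in> {[x]}" using that by (intro h1) (auto simp: \<Sigma>1_def)
    then show ?thesis by simp
  qed
  have "aut (C \<union> B) g" using g hfix by (auto simp: aut_def)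
  moreover have "ind (g ` A) C B'"
    unfolding ind_def
  proof (intro allI impI)
    fix l' assume l': "set l' \<subseteq> g ` A"
    obtain l where l: "set l \<subseteq> A" "l' = map g l" by (rule list_of_image[OF l'])
    have lU: "set l \<subseteq> U" using l(1) AU by blast
    have l'h: "l' = map h l" unfolding l(2) using g(2) l(1) by auto
    have l'U: "set l' \<subseteq> U" unfolding l(2) by (rule automorphism_set[OF g(1) lU])
    have s: "map srt l' = map srt l" unfolding l(2) by (rule map_sort_automorphism[OF g(1) lU])
    show "thorn_indep \<kappa> M l' C B'"
      unfolding thorn_indep_iff[OF l'U] s
    proof (intro allI impI notI)
      fix X assume X: "dfn M (C \<union> B') (map srt l) X" "l' \<in> X" "tfork C (map srt l) X"
      then have "(l, tuples M (map srt l) - X) \<in> \<Sigma>2" using l(1) by (auto simp: \<Sigma>2_def)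
      from h2[OF this] show False using X(2) l'h by simp
    qed
  qed
  ultimately show ?thesis by (rule that)
qed

end

lemma map_nth_prefix:
  assumes "length z = n" "\<And>i. i \<in> set ps \<Longrightarrow> i < length xs"
  shows "map ((!) (z @ xs)) ([0..<n] @ map ((+) n) ps) = z @ map ((!) xs) ps"
proof -
  have "map ((!) (z @ xs)) [0..<n] = z" using assms(1) by (intro nth_equalityI) (auto simp: nth_append)
  moreover have "map ((!) (z @ xs)) (map ((+) n) ps) = map ((!) xs) ps"
    using assms(1) by (auto simp: nth_append)
  ultimately show ?thesis by (simp only: map_append)
qed

lemma map_nth_swap:
  assumes "length y = m" "length z = n"
  shows "map ((!) (y @ z)) ([m..<m + n] @ [0..<m]) = z @ y"
proof -
  have "map ((!) (y @ z)) [0..<m] = y" using assms by (intro nth_equalityI) (auto simp: nth_append)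
  moreover have "map ((!) (y @ z)) [m..<m + n] = z" using assms by (intro nth_equalityI) (auto simp: nth_append)
  ultimately show ?thesis by (simp only: map_append)
qed

context monster
begin

lemma sorts_of_tuple: "set a \<subseteq> U \<Longrightarrow> set (map srt a) \<subseteq> sorts M"
  using sort_in by auto

lemma dfn_split:
  assumes "dfn M (A \<union> set b) \<Gamma> X" "A \<subseteq> U" "set b \<subseteq> U"
  obtains Y where "dfn M A (\<Gamma> @ map srt b) Y" "X = {z \<in> tuples M \<Gamma>. z @ b \<in> Y}"
proof -
  obtain p Y0 where p: "set p \<subseteq> A \<union> set b" and Y0: "dfn M {} (\<Gamma> @ map srt p) Y0"
    and X: "X = {z \<in> tuples M \<Gamma>. z @ p \<in> Y0}"
    by (rule dfn_fibreE[OF assms(1)]) (use assms in auto)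
  define d where "d = filter (\<lambda>x. x \<notin> set b) p"
  have d: "set d \<subseteq> A" "set p \<subseteq> set (b @ d)" using p by (auto simp: d_def)
  obtain ps where ps: "\<And>i. i \<in> set ps \<Longrightarrow> i < length (b @ d)" "map ((!) (b @ d)) ps = p"
    by (rule sublist_positions[OF d(2)]) blast
  let ?n = "length \<Gamma>" let ?ws = "[0..<?n] @ map ((+) ?n) ps"
  let ?Y = "{t \<in> tuples M (\<Gamma> @ map srt b). map ((!) (t @ d)) ?ws \<in> Y0}"
  show ?thesis
  proof (rule that)
    show "dfn M A (\<Gamma> @ map srt b) ?Y"
    proof (rule dfn_subst[OF Y0 _ d(1) assms(2)])
      show "i < length (\<Gamma> @ map srt b) + length d" if "i \<in> set ?ws" for i
        using that ps(1) by fastforce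
      have "map ((!) (\<Gamma> @ map srt (b @ d))) ?ws = \<Gamma> @ map ((!) (map srt (b @ d))) ps"
        by (rule map_nth_prefix) (use ps(1) in auto)
      also have "map ((!) (map srt (b @ d))) ps = map srt p"
        using map_nth_map[of ps "b @ d" srt, OF ps(1)] unfolding ps(2) .
      finally show "map ((!) ((\<Gamma> @ map srt b) @ map srt d)) ?ws = \<Gamma> @ map srt p"
        by (simp only: map_append append_assoc)
    qed simp
    show "X = {z \<in> tuples M \<Gamma>. z @ b \<in> ?Y}"
      unfolding X
    proof (rule Collect_cong, rule conj_cong[OF refl])
      fix z assume z: "z \<in> tuples M \<Gamma>"
      have "map ((!) (z @ (b @ d))) ?ws = z @ map ((!) (b @ d)) ps"
        by (rule map_nth_prefix) (use ps(1) tuples_length[OF z] in auto)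
      then have "map ((!) ((z @ b) @ d)) ?ws = z @ p" unfolding ps(2) append_assoc .
      then show "z @ p \<in> Y0 \<longleftrightarrow> z @ b \<in> ?Y"
        using z in_tuples_self[OF assms(3)]
        by (simp only: mem_Collect_eq in_tuples_append[OF tuples_length[OF z]] simp_thms)
    qed
  qed
qed

section \<open>Algebraic dependence is thorn-forking\<close>

text \<open>Let \<open>\<chi>(z, b)\<close> be a formula over \<open>D\<close> with fewer than \<open>k\<close> solutions, one of which is \<open>e\<close>. The formula
  expressing \<open>\<chi>(e, y)\<close> and that \<open>\<chi>(z, y)\<close> has fewer than \<open>k\<close> solutions holds of \<open>y = b\<close>, and it
  cannot hold of the same \<open>y\<close> for \<open>k\<close> different conjugates of \<open>e\<close>. So it strongly divides over
  \<open>D\<close>.\<close>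

lemma algebraic_dependence:
  assumes D: "sml D" "C \<subseteq> D" and e: "set e \<subseteq> U" and b: "set b \<subseteq> U"
    and na: "\<not> algebraic M D e" and alg: "algebraic M (D \<union> set b) e"
  shows "\<not> thorn_indep \<kappa> M b C (D \<union> set e)"
proof -
  have DU: "D \<subseteq> U" using D(1) by (rule smallD)
  obtain X where X: "dfn M (D \<union> set b) (map srt e) X" "e \<in> X" "finite X"
    using alg algebraic_iff[OF e] by blast
  obtain Y1 where Y1: "dfn M D (map srt e @ map srt b) Y1" "X = {z \<in> tuples M (map srt e). z @ b \<in> Y1}"
    by (rule dfn_split[OF X(1) DU b])
  let ?\<Gamma> = "map srt b" and ?\<Delta> = "map srt e" let ?m = "length b" and ?n = "length e"
  have et: "e \<in> tuples M ?\<Delta>" and bt: "b \<in> tuples M ?\<Gamma>" using e b by (simp_all add: in_tuples_self)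
  define k where "k = Suc (card X)"
  let ?G = "{y \<in> tuples M ?\<Gamma>. \<exists>S \<subseteq> tuples M ?\<Delta>. finite S \<and> card S = k \<and> (\<forall>z\<in>S. z @ y \<in> Y1)}"
  have G: "dfn M D ?\<Gamma> ?G" by (rule dfn_at_least[OF Y1(1) sorts_of_tuple[OF e] DU])
  let ?sw = "[?m..<?m + ?n] @ [0..<?m]"
  let ?Y1' = "{t \<in> tuples M (?\<Gamma> @ ?\<Delta>). map ((!) t) ?sw \<in> Y1}"
  let ?G' = "{t \<in> tuples M (?\<Gamma> @ ?\<Delta>). map ((!) t) [0..<?m] \<in> ?G}"
  have "dfn M D (?\<Gamma> @ ?\<Delta>) ?Y1'"
    using map_nth_swap[of ?\<Gamma> ?m ?\<Delta> ?n] by (intro dfn_reindex[OF Y1(1) DU]) auto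
  moreover have "dfn M D (?\<Gamma> @ ?\<Delta>) ?G'"
  proof (rule dfn_reindex[OF G DU])
    show "map ((!) (?\<Gamma> @ ?\<Delta>)) [0..<?m] = ?\<Gamma>" by (intro nth_equalityI) (auto simp: nth_append)
  qed auto
  ultimately have Y2: "dfn M D (?\<Gamma> @ ?\<Delta>) (?Y1' - ?G')" by (rule dfn_diff)
  have inY2: "y @ z \<in> ?Y1' - ?G' \<longleftrightarrow> z @ y \<in> Y1 \<and> y \<notin> ?G" if y: "y \<in> tuples M ?\<Gamma>" and z: "z \<in> tuples M ?\<Delta>" for y z
  proof -
    have l: "length y = ?m" "length z = ?n" using tuples_length[OF y] tuples_length[OF z] by simp_all
    have "map ((!) (y @ z)) ?sw = z @ y" by (rule map_nth_swap[OF l])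
    moreover have "map ((!) (y @ z)) [0..<?m] = y" using l by (intro nth_equalityI) (auto simp: nth_append)
    ultimately show ?thesis
      using y z by (simp only: Diff_iff mem_Collect_eq in_tuples_append[OF tuples_length[OF y]] simp_thms)
  qed
  let ?Z = "{y \<in> tuples M ?\<Gamma>. y @ e \<in> ?Y1' - ?G'}"
  have "b \<notin> ?G"
  proof
    assume "b \<in> ?G"
    then obtain S where S: "S \<subseteq> tuples M ?\<Delta>" "finite S" "card S = k" "\<forall>z\<in>S. z @ b \<in> Y1" by blast
    then have "S \<subseteq> X" using Y1(2) by blast
    then have "card S \<le> card X" using X(3) by (intro card_mono)
    then show False using S(3) by (simp add: k_def)
  qed
  moreover have "e @ b \<in> Y1" using X(2) Y1(2) by blast
  ultimately have bZ: "b \<in> ?Z" using inY2[OF bt et] bt by blast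
  have "sdiv D ?\<Gamma> ?Z"
    unfolding sdiv_def sdiv_by_def
  proof (intro exI conjI)
    show "set e \<subseteq> U" "dfn M D (?\<Gamma> @ ?\<Delta>) (?Y1' - ?G')" "?Z = ?Z" "\<not> algebraic M D e" by (fact e Y2 refl na)+
    show "\<forall>S \<subseteq> {e'. conjugate D e e'}. finite S \<and> card S = k \<longrightarrow>
        \<not> (\<exists>y \<in> tuples M ?\<Gamma>. \<forall>z\<in>S. y @ z \<in> ?Y1' - ?G')"
    proof (intro allI impI notI)
      fix S assume S: "S \<subseteq> {e'. conjugate D e e'}" "finite S \<and> card S = k"
        and "\<exists>y \<in> tuples M ?\<Gamma>. \<forall>z\<in>S. y @ z \<in> ?Y1' - ?G'"
      then obtain y where y: "y \<in> tuples M ?\<Gamma>" "\<forall>z\<in>S. y @ z \<in> ?Y1' - ?G'" by blast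
      have "S \<subseteq> tuples M ?\<Delta>" using S(1) conjugate_iff[OF D(1) e] by blast
      then have *: "\<forall>z\<in>S. z @ y \<in> Y1 \<and> y \<notin> ?G" using inY2[OF y(1)] y(2) by blast
      have "S \<noteq> {}" using S(2) by (auto simp: k_def)
      then have "y \<notin> ?G" using * by blast
      moreover have "y \<in> ?G" using y(1) \<open>S \<subseteq> tuples M ?\<Delta>\<close> S(2) * by blast
      ultimately show False by blast
    qed
  qed
  then have "tfork C ?\<Gamma> ?Z" using D by (intro tfork_tdiv) (auto simp: tdiv_def)
  moreover have "dfn M (C \<union> (D \<union> set e)) ?\<Gamma> ?Z"
    by (rule dfn_fibre[OF Y2 _ _ _ refl]) (use D DU e in auto)
  ultimately show ?thesis using bZ unfolding thorn_indep_iff[OF b] by blast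
qed

lemma algebraic_finite_support:
  assumes "algebraic M (D \<union> A) e" "set e \<subseteq> U" "D \<subseteq> U" "A \<subseteq> U"
  obtains b where "set b \<subseteq> A" "algebraic M (D \<union> set b) e"
proof -
  obtain X where X: "dfn M (D \<union> A) (map srt e) X" "e \<in> X" "finite X"
    using assms(1) algebraic_iff[OF assms(2)] by blast
  from X(1) obtain \<phi> p where p: "set p \<subseteq> D \<union> A" "wf_fm M (map srt e @ map srt p) \<phi>"
    "X = {a \<in> tuples M (map srt e). sat M (a @ p) \<phi>}" by (rule dfnE)
  let ?b = "filter (\<lambda>x. x \<notin> D) p"
  have "dfn M (D \<union> set ?b) (map srt e) X" using p by (intro dfnI[of p]) auto
  then have "algebraic M (D \<union> set ?b) e" using X algebraic_iff[OF assms(2)] by blast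
  moreover have "set ?b \<subseteq> A" using p(1) by auto
  ultimately show ?thesis using that by blast
qed

section \<open>Transitivity on the left\<close>

text \<open>Suppose that a tuple \<open>ab\<close> with \<open>a\<close> from \<open>A2\<close> and \<open>b\<close> from \<open>A1\<close> forks with \<open>X\<close> over \<open>C\<close>. By extension
  \<open>X\<close> may be enlarged by the sets \<open>D\<close> and tuples \<open>e\<close> that witness the forking, so that \<open>ab\<close> satisfies
  a formula that strongly divides over \<open>D\<close> with parameter \<open>e\<close>. If \<open>e\<close> is algebraic over \<open>D A1\<close>, then
  \<open>A1\<close> forks with \<open>De\<close> over \<open>C\<close>. Otherwise the formula still strongly divides over \<open>D A1\<close>, so that
  \<open>a\<close> forks with \<open>De\<close> over \<open>C A1\<close>.\<close>

theorem left_transitivity: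
  assumes ind1: "ind A1 C X" and ind2: "ind A2 (C \<union> A1) X"
    and sml: "sml A1" "sml A2" "sml C" "sml X"
  shows "ind (A1 \<union> A2) C X"
  unfolding ind_def
proof (intro allI impI)
  fix l0 assume l0: "set l0 \<subseteq> A1 \<union> A2"
  have U: "A1 \<subseteq> U" "A2 \<subseteq> U" "C \<subseteq> U" "X \<subseteq> U" using sml smallD by blast+
  define b where "b = filter (\<lambda>x. x \<in> A1) l0"
  define a where "a = filter (\<lambda>x. x \<notin> A1) l0"
  have ab: "set a \<subseteq> A2" "set b \<subseteq> A1" "set l0 \<subseteq> set (a @ b)" using l0 by (auto simp: a_def b_def)
  let ?l = "a @ b" let ?\<Gamma> = "map srt a"
  have lU: "set ?l \<subseteq> U" using ab U by auto
  have bU: "set b \<subseteq> U" and aU: "set a \<subseteq> U" using lU by auto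
  have "thorn_indep \<kappa> M ?l C X"
    unfolding thorn_indep_iff[OF lU]
  proof (intro allI impI notI)
    fix Z assume Z: "dfn M (C \<union> X) (map srt ?l) Z" "?l \<in> Z" "tfork C (map srt ?l) Z"
    from Z(3) obtain \<Y> where \<Y>: "finite \<Y>" "\<forall>Y\<in>\<Y>. tdiv C (map srt ?l) Y" "Z \<subseteq> \<Union>\<Y>"
      unfolding tfork_def by blast
    have "\<exists>De. \<forall>Y\<in>\<Y>. sml (fst (De Y)) \<and> C \<subseteq> fst (De Y) \<and> sdiv_by (fst (De Y)) (map srt ?l) Y (snd (De Y))"
      using \<Y>(2) unfolding tdiv_def sdiv_def by (intro bchoice) auto
    then obtain De where De: "\<And>Y. Y \<in> \<Y> \<Longrightarrow>
        sml (fst (De Y)) \<and> C \<subseteq> fst (De Y) \<and> sdiv_by (fst (De Y)) (map srt ?l) Y (snd (De Y))"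
      by blast
    define X' where "X' = X \<union> (\<Union>Y\<in>\<Y>. fst (De Y) \<union> set (snd (De Y)))"
    have X': "sml X'" "X \<subseteq> X'"
      unfolding X'_def using De sdiv_byD(1) \<Y>(1) sml(4)
      by (fastforce intro!: small_Un small_UN_finite small_set)+
    have X'U: "X' \<subseteq> U" using X'(1) by (rule smallD)
    obtain g1 where g1: "aut (C \<union> X) g1" "ind (g1 ` A1) C X'"
      by (rule extension[OF ind1 sml(1,3,4) X'])
    have a1: "automorphism M g1" using g1(1) by (rule aut_automorphism)
    have gA1: "sml (g1 ` A1)" "g1 ` A1 \<subseteq> U" using small_image[OF a1 sml(1)] smallD by blast+
    have gA2: "sml (g1 ` A2)" using small_image[OF a1 sml(2)] .
    have CA1: "sml (C \<union> g1 ` A1)" using small_Un[OF sml(3) gA1(1)] .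
    have "ind (g1 ` A2) (g1 ` (C \<union> A1)) (g1 ` X)" using ind2 a1 by (rule ind_image) (use U in auto)
    moreover have "g1 ` (C \<union> A1) = C \<union> g1 ` A1" using aut_image[OF g1(1), of C] by (simp add: image_Un)
    moreover have "g1 ` X = X" by (rule aut_image[OF g1(1)]) simp
    ultimately have "ind (g1 ` A2) (C \<union> g1 ` A1) X" by simp
    then obtain g2 where g2: "aut ((C \<union> g1 ` A1) \<union> X) g2" "ind (g2 ` g1 ` A2) (C \<union> g1 ` A1) X'"
      using gA2 CA1 sml(4) X' by (rule extension)
    have a2: "automorphism M g2" using g2(1) by (rule aut_automorphism)
    have g2A1: "g2 x = x" if "x \<in> g1 ` A1" for x by (rule aut_fix[OF g2(1)]) (use that in blast)
    have g21: "aut (C \<union> X) (g2 \<circ> g1)" by (rule aut_comp[OF g1(1) aut_mono[OF g2(1)]]) auto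
    let ?a = "map (g2 \<circ> g1) a" and ?b = "map g1 b"
    have b': "map (g2 \<circ> g1) b = ?b" using g2A1 ab(2) by auto
    have bs: "set ?b \<subseteq> g1 ` A1" "set ?b \<subseteq> U" using ab(2) gA1(2) by auto
    have as: "set ?a \<subseteq> g2 ` g1 ` A2" using ab(1) by auto
    have a'U: "set ?a \<subseteq> U" using automorphism_set[OF aut_automorphism[OF g21] aU] .
    have sa: "map srt ?a = map srt a" by (rule map_sort_automorphism[OF aut_automorphism[OF g21] aU])
    have sb: "map srt ?b = map srt b" by (rule map_sort_automorphism[OF a1 bU])
    have "map (g2 \<circ> g1) ?l \<in> Z"
      using dfn_automorphism[OF Z(1) aut_automorphism[OF g21] aut_fix[OF g21] _ in_tuples_self[OF lU]] Z(2) U by blast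
    then have "?a @ ?b \<in> Z" unfolding map_append b' .
    then obtain Y where Y: "Y \<in> \<Y>" "?a @ ?b \<in> Y" using \<Y>(3) by blast
    define D where "D = fst (De Y)"
    define e where "e = snd (De Y)"
    have D: "sml D" "C \<subseteq> D" and sd: "sdiv_by D (map srt ?l) Y e" using De[OF Y(1)] by (auto simp: D_def e_def)
    have DU: "D \<subseteq> U" using D(1) by (rule smallD)
    note e = sdiv_byD(1,2)[OF sd] and Ydfn = sdiv_byD(3)[OF sd DU]
    have DX: "D \<union> set e \<subseteq> X'" using Y(1) unfolding X'_def D_def e_def by blast
    show False
    proof (cases "algebraic M (D \<union> g1 ` A1) e")
      case True
      obtain b1 where b1: "set b1 \<subseteq> g1 ` A1" "algebraic M (D \<union> set b1) e"
        by (rule algebraic_finite_support[OF True e(1) DU gA1(2)])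
      have b1U: "set b1 \<subseteq> U" using b1(1) gA1(2) by blast
      have "\<not> thorn_indep \<kappa> M b1 C (D \<union> set e)"
        by (rule algebraic_dependence[OF D e(1) b1U e(2) b1(2)])
      moreover have "thorn_indep \<kappa> M b1 C X'" using g1(2) b1(1) by (rule indD)
      then have "thorn_indep \<kappa> M b1 C (D \<union> set e)"
        by (rule thorn_indep_mono[OF _ b1U order_refl]) (use DX in auto)
      ultimately show False by blast
    next
      case False
      let ?D = "D \<union> g1 ` A1"
      have D'U: "?D \<subseteq> U" using DU gA1(2) by blast
      let ?Y = "{t \<in> tuples M (map srt a). t @ ?b \<in> Y}"
      have "sdiv ?D (map srt a @ map srt ?b) Y" 
        unfolding sb sdiv_def using sdiv_by_mono[OF sd _ False] by auto
      then have "sdiv ?D (map srt a) ?Y" by (rule sdiv_fibre[OF _ D'U]) (use bs in auto)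
      moreover have "sml ?D" using small_Un[OF D(1) gA1(1)] .
      ultimately have "tfork (C \<union> g1 ` A1) (map srt ?a) ?Y"
        unfolding sa using D(2) by (intro tfork_tdiv) (auto simp: tdiv_def)
      moreover have "dfn M ((C \<union> g1 ` A1) \<union> X') (map srt ?a) ?Y"
        unfolding sa
      proof (rule dfn_fibre[OF _ _ _ _ refl])
        show "dfn M (D \<union> set e) (map srt a @ map srt ?b) Y" unfolding sb using Ydfn by simp
      qed (use DX bs X'U U gA1 in auto)
      moreover have "?a \<in> ?Y" using Y(2) in_tuples_self[OF a'U] unfolding sa by blast
      moreover have "thorn_indep \<kappa> M ?a (C \<union> g1 ` A1) X'" using g2(2) as by (rule indD)
      ultimately show False unfolding thorn_indep_iff[OF a'U] by blast
    qed
  qed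
  then show "thorn_indep \<kappa> M l0 C X" by (rule thorn_indep_subtuple[OF _ ab(3) lU]) (use U in auto)
qed

end

context monster
begin

lemma ind_left_empty:
  assumes "ind A C B"
  shows "ind {} C B"
  using assms by (auto simp: ind_def)

section \<open>Algebraicity by formulas with few solutions\<close>

text \<open>The tuples \<open>d @ a\<close> in \<open>Z\<close> for which fewer than \<open>n\<close> tuples \<open>z\<close> satisfy \<open>z @ a \<in> Z\<close>. They allow
  non-algebraicity to be expressed by constraints on finitely many elements at a time.\<close>

definition few :: "'s list \<Rightarrow> 's list \<Rightarrow> 'a list set \<Rightarrow> nat \<Rightarrow> 'a list set" where
  "few \<Delta> \<Gamma> Z n = {t \<in> Z. \<not> (\<exists>S \<subseteq> tuples M \<Delta>. finite S \<and> card S = n \<and> (\<forall>d\<in>S. d @ drop (length \<Delta>) t \<in> Z))}"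

lemma dfn_few:
  assumes "dfn M {} (\<Delta> @ \<Gamma>) Z" "set \<Delta> \<subseteq> sorts M"
  shows "dfn M {} (\<Delta> @ \<Gamma>) (few \<Delta> \<Gamma> Z n)"
proof -
  let ?G = "{a \<in> tuples M \<Gamma>. \<exists>S \<subseteq> tuples M \<Delta>. finite S \<and> card S = n \<and> (\<forall>d\<in>S. d @ a \<in> Z)}"
  let ?vs = "[length \<Delta>..<length \<Delta> + length \<Gamma>]"
  let ?G' = "{t \<in> tuples M (\<Delta> @ \<Gamma>). map ((!) t) ?vs \<in> ?G}"
  have G: "dfn M {} \<Gamma> ?G" using dfn_at_least[OF assms] by simp
  have "map ((!) (\<Delta> @ \<Gamma>)) ?vs = \<Gamma>" by (intro nth_equalityI) auto
  then have "dfn M {} (\<Delta> @ \<Gamma>) ?G'" by (intro dfn_reindex[OF G]) auto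
  with assms(1) have "dfn M {} (\<Delta> @ \<Gamma>) (Z - ?G')" by (rule dfn_diff)
  moreover have "Z - ?G' = few \<Delta> \<Gamma> Z n"
  proof -
    have "t \<in> ?G' \<longleftrightarrow> (\<exists>S \<subseteq> tuples M \<Delta>. finite S \<and> card S = n \<and> (\<forall>d\<in>S. d @ drop (length \<Delta>) t \<in> Z))"
      if "t \<in> Z" for t
    proof -
      have t: "t \<in> tuples M (\<Delta> @ \<Gamma>)" using that dfn_subset_tuples[OF assms(1)] by blast
      then obtain d a where "t = d @ a" "d \<in> tuples M \<Delta>" "a \<in> tuples M \<Gamma>" by (rule tuples_appendE)
      then have "drop (length \<Delta>) t \<in> tuples M \<Gamma>" by (simp add: tuples_length)
      moreover have "map ((!) t) ?vs = drop (length \<Delta>) t"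
        using tuples_length[OF t] by (intro nth_equalityI) auto
      ultimately show ?thesis using t by (simp only: mem_Collect_eq simp_thms)
    qed
    then show ?thesis unfolding few_def by blast
  qed
  ultimately show ?thesis by simp
qed

lemma algebraic_iff_few:
  assumes e: "set e \<subseteq> U" and P: "P \<subseteq> U"
  shows "algebraic M P e \<longleftrightarrow>
    (\<exists>w Z n. set w \<subseteq> P \<and> dfn M {} (map srt e @ map srt w) Z \<and> e @ w \<in> few (map srt e) (map srt w) Z n)"
proof
  assume "algebraic M P e"
  then obtain X where X: "dfn M P (map srt e) X" "e \<in> X" "finite X"
    using algebraic_iff[OF e] by blast
  obtain w Z where w: "set w \<subseteq> P" "dfn M {} (map srt e @ map srt w) Z"
    "X = {z \<in> tuples M (map srt e). z @ w \<in> Z}"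
    by (rule dfn_fibreE[OF X(1) P])
  have "\<not> (\<exists>S \<subseteq> tuples M (map srt e). finite S \<and> card S = Suc (card X) \<and> (\<forall>d\<in>S. d @ w \<in> Z))"
  proof
    assume "\<exists>S \<subseteq> tuples M (map srt e). finite S \<and> card S = Suc (card X) \<and> (\<forall>d\<in>S. d @ w \<in> Z)"
    then obtain S where S: "S \<subseteq> tuples M (map srt e)" "card S = Suc (card X)" "\<forall>d\<in>S. d @ w \<in> Z" by blast
    then have "S \<subseteq> X" using w(3) by blast
    then have "card S \<le> card X" using X(3) by (rule card_mono[rotated])
    then show False using S(2) by simp
  qed
  moreover have "e @ w \<in> Z" using X(2) w(3) by blast
  ultimately have "e @ w \<in> few (map srt e) (map srt w) Z (Suc (card X))" by (simp add: few_def)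
  then show "\<exists>w Z n. set w \<subseteq> P \<and> dfn M {} (map srt e @ map srt w) Z \<and> e @ w \<in> few (map srt e) (map srt w) Z n"
    using w(1,2) by blast
next
  assume "\<exists>w Z n. set w \<subseteq> P \<and> dfn M {} (map srt e @ map srt w) Z \<and> e @ w \<in> few (map srt e) (map srt w) Z n"
  then obtain w Z n where w: "set w \<subseteq> P" "dfn M {} (map srt e @ map srt w) Z"
    "e @ w \<in> few (map srt e) (map srt w) Z n" by blast
  let ?X = "{z \<in> tuples M (map srt e). z @ w \<in> Z}"
  have "dfn M P (map srt e) ?X" by (rule dfn_fibre[OF w(2) _ P w(1) refl]) simp
  moreover have "e \<in> ?X" using w(3) in_tuples_self[OF e] by (simp add: few_def)
  moreover have "finite ?X"
  proof (rule ccontr)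
    assume "infinite ?X"
    then obtain S where "S \<subseteq> ?X" "finite S" "card S = n" using infinite_arbitrarily_large by blast
    then show False using w(3) by (auto simp: few_def)
  qed
  ultimately show "algebraic M P e" using algebraic_iff[OF e] by blast
qed

lemma algebraic_Nil: "algebraic M D []"
proof -
  have "tuples M [] = {[]}" by (auto simp: tuples_def)
  moreover have "dfn M D [] (tuples M [])" by (rule dfn_tuples)
  ultimately show ?thesis using algebraic_iff[of "[]" D] by auto
qed

text \<open>The index set \<open>|T|\<^sup>+\<close>, as a well-order: it is regular, and still small.\<close>

abbreviation len :: "('s, 'f, 'r) fm set rel" where
  "len \<equiv> cardSuc |formulas M|"

definition before :: "('s, 'f, 'r) fm set \<Rightarrow> ('s, 'f, 'r) fm set \<Rightarrow> bool" where
  "before i j \<longleftrightarrow> (i, j) \<in> len \<and> i \<noteq> j"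

lemma Card_order_len: "Card_order len"
  by (rule cardSuc_Card_order[OF card_of_Card_order])

lemma Well_order_len: "Well_order len"
  using Card_order_len by (simp add: card_order_on_def)

lemma wo_rel_len: "wo_rel len"
  using Well_order_len by (simp add: wo_rel_def)

lemma infinite_len: "infinite (Field len)"
  using infinite_formulas by (simp add: card_of_cardSuc_finite)

lemma len_less_kappa: "|Field len| <o \<kappa>"
proof -
  have "|Field len| =o len" by (rule card_of_Field_ordIso[OF Card_order_len])
  also have "len \<le>o |Pow (formulas M)|"
    by (rule cardSuc_least[OF card_of_Card_order card_of_Card_order card_of_Pow])
  also note Pow_formulas_less
  finally show ?thesis .
qed

lemma before_Field: "before i j \<Longrightarrow> i \<in> Field len \<and> j \<in> Field len"
  by (auto simp: before_def Field_def)

lemma before_trans: "before i j \<Longrightarrow> before j k \<Longrightarrow> before i k"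
  using wo_rel.TRANS[OF wo_rel_len] wo_rel.ANTISYM[OF wo_rel_len]
  unfolding before_def trans_def antisym_def by blast

lemma before_irrefl: "\<not> before i i"
  by (simp add: before_def)

lemma before_total: "i \<in> Field len \<Longrightarrow> j \<in> Field len \<Longrightarrow> i = j \<or> before i j \<or> before j i"
  using wo_rel.TOTALS[OF wo_rel_len] by (auto simp: before_def)

lemma wf_before: "wf {(i, j). before i j}"
proof -
  have "{(i, j). before i j} = len - Id" by (auto simp: before_def)
  then show ?thesis using wo_rel.WF[OF wo_rel_len] by simp
qed

lemma before_minimal:
  assumes "J \<noteq> {}" "J \<subseteq> Field len"
  obtains m where "m \<in> J" "\<And>j. j \<in> J \<Longrightarrow> j \<noteq> m \<Longrightarrow> before m j"
proof -
  obtain m where m: "m \<in> J" "\<And>j. (j, m) \<in> {(i, j). before i j} \<Longrightarrow> j \<notin> J"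
    using wf_before assms(1) by (metis wfE_min ex_in_conv)
  then have "before m j" if "j \<in> J" "j \<noteq> m" for j using before_total[of m j] that assms(2) by blast
  then show ?thesis using that m(1) by blast
qed

end

section \<open>Consequences of rosiness\<close>

locale rosy_monster = monster \<kappa> T M
  for \<kappa> :: "'k rel" and T :: "('s, 'f, 'r) fm set" and M :: "('s, 'f, 'r, 'a) fo_structure" +
  assumes rosy: "rosy \<kappa> M"
begin

lemma local_character:
  assumes "set a \<subseteq> U" "sml B"
  obtains B0 where "B0 \<subseteq> B" "|B0| \<le>o |formulas M|" "thorn_indep \<kappa> M a B0 B"
proof -
  from rosy have "set a \<subseteq> U \<and> sml B \<longrightarrow>
      (\<exists>B0\<subseteq>B. |B0| \<le>o |formulas M| \<and> thorn_indep \<kappa> M a B0 B)"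
    unfolding rosy_def by (elim allE)
  then have "\<exists>B0\<subseteq>B. |B0| \<le>o |formulas M| \<and> thorn_indep \<kappa> M a B0 B" using assms by simp
  then show ?thesis using that by (elim exE conjE)
qed

text \<open>Since \<open>|T|\<^sup>+\<close> is regular, the set of size at most \<open>|T|\<close> given by local character is contained in
  an initial segment of the chain.\<close>

lemma chain_stabilizes:
  assumes b: "set b \<subseteq> U" and C: "sml C" and X: "sml (\<Union>j\<in>Field len. X j)"
  obtains i where "i \<in> Field len"
    "thorn_indep \<kappa> M b (C \<union> (\<Union>j\<in>{j. before j i}. X j)) (C \<union> (\<Union>j\<in>Field len. X j))"
proof -
  let ?B = "C \<union> (\<Union>j\<in>Field len. X j)"
  have "sml ?B" using C X by (rule small_Un)
  then obtain B0 where B0: "B0 \<subseteq> ?B" "|B0| \<le>o |formulas M|" "thorn_indep \<kappa> M b B0 ?B"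
    by (rule local_character[OF b])
  define As where "As i = C \<union> (\<Union>j\<in>{j. (j, i) \<in> len}. X j)" for i
  have chain: "relChain len As"
    unfolding relChain_def As_def using wo_rel.TRANS[OF wo_rel_len] unfolding trans_def by blast
  have sub: "B0 \<subseteq> (\<Union>i\<in>Field len. As i)"
  proof
    fix x assume "x \<in> B0"
    then consider "x \<in> C" | j where "j \<in> Field len" "x \<in> X j" using B0(1) by auto
    then show "x \<in> (\<Union>i\<in>Field len. As i)"
    proof cases
      case 1
      have "Field len \<noteq> {}" using infinite_len by (metis finite.emptyI)
      then show ?thesis using 1 by (auto simp: As_def)
    next
      case 2
      then have "(j, j) \<in> len" using wo_rel.REFL[OF wo_rel_len] by (simp add: refl_on_def)
      then show ?thesis using 2 by (auto simp: As_def)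
    qed
  qed
  have "infinite (Field |formulas M| )" using infinite_formulas by (simp add: Field_card_of)
  from cardSuc_UNION[OF card_of_Card_order this chain sub B0(2)]
  obtain i where i: "i \<in> Field len" "B0 \<subseteq> As i" ..
  obtain i' where i': "i' \<in> Field len" "i \<noteq> i'" "(i, i') \<in> len"
    using infinite_Card_order_limit[OF Card_order_len infinite_len i(1)] by (elim bexE conjE)
  have "before j i'" if "(j, i) \<in> len" for j
    using before_trans[of j i i'] i' that unfolding before_def by blast
  then have "As i \<subseteq> C \<union> (\<Union>j\<in>{j. before j i'}. X j)" by (auto simp: As_def)
  moreover have "(\<Union>j\<in>{j. before j i'}. X j) \<subseteq> (\<Union>j\<in>Field len. X j)" using before_Field by auto
  ultimately have "thorn_indep \<kappa> M b (C \<union> (\<Union>j\<in>{j. before j i'}. X j)) ?B"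
    using i(2) by (intro thorn_indep_mono[OF B0(3) b]) auto
  then show ?thesis using that i'(1) by blast
qed

lemma existence:
  assumes C: "sml C" and A: "A \<subseteq> U" and B: "B \<subseteq> C"
  shows "ind A C B"
  unfolding ind_def
proof (intro allI impI)
  fix a assume "set a \<subseteq> A"
  then have a: "set a \<subseteq> U" using A by blast
  obtain B0 where B0: "B0 \<subseteq> C" "thorn_indep \<kappa> M a B0 C"
    by (rule local_character[OF a C])
  show "thorn_indep \<kappa> M a C B" using B0(1) B by (intro thorn_indep_mono[OF B0(2) a]) auto
qed

section \<open>Symmetry\<close>

text \<open>The copies are chosen from the greatest index downwards, each one independent from \<open>b\<close> and the
  copies of greater index.\<close>

lemma reversed_independent_copies:
  assumes indep: "ind W C (set b)" and W: "sml W" and C: "sml C" and b: "set b \<subseteq> U"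
    and J: "finite J" "J \<subseteq> Field len"
  shows "\<exists>g. \<forall>i\<in>J. aut (C \<union> set b) (g i) \<and>
    ind (g i ` W) C (set b \<union> (\<Union>j\<in>{j\<in>J. before i j}. g j ` W))"
  using J
proof (induction "card J" arbitrary: J)
  case 0
  then show ?case by simp
next
  case (Suc n)
  then have "J \<noteq> {}" by auto
  then obtain m where m: "m \<in> J" "\<And>j. j \<in> J \<Longrightarrow> j \<noteq> m \<Longrightarrow> before m j"
    using Suc.prems(2) by (rule before_minimal) blast
  define K where "K = J - {m}"
  have "n = card K" using Suc.hyps(2) m(1) Suc.prems(1) by (simp add: K_def)
  from Suc.hyps(1)[OF this] Suc.prems
  obtain g where g: "\<forall>i\<in>K. aut (C \<union> set b) (g i) \<and> ind (g i ` W) C (set b \<union> (\<Union>j\<in>{j\<in>K. before i j}. g j ` W))"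
    by (auto simp: K_def)
  let ?B = "set b \<union> (\<Union>j\<in>K. g j ` W)"
  have "sml ?B"
  proof (intro small_Un[OF small_set[OF b]] small_UN_finite)
    show "finite K" using Suc.prems(1) by (simp add: K_def)
    show "sml (g j ` W)" if "j \<in> K" for j using small_image[OF aut_automorphism W] g that by blast
  qed
  then obtain f where f: "aut (C \<union> set b) f" "ind (f ` W) C ?B"
    using extension[OF indep W C small_set[OF b], of ?B] by blast
  let ?g = "g(m := f)"
  show ?case
  proof (intro exI[of _ ?g] ballI)
    fix i assume i: "i \<in> J"
    show "aut (C \<union> set b) (?g i) \<and> ind (?g i ` W) C (set b \<union> (\<Union>j\<in>{j\<in>J. before i j}. ?g j ` W))"
    proof (cases "i = m")
      case True
      have "{j\<in>J. before i j} = K" using True m before_irrefl by (auto simp: K_def)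
      moreover have "(\<Union>j\<in>K. ?g j ` W) = (\<Union>j\<in>K. g j ` W)" by (auto simp: K_def)
      ultimately show ?thesis using f True by simp
    next
      case False
      then have "i \<in> K" using i by (simp add: K_def)
      have "\<not> before i m" using m(2)[OF i False] before_trans before_irrefl by blast
      then have eq: "{j\<in>J. before i j} = {j\<in>K. before i j}" by (auto simp: K_def)
      have "(\<Union>j\<in>{j\<in>K. before i j}. ?g j ` W) = (\<Union>j\<in>{j\<in>K. before i j}. g j ` W)" by (auto simp: K_def)
      then show ?thesis using False g \<open>i \<in> K\<close> unfolding eq by simp
    qed
  qed
qed

text \<open>By transitivity on the left, the copies of index below \<open>i\<close> are together independent over \<open>C\<close> from
  the \<open>i\<close>-th copy of \<open>De\<close>. If they made the \<open>i\<close>-th copy of \<open>e\<close> algebraic over that of \<open>D\<close>,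
  they would fork with that copy of \<open>De\<close>, by \<open>algebraic_dependence\<close>.\<close>

lemma reversed_copies_nonalgebraic:
  fixes g
  assumes D: "sml D" "C \<subseteq> D" and eU: "set e \<subseteq> U" and na: "\<not> algebraic M D e" and b: "set b \<subseteq> U"
    and indep: "ind (D \<union> set e) C (set b)"
    and J: "finite J" "J \<subseteq> Field len" "i \<in> J"
    and g: "\<And>i. i \<in> J \<Longrightarrow> aut (C \<union> set b) (g i)"
      "\<And>i. i \<in> J \<Longrightarrow> ind (g i ` (D \<union> set e)) C (set b \<union> (\<Union>j\<in>{j\<in>J. before i j}. g j ` (D \<union> set e)))"
  shows "\<not> algebraic M (g i ` D \<union> (\<Union>j\<in>{j\<in>J. before j i}. g j ` (D \<union> set e))) (map (g i) e)"
proof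
  let ?W = "D \<union> set e"
  have DU: "D \<subseteq> U" using D(1) by (rule smallD)
  have C: "sml C" using D small_subset by blast
  have W: "sml (D \<union> set e)" using D(1) small_set[OF eU] by (rule small_Un)
  have bsm: "sml (set b)" using b by (rule small_set)
  let ?X = "set b \<union> (\<Union>j\<in>{j\<in>J. j = i \<or> before i j}. g j ` ?W)"
  have gW: "sml (g j ` ?W)" if "j \<in> J" for j using small_image[OF aut_automorphism[OF g(1)] W] that .
  have X: "sml ?X" using gW J(1) by (intro small_Un[OF bsm] small_UN_finite) auto
  have below: "ind (\<Union>j\<in>K. g j ` ?W) C ?X" if "K \<subseteq> {j\<in>J. before j i}" for K
    using that
  proof (induction "card K" arbitrary: K)
    case 0
    have "finite K" using 0(2) J(1) finite_subset by fastforce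
    then have "K = {}" using 0(1) by simp
    obtain f where "ind (f ` ?W) C (set b \<union> ?X)"
      by (rule extension[OF indep W C bsm small_Un[OF bsm X]]) auto
    then have "ind (f ` ?W) C ?X" by (simp add: Un_assoc[symmetric])
    then show ?case using ind_left_empty \<open>K = {}\<close> by auto
  next
    case (Suc n)
    have finK: "finite K" using Suc.hyps(2) by (metis card.infinite nat.distinct(1))
    have "K \<noteq> {}" "K \<subseteq> Field len" using Suc.hyps(2) Suc.prems J(2) by auto
    then obtain m where m: "m \<in> K" "\<And>j. j \<in> K \<Longrightarrow> j \<noteq> m \<Longrightarrow> before m j" by (rule before_minimal) blast
    define K' where "K' = K - {m}"
    have cK: "n = card K'" using Suc.hyps(2) m(1) finK by (simp add: K'_def)
    have IH: "ind (\<Union>j\<in>K'. g j ` ?W) C ?X" using Suc.prems by (intro Suc.hyps(1)[OF cK]) (auto simp: K'_def)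
    have mJ: "m \<in> J" "before m i" using m(1) Suc.prems by auto
    have K'J: "K' \<subseteq> {j\<in>J. before m j}" using m Suc.prems by (auto simp: K'_def)
    moreover have "{j\<in>J. j = i \<or> before i j} \<subseteq> {j\<in>J. before m j}" using mJ before_trans by blast
    ultimately have "(C \<union> (\<Union>j\<in>K'. g j ` ?W)) \<union> ?X \<subseteq> C \<union> (set b \<union> (\<Union>j\<in>{j\<in>J. before m j}. g j ` ?W))" by blast
    then have "ind (g m ` ?W) (C \<union> (\<Union>j\<in>K'. g j ` ?W)) ?X"
      using smallD[OF gW[OF mJ(1)]] by (intro ind_mono[OF g(2)[OF mJ(1)]]) auto
    moreover have "sml (\<Union>j\<in>K'. g j ` ?W)"
      using gW K'J finK by (intro small_UN_finite) (auto simp: K'_def)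
    ultimately have "ind ((\<Union>j\<in>K'. g j ` ?W) \<union> g m ` ?W) C ?X"
      using left_transitivity[OF IH _ _ gW[OF mJ(1)] C X] by blast
    moreover have "(\<Union>j\<in>K'. g j ` ?W) \<union> g m ` ?W = (\<Union>j\<in>K. g j ` ?W)" using m(1) by (auto simp: K'_def)
    ultimately show ?case by simp
  qed
  let ?A = "\<Union>j\<in>{j\<in>J. before j i}. g j ` ?W"
  have A: "?A \<subseteq> U" using gW smallD by blast
  have gi: "automorphism M (g i)" using g(1)[OF J(3)] by (rule aut_automorphism)
  have giD: "sml (g i ` D)" using small_image[OF gi D(1)] .
  have gie: "set (map (g i) e) \<subseteq> U" by (rule automorphism_set[OF gi eU])
  assume "algebraic M (g i ` D \<union> ?A) (map (g i) e)"
  then obtain w where w: "set w \<subseteq> ?A" "algebraic M (g i ` D \<union> set w) (map (g i) e)"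
    by (rule algebraic_finite_support[OF _ gie smallD[OF giD] A]) blast
  have wU: "set w \<subseteq> U" using w(1) A by blast
  obtain h where h: "automorphism M h" "\<And>x. x \<in> U \<Longrightarrow> h (g i x) = x"
    using gi by (rule automorphism_inverse) blast
  have "\<not> algebraic M (g i ` D) (map (g i) e)"
  proof
    assume "algebraic M (g i ` D) (map (g i) e)"
    then have "algebraic M (h ` g i ` D) (map h (map (g i) e))"
      by (rule algebraic_image[OF _ h(1) smallD[OF giD] gie])
    moreover have "h ` g i ` D = D" using DU h(2) by (rule image_inverse)
    moreover have "map h (map (g i) e) = e" using eU h(2) by (rule map_inverse)
    ultimately show False using na by simp
  qed
  moreover have CgD: "C \<subseteq> g i ` D" using aut_image[OF g(1)[OF J(3)], of C] D(2) by blast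
  ultimately have "\<not> thorn_indep \<kappa> M w C (g i ` D \<union> set (map (g i) e))"
    using algebraic_dependence[OF giD CgD gie wU _ w(2)] by blast
  moreover have "thorn_indep \<kappa> M w C ?X" using below[OF order_refl] w(1) by (rule indD)
  moreover have "C \<union> (g i ` D \<union> set (map (g i) e)) \<subseteq> C \<union> ?X" using J(3) by auto
  ultimately show False using thorn_indep_mono[OF _ wU order_refl] by blast
qed

text \<open>Copies indexed by an infinite ordinal cannot be chosen from the top downwards. But all that is
  wanted of them, namely to be conjugate to \<open>De\<close> over \<open>Cb\<close> (the constraints \<open>\<Sigma>1\<close>) and that each copy
  of \<open>e\<close> be non-algebraic over its copy of \<open>D\<close> and the earlier copies (the constraints \<open>\<Sigma>2\<close>), is
  expressed by conditions on finitely many elements, and finitely many indices can be treated by the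
  preceding lemmas. The variable \<open>(i, x)\<close> stands for the \<open>i\<close>-th copy of the element \<open>x\<close>.\<close>

lemma nonalgebraic_sequence:
  assumes D: "sml D" "C \<subseteq> D" and eU: "set e \<subseteq> U" and na: "\<not> algebraic M D e" and b: "set b \<subseteq> U"
    and indep: "ind (D \<union> set e) C (set b)"
  obtains g where "\<And>i. i \<in> Field len \<Longrightarrow> aut (C \<union> set b) (g i)"
    "\<And>i. i \<in> Field len \<Longrightarrow>
      \<not> algebraic M (g i ` D \<union> (\<Union>j\<in>{j. before j i}. g j ` (D \<union> set e))) (map (g i) e)"
proof -
  have DU: "D \<subseteq> U" using D(1) by (rule smallD)
  have C: "sml C" using D small_subset by blast
  define W where "W = D \<union> set e"
  have W: "sml W" unfolding W_def using D(1) small_set[OF eU] by (rule small_Un)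
  have WU: "W \<subseteq> U" using W by (rule smallD)
  have bsm: "sml (set b)" using b by (rule small_set)
  have Cb: "C \<union> set b \<subseteq> U" using smallD[OF C] b by blast
  have ne: "e \<noteq> []" using na algebraic_Nil by blast
  define V0 where "V0 = W \<union> set b"
  have V0: "sml V0" unfolding V0_def using W bsm by (rule small_Un)
  have V0U: "V0 \<subseteq> U" using V0 by (rule smallD)
  define V where "V = Field len \<times> V0"
  define \<sigma> where "\<sigma> v = srt (snd v)" for v :: "('s, 'f, 'r) fm set \<times> 'a"
  have \<sigma>i: "map \<sigma> (map (Pair i) l) = map srt l" for i l by (simp add: \<sigma>_def)
  define low where "low i = {(j, x). j \<in> Field len \<and> before j i \<and> x \<in> W} \<union> {i} \<times> D" for i
  define \<Sigma>1 where "\<Sigma>1 = {(map (Pair i) l, X) | i l X. i \<in> Field len \<and> set l \<subseteq> V0 \<and>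
    dfn M (C \<union> set b) (map srt l) X \<and> l \<in> X}"
  define \<Sigma>2 where "\<Sigma>2 = {(map (Pair i) e @ vs, tuples M (map srt e @ map \<sigma> vs) - few (map srt e) (map \<sigma> vs) Z n)
    | i vs Z n. i \<in> Field len \<and> set vs \<subseteq> low i \<and> dfn M {} (map srt e @ map \<sigma> vs) Z}"
  have lowV: "low i \<subseteq> V" if "i \<in> Field len" for i using that by (auto simp: low_def V_def V0_def W_def)
  have eV0: "set e \<subseteq> V0" and DV0: "D \<subseteq> V0" and WV0: "W \<subseteq> V0" by (auto simp: V0_def W_def)
  have "\<exists>h. (\<forall>v\<in>V. h v \<in> U \<and> srt (h v) = \<sigma> v) \<and> (\<forall>(vs, X)\<in>\<Sigma>1 \<union> \<Sigma>2. map h vs \<in> X)"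
  proof (rule realize_family)
    show "sml (C \<union> set b)" using C bsm by (rule small_Un)
    show "|V| <o \<kappa>" unfolding V_def using len_less_kappa small_less[OF V0] by (rule less_kappa_Times)
    show "set vs \<subseteq> V \<and> dfn M (C \<union> set b) (map \<sigma> vs) X" if vX: "(vs, X) \<in> \<Sigma>1 \<union> \<Sigma>2" for vs X
    proof (cases "(vs, X) \<in> \<Sigma>1")
      case True
      then obtain i l where *: "vs = map (Pair i) l" "i \<in> Field len" "set l \<subseteq> V0"
        "dfn M (C \<union> set b) (map srt l) X" by (auto simp: \<Sigma>1_def)
      then show ?thesis unfolding *(1) \<sigma>i by (auto simp: V_def)
    next
      case False
      then have "(vs, X) \<in> \<Sigma>2" using vX by blast
      then obtain i us Z n where i: "vs = map (Pair i) e @ us" "i \<in> Field len" "set us \<subseteq> low i"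
        "dfn M {} (map srt e @ map \<sigma> us) Z"
        "X = tuples M (map srt e @ map \<sigma> us) - few (map srt e) (map \<sigma> us) Z n"
        unfolding \<Sigma>2_def by blast
      have "set vs \<subseteq> V" using i(1-3) lowV[OF i(2)] eV0 by (auto simp: V_def)
      moreover have "dfn M {} (map srt e @ map \<sigma> us) X"
        unfolding i(5) by (rule dfn_compl[OF dfn_few[OF i(4) sorts_of_tuple[OF eU]]])
      then have "dfn M (C \<union> set b) (map \<sigma> vs) X" unfolding i(1) map_append \<sigma>i by (rule dfn_mono) simp
      ultimately show ?thesis by blast
    qed
    fix F assume F: "F \<subseteq> \<Sigma>1 \<union> \<Sigma>2" "finite F"
    define J where "J = (\<Union>(vs, X)\<in>F. fst ` set vs) \<inter> Field len"
    have "finite (\<Union>(vs, X)\<in>F. fst ` set vs)" using F(2) by (intro finite_UN_I) auto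
    then have J: "finite J" "J \<subseteq> Field len" by (auto simp: J_def)
    obtain g where "\<forall>i\<in>J. aut (C \<union> set b) (g i) \<and> ind (g i ` W) C (set b \<union> (\<Union>j\<in>{j\<in>J. before i j}. g j ` W))"
      using reversed_independent_copies[OF indep[folded W_def] W C b J] by blast
    then have g: "\<And>i. i \<in> J \<Longrightarrow> aut (C \<union> set b) (g i)"
      "\<And>i. i \<in> J \<Longrightarrow> ind (g i ` W) C (set b \<union> (\<Union>j\<in>{j\<in>J. before i j}. g j ` W))" by blast+
    define h where "h v = (if fst v \<in> J then g (fst v) (snd v) else snd v)" for v
    have typed: "h v \<in> U \<and> srt (h v) = \<sigma> v" if "v \<in> V" for v
    proof -
      have "snd v \<in> U" using that V0U by (auto simp: V_def)
      then show ?thesis using automorphismD(2,3)[OF aut_automorphism[OF g(1)]] by (simp add: h_def \<sigma>_def)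
    qed
    show "\<exists>h. (\<forall>v\<in>V. h v \<in> U \<and> srt (h v) = \<sigma> v) \<and> (\<forall>(vs, X)\<in>F. map h vs \<in> X)"
    proof (intro exI[of _ h] conjI ballI)
      show "h v \<in> U" "srt (h v) = \<sigma> v" if "v \<in> V" for v using typed[OF that] by auto
      fix c assume c: "c \<in> F"
      obtain vs X where vX: "c = (vs, X)" by force
      have "map h vs \<in> X"
      proof (cases "(vs, X) \<in> \<Sigma>1")
        case True
        then obtain i l where i: "vs = map (Pair i) l" "set l \<subseteq> V0"
          "dfn M (C \<union> set b) (map srt l) X" "l \<in> X" by (auto simp: \<Sigma>1_def)
        show ?thesis
        proof (cases "i \<in> J")
          case True
          have "map (g i) l \<in> X"
            using dfn_automorphism[OF i(3) aut_automorphism[OF g(1)[OF True]] aut_fix[OF g(1)[OF True]] Cb in_tuples_self]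
              i(2,4) V0U by blast
          moreover have "map h vs = map (g i) l" using True by (simp add: i(1) h_def)
          ultimately show ?thesis by (simp only:)
        next
          case False
          then have "map h vs = l" by (simp add: i(1) h_def map_idI)
          then show ?thesis using i(4) by simp
        qed
      next
        case False
        then have "(vs, X) \<in> \<Sigma>2" using c F(1) vX by blast
        then obtain i us Z n where i: "vs = map (Pair i) e @ us" "i \<in> Field len" "set us \<subseteq> low i"
          "dfn M {} (map srt e @ map \<sigma> us) Z"
          "X = tuples M (map srt e @ map \<sigma> us) - few (map srt e) (map \<sigma> us) Z n"
          unfolding \<Sigma>2_def by blast
        have vJ: "fst v \<in> J" if "v \<in> set vs" for v
        proof -
          have "set vs \<subseteq> V" using i(1-3) lowV[OF i(2)] eV0 by (auto simp: V_def)
          then have "fst v \<in> Field len" using that by (auto simp: V_def)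
          then show ?thesis using that c by (force simp: J_def vX)
        qed
        have iJ: "i \<in> J" using vJ[of "(i, hd e)"] ne by (simp add: i(1))
        have gi: "automorphism M (g i)" using g(1)[OF iJ] by (rule aut_automorphism)
        have usV: "set us \<subseteq> V" using i(2,3) lowV by blast
        let ?P = "g i ` D \<union> (\<Union>j\<in>{j\<in>J. before j i}. g j ` W)"
        have hus: "set (map h us) \<subseteq> ?P"
        proof
          fix y assume "y \<in> set (map h us)"
          then obtain v where v: "v \<in> set us" "y = h v" by auto
          then have "fst v \<in> J" using vJ by (simp add: i(1))
          then show "y \<in> ?P" using v i(3) by (force simp: h_def low_def)
        qed
        have PU: "?P \<subseteq> U"
          using automorphism_subset[OF gi DU] automorphism_subset[OF aut_automorphism[OF g(1)] WU] by blast
        have sus: "map srt (map h us) = map \<sigma> us" using typed usV by auto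
        have ge: "set (map (g i) e) \<subseteq> U" by (rule automorphism_set[OF gi eU])
        have sge: "map srt (map (g i) e) = map srt e" by (rule map_sort_automorphism[OF gi eU])
        have hvs: "map h vs = map (g i) e @ map h us" using iJ by (simp add: i(1) h_def)
        have "map (g i) e @ map h us \<notin> few (map srt e) (map \<sigma> us) Z n"
        proof
          assume "map (g i) e @ map h us \<in> few (map srt e) (map \<sigma> us) Z n"
          then have f: "map (g i) e @ map h us \<in> few (map srt e) (map srt (map h us)) Z n"
            unfolding sus .
          have "dfn M {} (map srt e @ map srt (map h us)) Z" unfolding sus by (rule i(4))
          with f hus have "\<exists>w Z n. set w \<subseteq> ?P \<and> dfn M {} (map srt e @ map srt w) Z \<and>
              map (g i) e @ w \<in> few (map srt e) (map srt w) Z n"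
            by (intro exI conjI)
          then show False using reversed_copies_nonalgebraic[OF D eU na b indep J iJ g[unfolded W_def], folded W_def] unfolding algebraic_iff_few[OF ge PU] sge by (rule notE[rotated])
        qed
        moreover have "map (g i) e @ map h us \<in> tuples M (map srt e @ map \<sigma> us)"
        proof -
          have "map (g i) e \<in> tuples M (map srt e)" using in_tuples_self[OF ge] unfolding sge .
          moreover have "map h us \<in> tuples M (map \<sigma> us)"
            using in_tuples_self[of "map h us" M] hus PU unfolding sus by blast
          ultimately show ?thesis by (simp add: in_tuples_append)
        qed
        ultimately show ?thesis unfolding i(5) hvs by blast
      qed
      then show "case c of (vs, X) \<Rightarrow> map h vs \<in> X" by (simp add: vX)
    qed
  qed
  then obtain h where h: "(\<forall>v\<in>V. h v \<in> U \<and> srt (h v) = \<sigma> v) \<and>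
      (\<forall>(vs, X)\<in>\<Sigma>1 \<union> \<Sigma>2. map h vs \<in> X)" ..
  have typed: "h v \<in> U \<and> srt (h v) = \<sigma> v" if "v \<in> V" for v
    by (rule bspec[OF conjunct1[OF h] that])
  have hX: "map h vs \<in> X" if "(vs, X) \<in> \<Sigma>1 \<union> \<Sigma>2" for vs X
    using bspec[OF conjunct2[OF h] that] by (simp only: prod.case)
  have h1: "map h vs \<in> X" if "(vs, X) \<in> \<Sigma>1" for vs X by (rule hX[OF UnI1[OF that]])
  have h2: "map h vs \<in> X" if "(vs, X) \<in> \<Sigma>2" for vs X by (rule hX[OF UnI2[OF that]])
  have copies: "\<exists>g. aut (C \<union> set b) g \<and> (\<forall>x\<in>V0. g x = h (i, x))" if i: "i \<in> Field len" for i
  proof -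
    have hi: "h (i, x) \<in> U \<and> srt (h (i, x)) = srt x" if "x \<in> V0" for x
      using typed[of "(i, x)"] that i by (simp add: V_def \<sigma>_def)
    have copy: "map (\<lambda>x. h (i, x)) l \<in> X" if l: "set l \<subseteq> V0" "dfn M (C \<union> set b) (map srt l) X" "l \<in> X" for l X
    proof -
      have "(map (Pair i) l, X) \<in> \<Sigma>1" using l i unfolding \<Sigma>1_def by blast
      from h1[OF this] show ?thesis by (simp add: comp_def)
    qed
    have copy0: "map (\<lambda>x. h (i, x)) l \<in> X" if "set l \<subseteq> V0" "dfn M {} (map srt l) X" "l \<in> X" for l X
      by (rule copy[OF that(1) dfn_mono[OF that(2)] that(3)]) simp
    have "\<exists>g. automorphism M g \<and> (\<forall>x\<in>V0. g x = h (i, x))"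
      by (rule copy_extends[OF V0 hi copy0]) auto
    then obtain g where g: "automorphism M g" "\<forall>x\<in>V0. g x = h (i, x)" by blast
    have "g x = x" if "x \<in> C \<union> set b" for x
    proof -
      have x: "x \<in> V0" using that D(2) by (auto simp: V0_def W_def)
      have "dfn M (C \<union> set b) (map srt [x]) {[x]}" using that Cb by (intro dfn_singleton) auto
      then have "map (\<lambda>x. h (i, x)) [x] \<in> {[x]}" using x by (intro copy) auto
      then show ?thesis using g(2) x by simp
    qed
    then show ?thesis using g by (auto simp: aut_def)
  qed
  have "\<exists>g. \<forall>i\<in>Field len. aut (C \<union> set b) (g i) \<and> (\<forall>x\<in>V0. g i x = h (i, x))"
    using copies by (intro bchoice) blast
  then obtain g where g: "\<And>i. i \<in> Field len \<Longrightarrow> aut (C \<union> set b) (g i)"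
    "\<And>i x. i \<in> Field len \<Longrightarrow> x \<in> V0 \<Longrightarrow> g i x = h (i, x)" by blast
  have nonalg: "\<not> algebraic M (g i ` D \<union> (\<Union>j\<in>{j. before j i}. g j ` W)) (map (g i) e)"
    if i: "i \<in> Field len" for i
  proof
    let ?D = "g i ` D \<union> (\<Union>j\<in>{j. before j i}. g j ` W)"
    have ga: "automorphism M (g i)" using g(1)[OF i] by (rule aut_automorphism)
    have ge: "set (map (g i) e) \<subseteq> U" by (rule automorphism_set[OF ga eU])
    have sge: "map srt (map (g i) e) = map srt e" by (rule map_sort_automorphism[OF ga eU])
    have gD: "g i ` D = h ` ({i} \<times> D)" using g(2)[OF i] DV0 by force
    have "(\<Union>j\<in>{j. before j i}. g j ` W) = (\<Union>j\<in>{j. before j i}. (\<lambda>x. h (j, x)) ` W)"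
    proof (intro SUP_cong refl image_cong)
      fix j x assume "j \<in> {j. before j i}" "x \<in> W"
      then show "g j x = h (j, x)" using g(2)[of j x] before_Field WV0 by blast
    qed
    also have "\<dots> = h ` {(j, x). j \<in> Field len \<and> before j i \<and> x \<in> W}"
      using before_Field by force
    finally have D_low: "?D = h ` low i" unfolding gD by (auto simp: low_def)
    have "low i \<subseteq> V" by (rule lowV[OF i])
    then have DU': "?D \<subseteq> U" unfolding D_low using typed by auto
    assume "algebraic M ?D (map (g i) e)"
    then obtain w Z n where w: "set w \<subseteq> ?D" "dfn M {} (map srt e @ map srt w) Z"
      "map (g i) e @ w \<in> few (map srt e) (map srt w) Z n"
      unfolding algebraic_iff_few[OF ge DU'] sge by blast
    have "set w \<subseteq> h ` low i" using w(1) unfolding D_low .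
    then obtain us where us: "set us \<subseteq> low i" "w = map h us" by (rule list_of_image)
    have "set us \<subseteq> V" using us(1) lowV[OF i] by blast
    then have sw: "map srt w = map \<sigma> us" unfolding us(2) using typed by auto
    have "map h (map (Pair i) e @ us) \<in> tuples M (map srt e @ map \<sigma> us) - few (map srt e) (map \<sigma> us) Z n"
    proof (rule h2)
      show "(map (Pair i) e @ us, tuples M (map srt e @ map \<sigma> us) - few (map srt e) (map \<sigma> us) Z n) \<in> \<Sigma>2"
        using i us(1) w(2) unfolding \<Sigma>2_def sw by blast
    qed
    moreover have "map h (map (Pair i) e @ us) = map (g i) e @ w" using g(2)[OF i] eV0 by (auto simp: us(2))
    ultimately have "map (g i) e @ w \<notin> few (map srt e) (map \<sigma> us) Z n" by (simp only: Diff_iff simp_thms)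
    then show False using w(3) unfolding sw by (rule notE)
  qed
  show ?thesis by (rule that[OF g(1) nonalg[unfolded W_def]])
qed

text \<open>Along a sequence as in \<open>nonalgebraic_sequence\<close> the tuple \<open>b\<close> satisfies, for every index \<open>i\<close>, a
  formula that strongly divides over the \<open>i\<close>-th copy of \<open>D\<close> together with all earlier copies, with
  the \<open>i\<close>-th copy of \<open>e\<close> as its parameter. This contradicts \<open>chain_stabilizes\<close>.\<close>

lemma strong_dividing_dependent:
  assumes D: "sml D" "C \<subseteq> D" and sd: "sdiv_by D (map srt b) Y e"
    and b: "set b \<subseteq> U" "b \<in> Y" and indep: "ind (D \<union> set e) C (set b)"
  shows False
proof -
  have DU: "D \<subseteq> U" and eU: "set e \<subseteq> U" and na: "\<not> algebraic M D e"
    using smallD[OF D(1)] sdiv_byD[OF sd] by auto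
  have C: "sml C" using D small_subset by blast
  let ?W = "D \<union> set e"
  have W: "sml ?W" using D(1) small_set[OF eU] by (rule small_Un)
  have WU: "?W \<subseteq> U" using W by (rule smallD)
  obtain g where g: "\<And>i. i \<in> Field len \<Longrightarrow> aut (C \<union> set b) (g i)"
    and nalg: "\<And>i. i \<in> Field len \<Longrightarrow>
      \<not> algebraic M (g i ` D \<union> (\<Union>j\<in>{j. before j i}. g j ` ?W)) (map (g i) e)"
    by (rule nonalgebraic_sequence[OF D eU na b(1) indep]) blast
  define X where "X i = g i ` ?W" for i
  have XU: "X i \<subseteq> U" if "i \<in> Field len" for i
    unfolding X_def by (rule automorphism_subset[OF aut_automorphism[OF g[OF that]] WU])
  have "(\<Union>i\<in>Field len. X i) = (\<lambda>(i, x). g i x) ` (Field len \<times> ?W)" by (auto simp: X_def)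
  moreover have "|(\<lambda>(i, x). g i x) ` (Field len \<times> ?W)| <o \<kappa>"
    by (rule less_kappa_image[OF less_kappa_Times[OF len_less_kappa small_less[OF W]]])
  ultimately have Xs: "sml (\<Union>i\<in>Field len. X i)" using XU by (auto simp: small_def)
  obtain i where i: "i \<in> Field len"
    "thorn_indep \<kappa> M b (C \<union> (\<Union>j\<in>{j. before j i}. X j)) (C \<union> (\<Union>j\<in>Field len. X j))"
    by (rule chain_stabilizes[OF b(1) C Xs])
  let ?L = "\<Union>j\<in>{j. before j i}. X j"
  let ?D = "g i ` D \<union> ?L"
  have ga: "automorphism M (g i)" using g[OF i(1)] by (rule aut_automorphism)
  have low_sub: "?L \<subseteq> (\<Union>j\<in>Field len. X j)" using before_Field by blast
  have D': "sml ?D" using small_image[OF ga D(1)] small_subset[OF Xs low_sub] by (rule small_Un)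
  have gC: "C \<subseteq> g i ` D" using aut_image[OF g[OF i(1)], of C] D(2) by blast
  have sdg: "sdiv_by (g i ` D) (map srt b) (map (g i) ` Y) (map (g i) e)"
    by (rule sdiv_by_image[OF sd ga DU])
  have sd': "sdiv_by ?D (map srt b) (map (g i) ` Y) (map (g i) e)"
    by (rule sdiv_by_mono[OF sdg Un_upper1 nalg[OF i(1), folded X_def]])
  have "tfork (C \<union> ?L) (map srt b) (map (g i) ` Y)"
    using D' sd' gC by (intro tfork_tdiv) (auto simp: tdiv_def sdiv_def)
  moreover have "dfn M ((C \<union> ?L) \<union> (C \<union> (\<Union>j\<in>Field len. X j))) (map srt b) (map (g i) ` Y)"
  proof (rule dfn_mono[OF sdiv_byD(3)[OF sd' smallD[OF D']]])
    have "g i ` D \<union> set (map (g i) e) \<subseteq> X i" unfolding X_def by auto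
    then show "?D \<union> set (map (g i) e) \<subseteq> (C \<union> ?L) \<union> (C \<union> (\<Union>j\<in>Field len. X j))" using i(1) by blast
  qed
  moreover have "map (g i) b = b" by (rule aut_map[OF g[OF i(1)]]) simp
  then have "b \<in> map (g i) ` Y" using b(2) by (metis image_eqI)
  ultimately show False using i(2) unfolding thorn_indep_iff[OF b(1)] by blast
qed

text \<open>If \<open>b\<close> from \<open>B\<close> forks with \<open>A\<close> over \<open>C\<close>, collect the witnesses of this forking in a set \<open>E\<close>. By
  existence and extension a conjugate of \<open>E\<close> over \<open>C \<union> A\<close> is independent from \<open>B\<close> over \<open>C \<union> A\<close>, so by
  transitivity on the left it is independent from \<open>B\<close> over \<open>C\<close>. This is what
  \<open>strong_dividing_dependent\<close> excludes.\<close>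

theorem symmetry:
  assumes AB: "ind A C B" and sml: "sml A" "sml C" "sml B"
  shows "ind B C A"
  unfolding ind_def
proof (intro allI impI)
  fix b assume bB: "set b \<subseteq> B"
  have U: "A \<subseteq> U" "C \<subseteq> U" "B \<subseteq> U" using sml smallD by blast+
  have b: "set b \<subseteq> U" using bB U by blast
  show "thorn_indep \<kappa> M b C A"
    unfolding thorn_indep_iff[OF b]
  proof (intro allI impI notI)
    fix Z assume Z: "dfn M (C \<union> A) (map srt b) Z" "b \<in> Z" "tfork C (map srt b) Z"
    from Z(3) obtain \<Y> where \<Y>: "finite \<Y>" "\<forall>Y\<in>\<Y>. tdiv C (map srt b) Y" "Z \<subseteq> \<Union>\<Y>"
      unfolding tfork_def by blast
    have "\<exists>De. \<forall>Y\<in>\<Y>. sml (fst (De Y)) \<and> C \<subseteq> fst (De Y) \<and> sdiv_by (fst (De Y)) (map srt b) Y (snd (De Y))"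
      using \<Y>(2) unfolding tdiv_def sdiv_def by (intro bchoice) auto
    then obtain De where De: "\<And>Y. Y \<in> \<Y> \<Longrightarrow>
        sml (fst (De Y)) \<and> C \<subseteq> fst (De Y) \<and> sdiv_by (fst (De Y)) (map srt b) Y (snd (De Y))"
      by blast
    define E where "E = (\<Union>Y\<in>\<Y>. fst (De Y) \<union> set (snd (De Y)))"
    have E: "sml E" unfolding E_def
    proof (intro small_UN_finite[OF \<Y>(1)] small_Un)
      fix Y assume "Y \<in> \<Y>"
      then show "sml (fst (De Y))" "sml (set (snd (De Y)))"
        using De[of Y] sdiv_byD(1) small_set by blast+
    qed
    have CA: "sml (C \<union> A)" using sml by (intro small_Un)
    have "ind E (C \<union> A) {}" using CA smallD[OF E] by (rule existence) simp
    then obtain g where g: "aut ((C \<union> A) \<union> {}) g" "ind (g ` E) (C \<union> A) B"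
      using E CA small_finite[OF finite.emptyI] sml(3) by (rule extension) auto
    have ga: "automorphism M g" using g(1) by (rule aut_automorphism)
    have "ind (A \<union> g ` E) C B"
      by (rule left_transitivity[OF AB g(2) sml(1) small_image[OF ga E] sml(2,3)])
    then have gE: "ind (g ` E) C (set b)"
      by (rule ind_mono) (use bB U smallD[OF small_image[OF ga E]] in auto)
    obtain h where h: "aut ((C \<union> A) \<union> {}) h" "\<And>x. x \<in> U \<Longrightarrow> g (h x) = x"
      by (rule aut_inverse[OF g(1)]) (use U in auto)
    have "map h b \<in> Z"
      using dfn_automorphism[OF Z(1) aut_automorphism[OF h(1)] aut_fix[OF h(1)] _ in_tuples_self[OF b]] Z(2) U by auto
    then obtain Y where Y: "Y \<in> \<Y>" "map h b \<in> Y" using \<Y>(3) by blast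
    let ?D = "fst (De Y)" and ?e = "snd (De Y)"
    have D: "sml ?D" "C \<subseteq> ?D" "sdiv_by ?D (map srt b) Y ?e" using De[OF Y(1)] by auto
    have "map g (map h b) = b" using b h(2) by (rule map_inverse)
    then have bY: "b \<in> map g ` Y" using Y(2) by (metis image_eqI)
    show False
    proof (rule strong_dividing_dependent[OF _ _ _ b bY])
      show "sml (g ` ?D)" using small_image[OF ga D(1)] .
      show "C \<subseteq> g ` ?D" using aut_image[OF g(1), of C] D(2) by blast
      show "sdiv_by (g ` ?D) (map srt b) (map g ` Y) (map g ?e)"
        by (rule sdiv_by_image[OF D(3) ga smallD[OF D(1)]])
      have "g ` ?D \<union> set (map g ?e) \<subseteq> g ` E" using Y(1) unfolding E_def by auto
      then show "ind (g ` ?D \<union> set (map g ?e)) C (set b)"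
        using smallD[OF small_image[OF ga E]] by (intro ind_mono[OF gE]) auto
    qed
  qed
qed

end

definition els :: "'a list list \<Rightarrow> 'a set" where
  "els xs = \<Union>(set ` set xs)"

lemma els_simps [simp]: "els [] = {}" "els (x # xs) = set x \<union> els xs" "els (xs @ ys) = els xs \<union> els ys"
  by (auto simp: els_def)

lemma els_mono: "set xs \<subseteq> set ys \<Longrightarrow> els xs \<subseteq> els ys"
  by (auto simp: els_def)

lemma els_map: "els (map (map g) xs) = g ` els xs"
  by (auto simp: els_def)

lemma set_concat_els: "set (concat xs) = els xs"
  by (simp add: els_def)

lemma finite_els: "finite (els xs)"
  by (simp add: els_def)

lemma els_member: "x \<in> set xs \<Longrightarrow> set x \<subseteq> els xs"
  by (auto simp: els_def)

context rosy_monster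
begin

section \<open>The calculus of independence\<close>

lemma ind_trans:
  assumes "ind A C B" "ind A (C \<union> B) D" "sml A" "sml C" "sml B" "sml D"
  shows "ind A C (B \<union> D)"
proof -
  have "ind B C A" by (rule symmetry) (use assms in \<open>auto simp: small_Un_iff\<close>)
  moreover have "ind D (C \<union> B) A" by (rule symmetry) (use assms in \<open>auto simp: small_Un_iff\<close>)
  ultimately have "ind (B \<union> D) C A" using assms by (intro left_transitivity)
  then show ?thesis by (rule symmetry) (use assms in \<open>auto simp: small_Un_iff\<close>)
qed

lemma ind_base_left:
  assumes "ind A C B" "C \<subseteq> C'" "C' \<union> A' \<subseteq> C \<union> A" "sml A" "sml C" "sml B"
  shows "ind A' C' B"
proof -
  have CA: "sml (C \<union> A)" using assms by (intro small_Un)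
  have "ind B C A" by (rule symmetry) (use assms in \<open>auto simp: small_Un_iff\<close>)
  then have "ind B C' A'" by (rule ind_mono) (use assms smallD[OF assms(6)] in auto)
  moreover have "sml (C' \<union> A')" by (rule small_subset[OF CA assms(3)])
  ultimately show ?thesis using assms(6) symmetry[of B C' A'] by (simp add: small_Un_iff)
qed

lemma ind_aut:
  assumes "ind A C B" "aut (C \<union> B) g" "A \<subseteq> U" "C \<union> B \<subseteq> U"
  shows "ind (g ` A) C B"
  using ind_image[OF assms(1) aut_automorphism[OF assms(2)]] assms(3,4)
    aut_image[OF assms(2), of C] aut_image[OF assms(2), of B] by auto

lemma ind_conjugate:
  assumes "ind (set a) C B" "conjugate (C \<union> B) a b" "set a \<subseteq> U" "C \<union> B \<subseteq> U"
  shows "ind (set b) C B"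
  using assms ind_aut unfolding conjugate_def by fastforce

lemma ind_conjugate_iff:
  assumes "conjugate (C \<union> B) a b" "set a \<subseteq> U" "C \<union> B \<subseteq> U"
  shows "ind (set a) C B \<longleftrightarrow> ind (set b) C B"
  using ind_conjugate[OF _ assms] ind_conjugate[OF _ conjugate_sym[OF assms(1,3,2)] conjugate_set[OF assms(1,2)] assms(3)]
  by blast

text \<open>Each tuple is independent from those after it. For finite sequences this is equivalent to being
  an independent family (\<open>indseq_iff_family\<close>) and easier to use in inductions.\<close>

fun indseq :: "'a set \<Rightarrow> 'a list list \<Rightarrow> bool" where
  "indseq C [] \<longleftrightarrow> True"
| "indseq C (x # xs) \<longleftrightarrow> ind (set x) C (els xs) \<and> indseq C xs"

lemma small_els: "\<forall>x\<in>set xs. set x \<subseteq> U \<Longrightarrow> sml (els xs)"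
  by (intro small_finite finite_els) (auto simp: els_def)

lemma indseq_append:
  assumes "indseq C (xs @ ys)" "\<forall>x\<in>set (xs @ ys). set x \<subseteq> U" "sml C"
  shows "indseq C xs" "indseq C ys" "ind (els xs) C (els ys)"
proof -
  have "indseq C xs \<and> indseq C ys \<and> ind (els xs) C (els ys)"
    using assms(1,2)
  proof (induction xs)
    case Nil
    have "ind (els ys) C {}" using assms(3) smallD[OF small_els, of ys] Nil by (intro existence) auto
    then have "ind {} C (els ys)" by (rule symmetry) (use Nil assms(3) small_els[of ys] small_finite in auto)
    then show ?case using Nil by simp
  next
    case (Cons x xs)
    have x: "ind (set x) C (els xs \<union> els ys)" and xs: "indseq C (xs @ ys)" using Cons.prems(1) by auto
    have U: "set x \<subseteq> U" "els xs \<subseteq> U" "els ys \<subseteq> U" using Cons.prems(2) by (auto simp: els_def)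
    have sm: "sml (set x)" "sml (els xs)" "sml (els ys)" using U by (auto intro: small_finite simp: finite_els)
    have IH: "indseq C xs" "indseq C ys" "ind (els xs) C (els ys)" using Cons.IH[OF xs] Cons.prems(2) by auto
    have "ind (set x) C (els xs)" by (rule ind_mono[OF x U(1)]) auto
    moreover have "ind (set x) (C \<union> els xs) (els ys)" by (rule ind_mono[OF x U(1)]) auto
    then have "ind (els xs \<union> set x) C (els ys)" using IH(3) sm assms(3) by (intro left_transitivity)
    ultimately show ?case using IH by (simp add: Un_commute)
  qed
  then show "indseq C xs" "indseq C ys" "ind (els xs) C (els ys)" by auto
qed

lemma indseq_image:
  assumes "indseq C xs" "automorphism M g" "\<forall>x\<in>set xs. set x \<subseteq> U" "C \<subseteq> U"
  shows "indseq (g ` C) (map (map g) xs)"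
  using assms
proof (induction xs)
  case (Cons x xs)
  have "set x \<subseteq> U" "els xs \<subseteq> U" using Cons.prems by (auto simp: els_def)
  then have "ind (g ` set x) (g ` C) (g ` els xs)"
    using ind_image[of "set x" C "els xs" g] Cons.prems by simp
  then show ?case using Cons by (simp add: els_map)
qed simp

lemma indseq_aut:
  assumes "indseq C xs" "aut C g" "\<forall>x\<in>set xs. set x \<subseteq> U" "C \<subseteq> U"
  shows "indseq C (map (map g) xs)"
  using indseq_image[OF assms(1) aut_automorphism[OF assms(2)] assms(3,4)]
    aut_image[OF assms(2) order_refl] by simp

lemma indseq_base:
  assumes "indseq C xs" "C \<subseteq> C'" "ind C' C (els xs)" "\<forall>x\<in>set xs. set x \<subseteq> U" "sml C'"
  shows "indseq C' xs"
  using assms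
proof (induction xs)
  case (Cons x xs)
  have C: "sml C" using Cons.prems by (meson small_subset)
  have U: "set x \<subseteq> U" "els xs \<subseteq> U" using Cons.prems by (auto simp: els_def)
  have sm: "sml (set x)" "sml (els xs)" using U by (auto intro: small_finite simp: finite_els)
  have C'U: "C' \<subseteq> U" using Cons.prems(5) by (rule smallD)
  have "ind C' C (els xs)" by (rule ind_mono[OF Cons.prems(3) C'U]) auto
  then have "indseq C' xs" using Cons by auto
  have x: "ind (set x) C (els xs)" using Cons.prems by simp
  have "ind C' C (els xs \<union> set x)" using Cons.prems by (simp add: Un_commute)
  then have "ind C' (C \<union> els xs) (set x)" using C'U by (rule ind_mono) auto
  then have "ind (set x) (C \<union> els xs) C'" by (rule symmetry) (use sm C Cons.prems(5) in \<open>auto simp: small_Un_iff\<close>)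
  then have "ind (set x) C (els xs \<union> C')" by (rule ind_trans[OF x]) (use sm C Cons.prems(5) in auto)
  then have "ind (set x) C' (els xs)" using U(1) by (rule ind_mono) (use Cons.prems in auto)
  then show ?case using \<open>indseq C' xs\<close> by simp
qed simp

lemma indseq_subseq:
  assumes "indseq C (xs @ x # ys)" "\<forall>y\<in>set (xs @ x # ys). set y \<subseteq> U"
  shows "indseq C (xs @ ys)"
  using assms
proof (induction xs)
  case (Cons z xs)
  have "ind (set z) C (els (xs @ ys))"
    by (rule ind_mono[of "set z" C "els (xs @ x # ys)"]) (use Cons.prems in auto)
  then show ?case using Cons by auto
qed simp

lemma family_of_indseq:
  assumes "indseq C xs" "\<forall>x\<in>set xs. set x \<subseteq> U" "sml C" "i < length xs"
  shows "ind (set (xs ! i)) C (els (take i xs) \<union> els (drop (Suc i) xs))"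
proof -
  let ?l = "take i xs" and ?r = "drop (Suc i) xs" and ?x = "xs ! i"
  have eq: "xs = (?l @ [?x]) @ ?r" using assms(4) by (simp add: id_take_nth_drop[symmetric])
  have eq2: "xs = ?l @ (?x # ?r)" using assms(4) by (simp add: id_take_nth_drop[symmetric])
  have lU: "\<forall>x\<in>set (?l @ (?x # ?r)). set x \<subseteq> U" using assms(2) eq2 by metis
  have l: "ind (els ?l) C (els (?x # ?r))" "indseq C (?x # ?r)"
    using indseq_append[of C ?l "?x # ?r", OF _ lU assms(3)] assms(1) eq2 by metis+
  have U: "set ?x \<subseteq> U" "els ?l \<subseteq> U" "els ?r \<subseteq> U" using lU by (auto simp: els_def)
  have sm: "sml (set ?x)" "sml (els ?l)" "sml (els ?r)" using U by (auto intro: small_finite simp: finite_els)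
  have x: "ind (set ?x) C (els ?r)" using l(2) by simp
  have "ind (els ?l) (C \<union> els ?r) (set ?x)" by (rule ind_mono[OF l(1) U(2)]) auto
  then have "ind (set ?x) (C \<union> els ?r) (els ?l)" by (rule symmetry) (use sm assms(3) in \<open>auto simp: small_Un_iff\<close>)
  then have "ind (set ?x) C (els ?r \<union> els ?l)" using ind_trans[OF x] sm assms(3) by blast
  then show ?thesis by (simp add: Un_commute)
qed

section \<open>Morley sequences\<close>

lemma before_maximal:
  assumes "finite J" "J \<noteq> {}" "J \<subseteq> Field len"
  obtains m where "m \<in> J" "\<And>j. j \<in> J \<Longrightarrow> j \<noteq> m \<Longrightarrow> before j m"
proof -
  have "\<exists>m\<in>J. \<forall>j\<in>J. j \<noteq> m \<longrightarrow> before j m"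
    using assms
  proof (induction J rule: finite_ne_induct)
    case (insert x F)
    then obtain m where m: "m \<in> F" "\<forall>j\<in>F. j \<noteq> m \<longrightarrow> before j m" by auto
    consider "before x m" | "before m x" using before_total[of x m] m(1) insert by blast
    then show ?case
    proof cases
      case 1
      then show ?thesis using m by auto
    next
      case 2
      then have "before j x" if "j \<in> F" for j
        using that m(2) before_trans[of j m x] by (cases "j = m") auto
      then show ?thesis by auto
    qed
  qed simp
  then show ?thesis using that by blast
qed

lemma finite_cover:
  assumes "finite A" "A \<subseteq> (\<Union>j\<in>J. X j)"
  obtains F where "finite F" "F \<subseteq> J" "A \<subseteq> (\<Union>j\<in>F. X j)"
proof -
  from assms have "\<exists>F. finite F \<and> F \<subseteq> J \<and> A \<subseteq> (\<Union>j\<in>F. X j)"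
  proof (induction A)
    case empty
    then show ?case by (intro exI[of _ "{}"]) auto
  next
    case (insert a A)
    then obtain F where F: "finite F" "F \<subseteq> J" "A \<subseteq> (\<Union>j\<in>F. X j)" by auto
    obtain j where "j \<in> J" "a \<in> X j" using insert.prems by auto
    then show ?case using F by (intro exI[of _ "insert j F"]) auto
  qed
  then show ?thesis using that by blast
qed

lemma small_UN_tuples:
  assumes J: "J \<subseteq> Field len" and f: "\<And>i. i \<in> J \<Longrightarrow> set (f i) \<subseteq> U"
  shows "sml (\<Union>i\<in>J. set (f i))"
proof -
  have "|UNIV :: nat set| \<le>o |formulas M|" using infinite_formulas by (simp add: infinite_iff_card_of_nat)
  also have "|formulas M| \<le>o |Pow (formulas M)|" using card_of_Pow ordLess_imp_ordLeq by blast
  also note Pow_formulas_less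
  finally have nat: "|UNIV :: nat set| <o \<kappa>" .
  have "(\<Union>i\<in>J. set (f i)) \<subseteq> (\<lambda>(i, n). f i ! n) ` (Field len \<times> (UNIV :: nat set))"
    using J by (force simp: in_set_conv_nth)
  then have "|\<Union>i\<in>J. set (f i)| \<le>o |(\<lambda>(i, n). f i ! n) ` (Field len \<times> (UNIV :: nat set))|"
    by (rule card_of_mono1)
  moreover have "|(\<lambda>(i, n). f i ! n) ` (Field len \<times> (UNIV :: nat set))| <o \<kappa>"
    by (intro less_kappa_image less_kappa_Times len_less_kappa nat)
  ultimately have "|\<Union>i\<in>J. set (f i)| <o \<kappa>" by (rule ordLeq_ordLess_trans)
  then show ?thesis using f by (auto simp: small_def)
qed

lemma independent_conjugates:
  assumes d: "set d \<subseteq> U" and E: "sml E"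
  obtains f where "\<And>j. conjugate E d (f j)" "\<And>j. ind (set (f j)) E (\<Union>i\<in>{i. before i j}. set (f i))"
proof -
  let ?P = "\<lambda>f j r. conjugate E d r \<and> ind (set r) E (\<Union>i\<in>{i. before i j}. set (f i))"
  have "\<exists>f. \<forall>j. ?P f j (f j)"
  proof (rule dependent_wf_choice[OF wf_before])
    fix f g :: "('s, 'f, 'r) fm set \<Rightarrow> 'a list" and j r
    assume "\<And>z. (z, j) \<in> {(i, j). before i j} \<Longrightarrow> f z = g z"
    then have "(\<Union>i\<in>{i. before i j}. set (f i)) = (\<Union>i\<in>{i. before i j}. set (g i))" by auto
    then show "?P f j r = ?P g j r" by simp
  next
    fix j and f :: "('s, 'f, 'r) fm set \<Rightarrow> 'a list"
    assume "\<And>y. (y, j) \<in> {(i, j). before i j} \<Longrightarrow> ?P f y (f y)"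
    then have fU: "set (f i) \<subseteq> U" if "before i j" for i using that conjugate_set[OF _ d] by auto
    let ?B = "\<Union>i\<in>{i. before i j}. set (f i)"
    have B: "sml ?B" using fU before_Field by (intro small_UN_tuples) auto
    have "ind (set d) E {}" using E d by (rule existence) simp
    then obtain g where g: "aut (E \<union> {}) g" "ind (g ` set d) E ?B"
      using small_set[OF d] E small_finite[OF finite.emptyI] B by (rule extension) auto
    then have "conjugate E d (map g d)" by (auto simp: conjugate_def)
    then show "\<exists>r. ?P f j r" using g(2) by (intro exI[of _ "map g d"]) simp
  qed
  then show ?thesis using that by blast
qed

text \<open>A substitute for canonical bases: if \<open>d\<close> forks with \<open>e\<close> over \<open>B\<close>, then it forks with a
  \<open>B\<close>-independent sequence of its own conjugates over \<open>Be\<close>. In a \<open>Be\<close>-independent sequence of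
  conjugates \<open>f i\<close> of length \<open>|T|\<^sup>+\<close>, some \<open>f i\<close> is independent from \<open>e\<close> over \<open>B\<close> and the earlier
  terms. As \<open>f i\<close> forks with \<open>e\<close> over \<open>B\<close>, it must fork with the earlier terms.\<close>

lemma morley_dependence:
  assumes B: "sml B" and d: "set d \<subseteq> U" and e: "set e \<subseteq> U" and dep: "\<not> ind (set d) B (set e)"
  obtains ds where "\<And>x. x \<in> set ds \<Longrightarrow> conjugate (B \<union> set e) d x" "indseq B ds"
    "ind (els ds) (B \<union> set e) (set d)" "\<not> ind (set d) B (els ds)"
proof -
  let ?E = "B \<union> set e"
  have BU: "B \<subseteq> U" using B by (rule smallD)
  have E: "sml ?E" using B small_set[OF e] by (rule small_Un)
  have EU: "?E \<subseteq> U" using E by (rule smallD)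
  obtain f where f: "\<And>j. conjugate ?E d (f j)" "\<And>j. ind (set (f j)) ?E (\<Union>i\<in>{i. before i j}. set (f i))"
    by (rule independent_conjugates[OF d E]) blast
  have fU: "set (f j) \<subseteq> U" for j using conjugate_set[OF f(1) d] .
  have fs: "sml (set (f j))" for j using fU by (rule small_set)
  let ?X = "\<lambda>J. \<Union>j\<in>J. set (f j)"
  have Xs: "sml (?X J)" if "J \<subseteq> Field len" for J using that fU by (rule small_UN_tuples)
  have fdep: "\<not> ind (set (f j)) B (set e)" for j
    using dep ind_conjugate_iff[OF f(1) d EU] by blast
  obtain i where i: "i \<in> Field len" "thorn_indep \<kappa> M e (B \<union> ?X {j. before j i}) (B \<union> ?X (Field len))"
    by (rule chain_stabilizes[OF e B Xs[OF order_refl]])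
  have lowF: "{j. before j i} \<subseteq> Field len" using before_Field by blast
  let ?L = "?X {j. before j i}"
  have L: "sml ?L" by (rule Xs[OF lowF])
  have "thorn_indep \<kappa> M e (B \<union> ?L) (set (f i))"
    by (rule thorn_indep_mono[OF i(2) e order_refl]) (use i(1) in blast)
  then have ei: "ind (set e) (B \<union> ?L) (set (f i))"
    using ind_set_iff[OF e] smallD[OF L] BU fU by auto
  have "\<not> ind ?L B (set (f i))"
  proof
    assume "ind ?L B (set (f i))"
    then have "ind (?L \<union> set e) B (set (f i))"
      using ei L small_set[OF e] B fs by (rule left_transitivity)
    then have "ind (set e) B (set (f i))"
      by (rule ind_mono) (use smallD[OF L] e in auto)
    then have "ind (set (f i)) B (set e)" by (rule symmetry) (use small_set[OF e] B fs in \<open>auto simp: small_Un_iff\<close>)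
    then show False using fdep by blast
  qed
  then obtain l where l: "set l \<subseteq> ?L" "\<not> thorn_indep \<kappa> M l B (set (f i))" unfolding ind_def by blast
  obtain F where F: "finite F" "F \<subseteq> {j. before j i}" "set l \<subseteq> ?X F"
    by (rule finite_cover[OF finite_set l(1)])
  have "\<not> ind (?X F) B (set (f i))" using l(2) F(3) unfolding ind_def by blast
  moreover have FF: "F \<subseteq> Field len" "i \<notin> F" using F(2) lowF before_irrefl by auto
  ultimately have nFi: "\<not> ind (set (f i)) B (?X F)" using symmetry[of "set (f i)" B "?X F"] fs B Xs by blast
  \<comment> \<open>Among all finite sets \<open>G\<close> of indices and \<open>k \<notin> G\<close> such that \<open>f k\<close> forks with \<open>f ` G\<close> over \<open>B\<close>,
    one where \<open>G\<close> has least size: then the terms with index in \<open>G\<close> are independent over \<open>B\<close>.\<close>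
  define Q where "Q p \<longleftrightarrow> finite (fst p) \<and> fst p \<subseteq> Field len \<and> snd p \<in> Field len \<and> snd p \<notin> fst p \<and>
    \<not> ind (set (f (snd p))) B (?X (fst p))" for p
  have "Q (F, i)" unfolding Q_def using nFi F(1) FF i(1) by simp
  from ex_has_least_nat[of Q, OF this, of "\<lambda>p. card (fst p)"]
  obtain p where p: "Q p" and pmin: "\<And>q. Q q \<Longrightarrow> card (fst p) \<le> card (fst q)" by blast
  define G where "G = fst p"
  define k where "k = snd p"
  have G: "finite G" "G \<subseteq> Field len" "k \<in> Field len" "k \<notin> G" "\<not> ind (set (f k)) B (?X G)"
    using p by (auto simp: G_def k_def Q_def)
  have Gind: "ind (set (f j)) B (?X G')" if "j \<in> G" "G' \<subseteq> G - {j}" for j G'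
  proof (rule ccontr)
    assume neg: "\<not> ?thesis"
    have "finite G'" using that(2) G(1) by (meson finite_Diff finite_subset)
    then have "card G \<le> card G'"
      using pmin[of "(G', j)"] that G(2) neg \<open>finite G'\<close> by (auto simp: G_def Q_def)
    moreover have "card G' < card G" using that G(1) by (intro psubset_card_mono) auto
    ultimately show False by simp
  qed
  have Eind: "ind (set (f j)) ?E (?X (H - {j}))" if "finite H" "H \<subseteq> Field len" "j \<in> H" for H j
    using that
  proof (induction "card H" arbitrary: H j)
    case 0
    then show ?case by simp
  next
    case (Suc n)
    have "H \<noteq> {}" using Suc.prems by auto
    then obtain m where m: "m \<in> H" "\<And>j. j \<in> H \<Longrightarrow> j \<noteq> m \<Longrightarrow> before j m"
      by (rule before_maximal[OF Suc.prems(1) _ Suc.prems(2)]) blast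
    have max: "ind (set (f m)) ?E (?X (H - {m}))"
      by (rule ind_mono[OF f(2) fU order_refl order_refl]) (use m in blast)
    show ?case
    proof (cases "j = m")
      case True
      then show ?thesis using max by simp
    next
      case False
      let ?H = "H - {m}"
      have "n = card ?H" using Suc.hyps(2) m(1) Suc.prems(1) by simp
      then have IH: "ind (set (f j)) ?E (?X (?H - {j}))" using Suc.hyps(1)[of ?H j] Suc.prems False by auto
      have sm: "sml (?X (?H - {j}))" using Suc.prems(2) by (intro Xs) auto
      have "?X (H - {m}) = ?X (?H - {j}) \<union> set (f j)" using Suc.prems(3) False by auto
      then have "ind (set (f m)) ?E (?X (?H - {j}) \<union> set (f j))" using max by simp
      then have "ind (set (f m)) (?E \<union> ?X (?H - {j})) (set (f j))" using fU by (rule ind_mono) auto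
      then have "ind (set (f j)) (?E \<union> ?X (?H - {j})) (set (f m))" by (rule symmetry) (use fs E sm in \<open>auto simp: small_Un_iff\<close>)
      then have "ind (set (f j)) ?E (?X (?H - {j}) \<union> set (f m))" by (rule ind_trans[OF IH]) (use fs E sm in auto)
      moreover have "?X (?H - {j}) \<union> set (f m) = ?X (H - {j})" using m(1) False by auto
      ultimately show ?thesis by simp
    qed
  qed
  obtain js where js: "set js = G" "distinct js" using finite_distinct_list[OF G(1)] by blast
  have seq: "indseq B (map f js')" if "set js' \<subseteq> G" "distinct js'" for js'
    using that
  proof (induction js')
    case (Cons j js')
    have "ind (set (f j)) B (?X (set js'))" using Cons.prems by (intro Gind) auto
    then show ?case using Cons by (simp add: els_def)
  qed simp
  have elsX: "els (map f js) = ?X G" by (simp add: els_def js(1))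
  have "ind (set (f k)) ?E (?X (insert k G - {k}))" using G by (intro Eind) auto
  then have kE: "ind (set (f k)) ?E (els (map f js))" using G(4) elsX by simp
  have "conjugate ?E (f k) d" by (rule conjugate_sym[OF f(1) EU d])
  then obtain g where g: "aut ?E g" "d = map g (f k)" by (auto simp: conjugate_def)
  have ga: "automorphism M g" using g(1) by (rule aut_automorphism)
  have gd: "g ` set (f k) = set d" using g(2) by simp
  have gE: "g ` ?E = ?E" and gB: "g ` B = B" using aut_image[OF g(1)] by auto
  have jsU: "els (map f js) \<subseteq> U" using fU by (auto simp: els_def)
  have jss: "sml (els (map f js))" using jsU finite_els by (intro small_finite)
  let ?ds = "map (map g) (map f js)"
  have eds: "els ?ds = g ` els (map f js)" by (rule els_map)
  have eds_s: "sml (els ?ds)" unfolding eds by (rule small_image[OF ga jss])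
  show ?thesis
  proof (rule that)
    show "conjugate ?E d x" if x: "x \<in> set ?ds" for x
    proof -
      obtain j where "x = map g (f j)" using x by auto
      then have "conjugate ?E (f j) x" using g(1) by (auto simp: conjugate_def)
      then show ?thesis using f(1) conjugate_trans by blast
    qed
    show "indseq B ?ds"
      using seq[of js] js fU BU by (intro indseq_aut aut_mono[OF g(1)]) auto
    have "ind (g ` set (f k)) (g ` ?E) (g ` els (map f js))"
      by (rule ind_image[OF kE ga fU EU jsU])
    then have "ind (set d) ?E (els ?ds)" unfolding gd gE eds .
    then show "ind (els ?ds) ?E (set d)" by (rule symmetry) (use small_set[OF d] E eds_s in \<open>auto simp: small_Un_iff\<close>)
    show "\<not> ind (set d) B (els ?ds)"
      using ind_image_iff[OF ga fU[of k] BU jsU] G(5) unfolding gd gB eds elsX by blast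
  qed
qed

end

lemma acc_minimal:
  assumes "x \<in> Wellfounded.acc r" "Q x"
  obtains z where "Q z" "\<And>y. (y, z) \<in> r \<Longrightarrow> \<not> Q y"
proof -
  have "\<exists>z. Q z \<and> (\<forall>y. (y, z) \<in> r \<longrightarrow> \<not> Q y)"
    using assms
  proof (induction x rule: acc_induct_rule)
    case (1 x)
    then show ?case by blast
  qed
  then show ?thesis using that by blast
qed

context rosy_monster
begin

section \<open>Regular types and types of weight one\<close>

text \<open>Regularity and weight of the type of \<open>d\<close> over \<open>C\<close>, in terms of realizations. \<open>weight1 d C\<close> bounds
  the weight by one; it includes the case of weight zero.\<close>

definition regular :: "'a list \<Rightarrow> 'a set \<Rightarrow> bool" where
  "regular d C \<longleftrightarrow> (\<forall>B d1 d2. sml B \<longrightarrow> C \<subseteq> B \<longrightarrow> conjugate C d d1 \<longrightarrow> conjugate C d d2 \<longrightarrow>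
     \<not> ind (set d1) C B \<longrightarrow> ind (set d2) C B \<longrightarrow> ind (set d1) B (set d2))"

definition weight1 :: "'a list \<Rightarrow> 'a set \<Rightarrow> bool" where
  "weight1 d C \<longleftrightarrow> (\<forall>B e1 e2. sml B \<longrightarrow> C \<subseteq> B \<longrightarrow> set e1 \<subseteq> U \<longrightarrow> set e2 \<subseteq> U \<longrightarrow>
     ind (set d) C B \<longrightarrow> ind (set e1) B (set e2) \<longrightarrow> \<not> ind (set d) B (set e1) \<longrightarrow> ind (set d) B (set e2))"

lemma ind_trans':
  assumes "ind A C B" "ind A B D" "C \<subseteq> B" "sml A" "sml B" "sml D"
  shows "ind A C (B \<union> D)"
proof -
  have C: "sml C" by (rule small_subset[OF assms(5,3)])
  have "C \<union> B = B" using assms(3) by blast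
  then show ?thesis using ind_trans[OF assms(1), of D] assms(2,4-6) C by simp
qed

lemma regular_extension:
  assumes reg: "regular d C" and nf: "ind (set d) C B" and CB: "C \<subseteq> B" and B: "sml B" and d: "set d \<subseteq> U"
  shows "regular d B"
  unfolding regular_def
proof (intro allI impI)
  fix B' d1 d2
  assume B': "sml B'" "B \<subseteq> B'" and c: "conjugate B d d1" "conjugate B d d2"
    and f: "\<not> ind (set d1) B B'" and n: "ind (set d2) B B'"
  have BU: "B \<subseteq> U" and dU: "set d1 \<subseteq> U" "set d2 \<subseteq> U"
    using smallD[OF B] conjugate_set[OF c(1) d] conjugate_set[OF c(2) d] by auto
  have "C \<union> B = B" using CB by blast
  then have "ind (set d2) C B" using ind_conjugate[OF nf _ d] c(2) BU by simp
  then have "ind (set d2) C (B \<union> B')"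
    using n CB small_set[OF dU(2)] B B'(1) by (rule ind_trans')
  then have "ind (set d2) C B'" using dU(2) by (rule ind_mono) auto
  moreover have "\<not> ind (set d1) C B'"
  proof
    assume "ind (set d1) C B'"
    then have "ind (set d1) B B'" using dU(1) by (rule ind_mono) (use CB B' in auto)
    then show False using f by blast
  qed
  ultimately show "ind (set d1) B' (set d2)"
    using reg B' CB conjugate_mono[OF c(1) CB] conjugate_mono[OF c(2) CB] unfolding regular_def by (meson order_trans)
qed

lemma weight1_extension:
  assumes w: "weight1 d C" and nf: "ind (set d) C B" and CB: "C \<subseteq> B" and B: "sml B" and d: "set d \<subseteq> U"
  shows "weight1 d B"
  unfolding weight1_def
proof (intro allI impI)
  fix B' e1 e2
  assume *: "sml B'" "B \<subseteq> B'" "set e1 \<subseteq> U" "set e2 \<subseteq> U" "ind (set d) B B'"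
    "ind (set e1) B' (set e2)" "\<not> ind (set d) B' (set e1)"
  have "ind (set d) C (B \<union> B')" using nf *(5) CB small_set[OF d] B *(1) by (rule ind_trans')
  then have "ind (set d) C B'" using d by (rule ind_mono) auto
  then show "ind (set d) B' (set e2)" using w * CB unfolding weight1_def by (meson order_trans)
qed

lemma weight1D:
  assumes "weight1 d C" "sml C" "set d \<subseteq> U" "set e1 \<subseteq> U" "set e2 \<subseteq> U"
    "ind (set e1) C (set e2)" "\<not> ind (set d) C (set e1)"
  shows "ind (set d) C (set e2)"
proof -
  have "ind (set d) C C" using assms(2,3) by (rule existence) simp
  then show ?thesis using assms unfolding weight1_def by (meson order_refl)
qed

text \<open>Suppose that \<open>d\<close> forks with \<open>e1\<close> and with \<open>e2\<close>, which are independent over \<open>B\<close>. By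
  \<open>morley_dependence\<close> the tuple \<open>e2\<close> can be replaced by an independent sequence \<open>ys\<close> of realizations
  of the same regular type, with which \<open>d\<close> forks. Over \<open>B\<close>, \<open>e1\<close> and part of the sequence, any further
  member realizes a non-forking extension of that type but \<open>d\<close> a forking one. So \<open>d\<close> is
  independent from \<open>ys\<close> over \<open>B e1\<close>, and as \<open>ys\<close> is independent from \<open>e1\<close>, also over \<open>B\<close>.\<close>

lemma regular_weight1:
  assumes reg: "regular d C" and C: "sml C" and d: "set d \<subseteq> U"
  shows "weight1 d C"
  unfolding weight1_def
proof (intro allI impI, rule ccontr)
  fix B e1 e2
  assume B: "sml B" "C \<subseteq> B" and e: "set e1 \<subseteq> U" "set e2 \<subseteq> U" and nf: "ind (set d) C B"
    and e12: "ind (set e1) B (set e2)" and f1: "\<not> ind (set d) B (set e1)" and f2: "\<not> ind (set d) B (set e2)"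
  have BU: "B \<subseteq> U" using B(1) by (rule smallD)
  have ds: "sml (set d)" and es: "sml (set e1)" "sml (set e2)" using d e by (auto intro: small_set)
  obtain xs where xs: "\<And>x. x \<in> set xs \<Longrightarrow> conjugate (B \<union> set e2) d x" "indseq B xs"
    "ind (els xs) (B \<union> set e2) (set d)" "\<not> ind (set d) B (els xs)"
    by (rule morley_dependence[OF B(1) d e(2) f2]) blast
  have xU: "\<forall>x\<in>set xs. set x \<subseteq> U" using conjugate_set[OF xs(1) d] by blast
  have xs_s: "sml (els xs)" using xU by (rule small_els)
  have xsU: "els xs \<subseteq> U" using xs_s by (rule smallD)
  let ?E = "B \<union> set e2"
  have E: "sml ?E" using B(1) es(2) by (rule small_Un)
  have Ed: "sml (?E \<union> set d)" using E ds by (rule small_Un)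
  have "ind (els xs) (?E \<union> set d) {}" using Ed xsU by (rule existence) simp
  then obtain g where g: "aut ((?E \<union> set d) \<union> {}) g" "ind (g ` els xs) (?E \<union> set d) (set e1)"
    using xs_s Ed small_finite[OF finite.emptyI] es(1) by (rule extension) auto
  have gE: "aut ?E g" using g(1) by (rule aut_mono) auto
  have ga: "automorphism M g" using gE by (rule aut_automorphism)
  define ys where "ys = map (map g) xs"
  have ys_els: "els ys = g ` els xs" by (simp add: ys_def els_map)
  have gfix: "g ` ?E = ?E" "g ` set d = set d" "g ` B = B" using aut_image[OF g(1)] by auto
  have ys: "\<And>x. x \<in> set ys \<Longrightarrow> conjugate ?E d x"
  proof -
    fix x assume "x \<in> set ys"
    then obtain x' where x': "x' \<in> set xs" "x = map g x'" by (auto simp: ys_def)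
    have "conjugate ?E x' x" using gE x'(2) by (auto simp: conjugate_def)
    then show "conjugate ?E d x" using xs(1)[OF x'(1)] conjugate_trans by blast
  qed
  have ysU: "\<forall>x\<in>set ys. set x \<subseteq> U" using conjugate_set[OF ys d] by blast
  have ys_s: "sml (els ys)" using ysU by (rule small_els)
  have seq: "indseq B ys" unfolding ys_def using xs(2) aut_mono[OF gE] xU BU by (intro indseq_aut) auto
  have "ind (g ` els xs) (g ` ?E) (g ` set d)" using xs(3) ga xsU smallD[OF E] d by (rule ind_image)
  then have ysd: "ind (els ys) ?E (set d)" unfolding ys_els gfix .
  have ysdep: "\<not> ind (set d) B (els ys)"
    using ind_image_iff[OF ga d BU xsU] xs(4) unfolding gfix ys_els by blast
  \<comment> \<open>The sequence was moved so as to be independent from \<open>e1\<close> over \<open>B e2 d\<close>; with the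
    independence of \<open>e1\<close> and \<open>e2\<close> this makes it independent from \<open>e1\<close> over \<open>B\<close>.\<close>
  have "ind (els ys) (?E \<union> set d) (set e1)" using g(2) ys_els by simp
  then have "ind (els ys) ?E (set d \<union> set e1)" by (rule ind_trans[OF ysd]) (use ys_s E ds es in auto)
  then have "ind (els ys) ?E (set e1)" using smallD[OF ys_s] by (rule ind_mono) auto
  moreover have "ind (set e2) B (set e1)" by (rule symmetry[OF e12]) (use es B in auto)
  ultimately have "ind (set e2 \<union> els ys) B (set e1)" using es ys_s B(1) left_transitivity by blast
  then have ys_e1: "ind (els ys) B (set e1)" by (rule ind_mono) (use e smallD[OF ys_s] in auto)
  have Be: "sml (B \<union> set e1)" using B(1) es(1) by (rule small_Un)
  have "ind (set d) (B \<union> set e1) (els zs)" if "set zs \<subseteq> set ys" "indseq B zs" for zs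
    using that
  proof (induction zs)
    case Nil
    then show ?case using Be d by (auto intro: existence)
  next
    case (Cons z zs)
    have IH: "ind (set d) (B \<union> set e1) (els zs)" using Cons by auto
    have zU: "set z \<subseteq> U" "\<forall>x\<in>set zs. set x \<subseteq> U" using Cons.prems(1) ysU by auto
    have zs_s: "sml (set z)" "sml (els zs)" using small_set[OF zU(1)] small_els[OF zU(2)] by auto
    have zE: "conjugate ?E d z" using Cons.prems(1) by (intro ys) auto
    have zC: "conjugate C d z" using zE by (rule conjugate_mono) (use B in auto)
    let ?B = "B \<union> set e1 \<union> els zs"
    have B': "sml ?B" using Be zs_s(2) by (rule small_Un)
    have zz: "ind (set z) B (els zs)" using Cons.prems(2) by simp
    have "els (z # zs) \<subseteq> els ys" using Cons.prems(1) by (rule els_mono)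
    then have sub: "els zs \<union> set z \<subseteq> els ys" by auto
    have "ind (els zs \<union> set z) B (set e1)" by (rule ind_mono[OF ys_e1 smallD[OF ys_s] sub]) auto
    then have "ind (set z) (B \<union> els zs) (set e1)" by (rule ind_base_left) (use zs_s B es in \<open>auto simp: small_Un_iff\<close>)
    then have "ind (set z) B (els zs \<union> set e1)" by (rule ind_trans[OF zz]) (use zs_s B es in auto)
    moreover have zB: "ind (set z) C B"
    proof -
      have "C \<union> B = B" using B(2) by blast
      then show ?thesis using ind_conjugate[OF nf _ d] conjugate_mono[OF zE, of B] BU by simp
    qed
    ultimately have "ind (set z) C (B \<union> (els zs \<union> set e1))"
      using ind_trans'[OF zB _ B(2) zs_s(1) B(1) small_Un[OF zs_s(2) es(1)]] by blast
    then have nfz: "ind (set z) C ?B" using zU(1) by (rule ind_mono) auto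
    have fd: "\<not> ind (set d) C ?B"
    proof
      assume "ind (set d) C ?B"
      then have "ind (set d) B (set e1)" using d by (rule ind_mono) (use B in auto)
      then show False using f1 by blast
    qed
    have "ind (set d) ?B (set z)"
      using reg B' B(2) conjugate_refl zC fd nfz unfolding regular_def by blast
    then have "ind (set d) (B \<union> set e1) (els zs \<union> set z)" by (rule ind_trans[OF IH]) (use ds Be zs_s in auto)
    then show ?case by (simp add: Un_commute)
  qed
  then have dB: "ind (set d) (B \<union> set e1) (els ys)" using seq by blast
  have "ind (set e1 \<union> set d) B (els ys)"
    by (rule left_transitivity[OF symmetry[OF ys_e1] dB]) (use ys_s B ds es in auto)
  then have "ind (set d) B (els ys)" by (rule ind_mono) (use e d in auto)
  then show False using ysdep by blast
qed

lemma indseq_Un: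
  assumes "indseq C xs" "ind A C (els xs)" "\<forall>x\<in>set xs. set x \<subseteq> U" "sml C" "sml A"
  shows "indseq (C \<union> A) xs"
proof (rule indseq_base[OF assms(1)])
  show "ind (C \<union> A) C (els xs)"
    by (rule ind_base_left[OF assms(2)]) (use assms small_els in auto)
qed (use assms in \<open>auto intro: small_Un\<close>)

text \<open>As long as \<open>b\<close> is independent from the members of the sequence, pass to the base over them. If \<open>b\<close>
  forks with the next member, then it is independent from the rest because its weight is one.\<close>

lemma weight1_drop:
  assumes "weight1 b C" "sml C" "set b \<subseteq> U" "indseq C ds" "\<forall>x\<in>set ds. set x \<subseteq> U"
  shows "ind (set b) C (els ds) \<or> (\<exists>xs x ys. ds = xs @ x # ys \<and> ind (set b) C (els (xs @ ys)))"
  using assms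
proof (induction ds arbitrary: C)
  case Nil
  then show ?case by (auto intro: existence)
next
  case (Cons d ds)
  have U: "set d \<subseteq> U" "\<forall>x\<in>set ds. set x \<subseteq> U" using Cons.prems by auto
  have sm: "sml (set d)" "sml (els ds)" "sml (set b)" using U Cons.prems small_els by (auto intro: small_set)
  have dd: "ind (set d) C (els ds)" and ds: "indseq C ds" using Cons.prems by auto
  show ?case
  proof (cases "ind (set b) C (set d)")
    case True
    let ?C = "C \<union> set d"
    have C': "sml ?C" using Cons.prems(2) sm(1) by (rule small_Un)
    have "indseq ?C ds" using ds dd U(2) Cons.prems(2) sm(1) by (rule indseq_Un)
    moreover have "ind (set b) C ?C" using True Cons.prems(3) by (rule ind_mono) auto
    then have "weight1 b ?C" by (rule weight1_extension[OF Cons.prems(1) _ Un_upper1 C' Cons.prems(3)])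
    ultimately have "ind (set b) ?C (els ds) \<or> (\<exists>xs x ys. ds = xs @ x # ys \<and> ind (set b) ?C (els (xs @ ys)))"
      using Cons.IH[of ?C] C' Cons.prems(3) U(2) by blast
    then show ?thesis
    proof
      assume "ind (set b) ?C (els ds)"
      then have "ind (set b) C (set d \<union> els ds)" by (rule ind_trans[OF True]) (use sm Cons.prems in auto)
      then show ?thesis by simp
    next
      assume "\<exists>xs x ys. ds = xs @ x # ys \<and> ind (set b) ?C (els (xs @ ys))"
      then obtain xs x ys where x: "ds = xs @ x # ys" "ind (set b) ?C (els (xs @ ys))" by blast
      have "sml (els (xs @ ys))" using U(2) x(1) by (intro small_els) auto
      then have "ind (set b) C (set d \<union> els (xs @ ys))" by (intro ind_trans[OF True x(2)]) (use sm Cons.prems in auto)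
      then have "ind (set b) C (els ((d # xs) @ ys))" by simp
      then show ?thesis using x(1) by (metis append_Cons)
    qed
  next
    case False
    have "ind (set d) C (set (concat ds))" using dd by (simp only: set_concat_els)
    then have "ind (set b) C (set (concat ds))"
      using weight1D[OF Cons.prems(1-3) U(1) _ _ False, of "concat ds"] smallD[OF sm(2)] by (simp only: set_concat_els)
    then have "ind (set b) C (els ([] @ ds))" by (simp only: set_concat_els append_Nil)
    then show ?thesis by (metis append_Nil)
  qed
qed

text \<open>Additivity of weight for independent tuples of weight one, by induction on their number: by
  \<open>weight1_drop\<close> the first tuple \<open>b\<close> costs at most one member of \<open>ds\<close>, and the others still fork with
  the remaining tuples over \<open>Cb\<close>.\<close>

lemma weight_le_length:
  assumes "indseq C bs" "\<forall>b\<in>set bs. set b \<subseteq> U \<and> weight1 b C" "sml C"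
    "indseq C ds" "\<forall>d\<in>set ds. set d \<subseteq> U \<and> \<not> ind (set d) C (els bs)"
  shows "length ds \<le> length bs"
  using assms
proof (induction bs arbitrary: C ds)
  case Nil
  have "ds = []"
  proof (rule ccontr)
    assume "ds \<noteq> []"
    then obtain d where "d \<in> set ds" by fastforce
    then show False using Nil existence[OF Nil.prems(3), of "set d" "{}"] by auto
  qed
  then show ?case by simp
next
  case (Cons b bs)
  have b: "set b \<subseteq> U" "weight1 b C" and bsU: "\<forall>x\<in>set bs. set x \<subseteq> U" using Cons.prems(2) by auto
  have dsU: "\<forall>x\<in>set ds. set x \<subseteq> U" using Cons.prems(5) by auto
  have sm: "sml (set b)" "sml (els bs)" using small_set[OF b(1)] small_els[OF bsU] by auto
  obtain ds' where ds': "length ds \<le> Suc (length ds')" "set ds' \<subseteq> set ds" "indseq C ds'" "ind (set b) C (els ds')"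
  proof -
    from weight1_drop[OF b(2) Cons.prems(3) b(1) Cons.prems(4) dsU]
    show ?thesis
    proof
      assume "ind (set b) C (els ds)"
      then show ?thesis using that[of ds] Cons.prems(4) by auto
    next
      assume "\<exists>xs x ys. ds = xs @ x # ys \<and> ind (set b) C (els (xs @ ys))"
      then obtain xs x ys where x: "ds = xs @ x # ys" "ind (set b) C (els (xs @ ys))" by blast
      have "indseq C (xs @ ys)" using Cons.prems(4) dsU unfolding x(1) by (rule indseq_subseq)
      then show ?thesis using that[of "xs @ ys"] x by auto
    qed
  qed
  have ds'U: "\<forall>x\<in>set ds'. set x \<subseteq> U" using dsU ds'(2) by auto
  let ?C = "C \<union> set b"
  have C': "sml ?C" using Cons.prems(3) sm(1) by (rule small_Un)
  have bb: "ind (set b) C (els bs)" "indseq C bs" using Cons.prems(1) by auto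
  have "indseq ?C bs" using bb(2,1) bsU Cons.prems(3) sm(1) by (rule indseq_Un)
  moreover have "\<forall>x\<in>set bs. set x \<subseteq> U \<and> weight1 x ?C"
  proof
    fix x assume x: "x \<in> set bs"
    then have xU: "set x \<subseteq> U" using bsU by blast
    have "ind (set b) C (set x)" using bb(1) b(1) by (rule ind_mono) (use els_member[OF x] in auto)
    then have "ind (set x) C (set b)" by (rule symmetry) (use sm Cons.prems(3) small_set[OF xU] in auto)
    then have "ind (set x) C ?C" using xU by (rule ind_mono) auto
    then show "set x \<subseteq> U \<and> weight1 x ?C"
      using weight1_extension[of x C ?C] Cons.prems(2) x xU C' by auto
  qed
  moreover have "indseq ?C ds'" using ds'(3,4) ds'U Cons.prems(3) sm(1) by (rule indseq_Un)
  moreover have "\<forall>d\<in>set ds'. set d \<subseteq> U \<and> \<not> ind (set d) ?C (els bs)"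
  proof (intro ballI conjI notI)
    fix d assume d: "d \<in> set ds'"
    show dU: "set d \<subseteq> U" using d ds'U by blast
    assume *: "ind (set d) ?C (els bs)"
    have "ind (set b) C (set d)" using ds'(4) b(1) by (rule ind_mono) (use els_member[OF d] in auto)
    then have "ind (set d) C (set b)" by (rule symmetry) (use sm Cons.prems(3) small_set[OF dU] in auto)
    then have "ind (set d) C (set b \<union> els bs)" using * by (rule ind_trans) (use sm Cons.prems(3) small_set[OF dU] in auto)
    then show False using Cons.prems(5) d ds'(2) by auto
  qed
  ultimately have "length ds' \<le> length bs" using Cons.IH[of ?C ds'] C' by blast
  then show ?case using ds'(1) by simp
qed

section \<open>The existence of regular types\<close>

text \<open>The forking extensions of the type of \<open>d\<close> over \<open>C\<close>, with a realization of each.\<close>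

definition below :: "(('a set \<times> 'a list) \<times> ('a set \<times> 'a list)) set" where
  "below = {((B, d1), (C, d)). sml B \<and> C \<subseteq> B \<and> conjugate C d d1 \<and> \<not> ind (set d1) C B}"

lemma belowI: "sml B \<Longrightarrow> C \<subseteq> B \<Longrightarrow> conjugate C d d1 \<Longrightarrow> \<not> ind (set d1) C B \<Longrightarrow> ((B, d1), (C, d)) \<in> below"
  by (simp add: below_def)

text \<open>A pair \<open>(C', d')\<close> as required that is minimal for forking extension has a regular type. Otherwise
  there are \<open>B\<close> and conjugates \<open>d1\<close> and \<open>d'\<close> such that \<open>d1\<close> realizes a forking extension over \<open>B\<close>,
  \<open>d'\<close> a non-forking one, and \<open>d1\<close> forks with \<open>d'\<close> over \<open>B\<close>. Then \<open>(B, d1)\<close> and \<open>(B d1, d')\<close> are both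
  below \<open>(C', d')\<close>. By minimality \<open>d1\<close> is independent from \<open>a\<close> over \<open>B\<close>, and then \<open>d'\<close> is independent
  from \<open>a\<close> over \<open>B d1\<close>. So \<open>d'\<close> is independent from \<open>a\<close> over \<open>B\<close>, and hence over \<open>C'\<close>.

  The set \<open>G\<close> is carried along for the decomposition theorem, where the new regular tuple has to be
  independent from those already found.\<close>

lemma regular_exists:
  assumes acc: "(C, d) \<in> Wellfounded.acc below" and C: "sml C" and d: "set d \<subseteq> U" and a: "set a \<subseteq> U"
    and G: "sml G" and da: "\<not> ind (set d) C (set a)" and dG: "ind (set d) C G"
  obtains C' d' where "sml C'" "C \<subseteq> C'" "set d' \<subseteq> U" "ind (set a) C C'"
    "\<not> ind (set d') C' (set a)" "ind (set d') C' G" "regular d' C'"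
proof -
  define Q where "Q p \<longleftrightarrow> sml (fst p) \<and> C \<subseteq> fst p \<and> set (snd p) \<subseteq> U \<and> ind (set a) C (fst p) \<and>
    \<not> ind (set (snd p)) (fst p) (set a) \<and> ind (set (snd p)) (fst p) G" for p
  have "ind (set a) C C" using C a by (rule existence) simp
  then have "Q (C, d)" using C d da dG by (simp add: Q_def)
  from acc this obtain p where Qp: "Q p" and min: "\<And>q. (q, p) \<in> below \<Longrightarrow> \<not> Q q"
    by (rule acc_minimal) blast
  obtain C' d' where p: "p = (C', d')" by force
  have q: "sml C'" "C \<subseteq> C'" "set d' \<subseteq> U" "ind (set a) C C'" "\<not> ind (set d') C' (set a)" "ind (set d') C' G"
    using Qp by (auto simp: Q_def p)
  have C'U: "C' \<subseteq> U" using q(1) by (rule smallD)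
  have ds: "sml (set d')" and as: "sml (set a)" using q(3) a by (auto intro: small_set)
  have GU: "G \<subseteq> U" using G by (rule smallD)
  have "regular d' C'"
    unfolding regular_def
  proof (intro allI impI, rule ccontr)
    fix B0 d10 d2
    assume B0: "sml B0" "C' \<subseteq> B0" and c0: "conjugate C' d' d10" "conjugate C' d' d2"
      and f0: "\<not> ind (set d10) C' B0" and n0: "ind (set d2) C' B0" and neg0: "\<not> ind (set d10) B0 (set d2)"
    have d2U: "set d2 \<subseteq> U" and d10U: "set d10 \<subseteq> U" using conjugate_set[OF _ q(3)] c0 by auto
    have B0U: "B0 \<subseteq> U" using B0(1) by (rule smallD)
    \<comment> \<open>Moving everything by an automorphism, \<open>d2\<close> becomes \<open>d'\<close>, and \<open>B\<close> and \<open>d1\<close> become independent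
      from \<open>a\<close> and \<open>G\<close> over \<open>C' d'\<close>.\<close>
    have "conjugate C' d2 d'" using conjugate_sym[OF c0(2) C'U q(3)] .
    then obtain g1 where g1: "aut C' g1" "d' = map g1 d2" by (auto simp: conjugate_def)
    have g1a: "automorphism M g1" using g1(1) by (rule aut_automorphism)
    let ?E = "g1 ` (B0 \<union> set d10)"
    have E: "sml ?E" using small_image[OF g1a small_Un[OF B0(1) small_set[OF d10U]]] .
    have Cd: "sml (C' \<union> set d')" using q(1) ds by (rule small_Un)
    have aG: "sml (set a \<union> G)" using as G by (rule small_Un)
    have "ind ?E (C' \<union> set d') {}" using Cd smallD[OF E] by (rule existence) simp
    then obtain g2 where g2: "aut ((C' \<union> set d') \<union> {}) g2" "ind (g2 ` ?E) (C' \<union> set d') (set a \<union> G)"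
      using E Cd small_finite[OF finite.emptyI] aG by (rule extension) auto
    define g where "g = g2 \<circ> g1"
    have gC: "aut C' g" unfolding g_def using g1(1) aut_mono[OF g2(1)] by (intro aut_comp) auto
    have ga: "automorphism M g" using gC by (rule aut_automorphism)
    have gd2: "map g d2 = d'"
    proof -
      have "map g2 d' = d'" by (rule aut_map[OF g2(1)]) auto
      then show ?thesis using g1(2) by (simp add: g_def)
    qed
    define B where "B = g ` B0"
    define d1 where "d1 = map g d10"
    have B: "sml B" unfolding B_def by (rule small_image[OF ga B0(1)])
    have BU: "B \<subseteq> U" using B by (rule smallD)
    have gC': "g ` C' = C'" by (rule aut_image[OF gC]) simp
    have CB: "C' \<subseteq> B" using B0(2) gC' unfolding B_def by blast
    have d1U: "set d1 \<subseteq> U" unfolding d1_def by (rule automorphism_set[OF ga d10U])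
    have d1s: "sml (set d1)" using d1U by (rule small_set)
    have c1: "conjugate C' d' d1"
      using c0(1) gC conjugate_trans unfolding d1_def conjugate_def by (metis list.map_comp aut_comp)
    have gd1: "g ` set d10 = set d1" by (simp add: d1_def)
    have gd': "g ` set d2 = set d'" using gd2 by (metis set_map)
    have f: "\<not> ind (set d1) C' B"
      using ind_image_iff[OF ga d10U C'U B0U] f0 unfolding gd1 gC' B_def by blast
    have neg: "\<not> ind (set d1) B (set d')"
      using ind_image_iff[OF ga d10U B0U d2U] neg0 unfolding gd1 gd' B_def by blast
    have n: "ind (set d') C' B"
      using ind_image_iff[OF ga d2U C'U B0U] n0 unfolding gd' gC' B_def by blast
    have "g2 ` ?E = B \<union> set d1" unfolding B_def d1_def g_def by auto
    then have free: "ind (B \<union> set d1) (C' \<union> set d') (set a \<union> G)" using g2(2) by simp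
    have "ind B C' (set d')" by (rule symmetry[OF n]) (use ds q B in auto)
    moreover have "ind B (C' \<union> set d') (set a \<union> G)" using free by (rule ind_mono) (use BU d1U in auto)
    ultimately have BC: "ind B C' (set d' \<union> (set a \<union> G))" using B q(1) ds aG by (rule ind_trans)
    have "ind B C' (set a)" using BC BU by (rule ind_mono) auto
    then have "ind (set a) C' B" by (rule symmetry) (use B q as in auto)
    then have "ind (set a) C (C' \<union> B)" using ind_trans'[OF q(4) _ q(2) as q(1) B] by blast
    then have aB: "ind (set a) C B" using a by (rule ind_mono) auto
    have nda: "\<not> ind (set d') B (set a)"
    proof
      assume "ind (set d') B (set a)"
      then have "ind (set d') C' (B \<union> set a)" using ind_trans'[OF n _ CB ds B as] by blast
      then have "ind (set d') C' (set a)" using q(3) by (rule ind_mono) auto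
      then show False using q(5) by blast
    qed
    have "ind B (C' \<union> G) (set d')" using BC BU by (rule ind_mono) auto
    then have "ind (set d') (C' \<union> G) B" by (rule symmetry) (use B q ds G small_Un in auto)
    then have "ind (set d') C' (G \<union> B)" by (rule ind_trans[OF q(6)]) (use B q ds G in auto)
    then have dBG: "ind (set d') B G" using q(3) by (rule ind_mono) (use CB in auto)
    have Bd: "sml (B \<union> set d')" using B ds by (rule small_Un)
    have "ind (set d1) (B \<union> set d') (set a \<union> G)"
      by (rule ind_base_left[OF free]) (use CB B d1s q(1) ds aG in \<open>auto simp: small_Un_iff\<close>)
    then have "ind (set d1) (B \<union> set d') G" using d1U by (rule ind_mono) auto
    with dBG have ddG: "ind (set d' \<union> set d1) B G" using ds d1s B G by (rule left_transitivity)
    have d1G: "ind (set d1) B G" by (rule ind_mono[OF ddG]) (use q(3) d1U in auto)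
    have "\<not> Q (B, d1)" using min[of "(B, d1)"] belowI[OF B CB c1 f] unfolding p by blast
    then have d1a: "ind (set d1) B (set a)" using B CB q(2) d1U aB d1G by (auto simp: Q_def)
    have Bd1: "sml (B \<union> set d1)" using B d1s by (rule small_Un)
    have "ind (set a) B (set d1)" by (rule symmetry[OF d1a]) (use B d1s as in auto)
    then have aBd: "ind (set a) C (B \<union> set d1)"
      using ind_trans'[OF aB _ _ as B d1s] CB q(2) by blast
    have "\<not> ind (set d') C' (B \<union> set d1)"
    proof
      assume "ind (set d') C' (B \<union> set d1)"
      then have "ind (set d') B (set d1)" using q(3) by (rule ind_mono) (use CB in auto)
      then have "ind (set d1) B (set d')" by (rule symmetry) (use B ds d1s in auto)
      then show False using neg by blast
    qed
    then have "((B \<union> set d1, d'), (C', d')) \<in> below"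
      using Bd1 CB conjugate_refl by (intro belowI) auto
    then have "\<not> Q (B \<union> set d1, d')" using min unfolding p by blast
    moreover have "ind (set d') (B \<union> set d1) G"
      by (rule ind_base_left[OF ddG]) (use B ds d1s G in \<open>auto simp: small_Un_iff\<close>)
    ultimately have "ind (set d') (B \<union> set d1) (set a)"
      using Bd1 CB q(2,3) aBd by (auto simp: Q_def)
    with d1a have "ind (set d1 \<union> set d') B (set a)" using d1s ds B as by (rule left_transitivity)
    then have "ind (set d') B (set a)" by (rule ind_mono) (use q(3) d1U in auto)
    then show False using nda by blast
  qed
  then show ?thesis using that q by blast
qed

end

context rosy_monster
begin

section \<open>Finite weight\<close>

text \<open>A family \<open>bs\<close> witnessing that \<open>a\<close> has weight at least \<open>length bs\<close>, over the base \<open>B\<close>.\<close>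

definition weighs :: "'a list \<Rightarrow> 'a set \<Rightarrow> 'a list list \<Rightarrow> bool" where
  "weighs a B bs \<longleftrightarrow> indseq B bs \<and> (\<forall>b\<in>set bs. set b \<subseteq> U \<and> \<not> ind (set a) B (set b))"

definition weight_ge :: "'a list \<Rightarrow> 'a set \<Rightarrow> nat \<Rightarrow> bool" where
  "weight_ge a C n \<longleftrightarrow> (\<exists>B bs. sml B \<and> C \<subseteq> B \<and> ind (set a) C B \<and> length bs = n \<and> weighs a B bs)"

lemma weighsD:
  assumes "weighs a B bs"
  shows "indseq B bs" "b \<in> set bs \<Longrightarrow> set b \<subseteq> U" "b \<in> set bs \<Longrightarrow> \<not> ind (set a) B (set b)"
  using assms by (auto simp: weighs_def)

lemma weighs_image:
  assumes w: "weighs a B bs" and g: "automorphism M g" and a: "set a \<subseteq> U" and B: "B \<subseteq> U"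
  shows "weighs (map g a) (g ` B) (map (map g) bs)"
  unfolding weighs_def
proof (intro conjI ballI)
  show "indseq (g ` B) (map (map g) bs)" using weighsD(1,2)[OF w] g B by (intro indseq_image) auto
  fix b assume "b \<in> set (map (map g) bs)"
  then obtain c where c: "c \<in> set bs" "b = map g c" by auto
  have cU: "set c \<subseteq> U" by (rule weighsD(2)[OF w c(1)])
  show "set b \<subseteq> U" unfolding c(2) by (rule automorphism_set[OF g cU])
  show "\<not> ind (set (map g a)) (g ` B) (set b)"
    using ind_image_iff[OF g a B cU] weighsD(3)[OF w c(1)] by (simp add: c(2))
qed

text \<open>Any \<open>E\<close> is independent from \<open>a\<close> over \<open>Ca\<close>, so transitivity on the left applies.\<close>

lemma self_independent_trivial:
  assumes aa: "ind (set a) C (set a)" and C: "sml C" and a: "set a \<subseteq> U" and E: "sml E"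
  shows "ind (set a) C E"
proof -
  have as: "sml (set a)" using a by (rule small_set)
  have "ind E (C \<union> set a) (set a)"
    using small_Un[OF C as] smallD[OF E] by (rule existence) simp
  with aa have "ind (set a \<union> E) C (set a)" using as E C as by (rule left_transitivity)
  then have "ind E C (set a)" by (rule ind_mono) (use a smallD[OF E] in auto)
  then show ?thesis by (rule symmetry) (use E C as in auto)
qed

lemma indseq_take_drop:
  assumes "indseq C xs" "\<forall>x\<in>set xs. set x \<subseteq> U" "sml C"
  shows "indseq C (take k xs)" "indseq C (drop k xs)" "ind (els (take k xs)) C (els (drop k xs))"
  using indseq_append[of C "take k xs" "drop k xs"] assms by simp_all

text \<open>By induction on forking extensions. If \<open>a\<close> had infinite weight over \<open>C\<close>, it would fork with itself,
  so \<open>regular_exists\<close> gives \<open>d\<close> with a regular type over some \<open>C'\<close> such that \<open>a\<close> forks with \<open>d\<close> over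
  \<open>C'\<close> but not with \<open>C'\<close> over \<open>C\<close>. By induction the weight of \<open>a\<close> over \<open>C'd\<close> is at most some \<open>m\<close>.
  A family of size greater than \<open>2m + 2\<close> that witnesses the weight of \<open>a\<close> over \<open>C\<close> can be moved so
  that its base and its members are independent from \<open>C'd\<close> over \<open>Ca\<close>. Then \<open>d\<close> forks with any \<open>m + 1\<close>
  of its members, since otherwise these would witness weight \<open>m + 1\<close> over \<open>C'd\<close>. Two disjoint
  blocks of \<open>m + 1\<close> members contradict that \<open>d\<close> has weight one.\<close>

lemma weight_bounded:
  assumes "(C, a) \<in> Wellfounded.acc below" "sml C" "set a \<subseteq> U"
  shows "\<exists>N. \<forall>n. weight_ge a C n \<longrightarrow> n \<le> N"
proof -
  have "sml (fst p) \<longrightarrow> set (snd p) \<subseteq> U \<longrightarrow> (\<exists>N. \<forall>n. weight_ge (snd p) (fst p) n \<longrightarrow> n \<le> N)"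
    if "p \<in> Wellfounded.acc below" for p
    using that
  proof (induction p rule: acc_induct_rule)
    case (1 p)
    show ?case
    proof (intro impI, rule ccontr)
      define C where "C = fst p"
      define a where "a = snd p"
      have p: "p = (C, a)" by (simp add: C_def a_def)
      assume Ca: "sml (fst p)" "set (snd p) \<subseteq> U" and unbdd: "\<nexists>N. \<forall>n. weight_ge (snd p) (fst p) n \<longrightarrow> n \<le> N"
      have C: "sml C" and a: "set a \<subseteq> U" using Ca by (auto simp: C_def a_def)
      have CU: "C \<subseteq> U" using C by (rule smallD)
      have as: "sml (set a)" using a by (rule small_set)
      have big: "\<exists>n>N. weight_ge a C n" for N
        using unbdd by (metis C_def a_def not_le)
      have naa: "\<not> ind (set a) C (set a)"
      proof
        assume aa: "ind (set a) C (set a)"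
        obtain n where "n > 0" "weight_ge a C n" using big by blast
        then obtain B bs where B: "sml B" "C \<subseteq> B" "length bs > 0" "weighs a B bs"
          unfolding weight_ge_def by blast
        then have b: "set (hd bs) \<subseteq> U" "\<not> ind (set a) B (set (hd bs))" by (auto simp: weighs_def)
        have "ind (set a) C (B \<union> set (hd bs))"
          using aa C a small_Un[OF B(1) small_set[OF b(1)]] by (rule self_independent_trivial)
        then have "ind (set a) B (set (hd bs))" using a by (rule ind_mono) (use B in auto)
        then show False using b by blast
      qed
      have nae: "ind (set a) C {}" using C a by (rule existence) simp
      obtain C' d where d: "sml C'" "C \<subseteq> C'" "set d \<subseteq> U" "ind (set a) C C'" "\<not> ind (set d) C' (set a)"
        "ind (set d) C' {}" "regular d C'"
        by (rule regular_exists[OF 1(1)[unfolded p] C a a small_finite[OF finite.emptyI] naa nae]) auto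
      have ds: "sml (set d)" using d(3) by (rule small_set)
      have w1: "weight1 d C'" using d(7,1,3) by (rule regular_weight1)
      let ?D = "C' \<union> set d"
      have D: "sml ?D" using d(1) ds by (rule small_Un)
      have "\<not> ind (set a) C ?D"
      proof
        assume "ind (set a) C ?D"
        then have "ind (set a) C' (set d)" using a by (rule ind_mono) (use d in auto)
        then have "ind (set d) C' (set a)" by (rule symmetry) (use as d ds in auto)
        then show False using d(5) by blast
      qed
      then have "((?D, a), p) \<in> below" unfolding p using D d(2) conjugate_refl by (intro belowI) auto
      from 1(2)[OF this] obtain m where m: "\<And>n. weight_ge a ?D n \<Longrightarrow> n \<le> m" using D a by auto
      obtain n where n: "n > 2 * m + 2" "weight_ge a C n" using big by blast
      then obtain B0 bs0 where B0: "sml B0" "C \<subseteq> B0" "ind (set a) C B0" "length bs0 = n" "weighs a B0 bs0"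
        unfolding weight_ge_def by blast
      have bs0U: "\<forall>b\<in>set bs0. set b \<subseteq> U" using weighsD(2)[OF B0(5)] by blast
      have bs0_s: "sml (els bs0)" using bs0U by (rule small_els)
      have E0: "sml (B0 \<union> els bs0)" using B0(1) bs0_s by (rule small_Un)
      have Caa: "sml (C \<union> set a)" using C as by (rule small_Un)
      have "ind (B0 \<union> els bs0) (C \<union> set a) {}" using Caa smallD[OF E0] by (rule existence) simp
      then obtain g where g: "aut ((C \<union> set a) \<union> {}) g" "ind (g ` (B0 \<union> els bs0)) (C \<union> set a) ?D"
        using E0 Caa small_finite[OF finite.emptyI] D by (rule extension) auto
      have ga: "automorphism M g" using g(1) by (rule aut_automorphism)
      have gC: "g ` C = C" "g ` set a = set a" using aut_image[OF g(1)] by auto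
      have gma: "map g a = a" by (rule aut_map[OF g(1)]) auto
      define B where "B = g ` B0"
      define bs where "bs = map (map g) bs0"
      have B0U: "B0 \<subseteq> U" using B0(1) by (rule smallD)
      have B: "sml B" unfolding B_def by (rule small_image[OF ga B0(1)])
      have BU: "B \<subseteq> U" using B by (rule smallD)
      have CB: "C \<subseteq> B" using B0(2) gC(1) unfolding B_def by blast
      have lbs: "length bs = n" using B0(4) by (simp add: bs_def)
      have w: "weighs a B bs" using weighs_image[OF B0(5) ga a B0U] unfolding gma B_def bs_def .
      have bsU: "\<forall>b\<in>set bs. set b \<subseteq> U" using weighsD(2)[OF w] by blast
      have bs_s: "sml (els bs)" using bsU by (rule small_els)
      have bsU': "els bs \<subseteq> U" using bs_s by (rule smallD)
      have seqB: "indseq B bs" by (rule weighsD(1)[OF w])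
      have aB: "ind (set a) C B" using ind_image[OF B0(3) ga a CU B0U] unfolding gC B_def .
      have "g ` (B0 \<union> els bs0) = B \<union> els bs" by (simp add: B_def bs_def els_map image_Un)
      then have free: "ind (B \<union> els bs) (C \<union> set a) ?D" using g(2) by simp
      have "ind B C (set a)" by (rule symmetry[OF aB]) (use as C B in auto)
      moreover have "ind B (C \<union> set a) ?D" using free by (rule ind_mono) (use BU bsU' in auto)
      ultimately have "ind B C (set a \<union> ?D)" using B C as D by (rule ind_trans)
      then have BC': "ind B C' (set a \<union> set d)" using BU by (rule ind_mono) (use d(2) in auto)
      let ?E = "B \<union> C'"
      have E: "sml ?E" using B d(1) by (rule small_Un)
      have "ind B C' (set a)" using BC' BU by (rule ind_mono) auto
      then have "ind (set a) C' B" by (rule symmetry) (use B d as in auto)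
      then have "ind (set a) C (C' \<union> B)" using ind_trans'[OF d(4) _ d(2) as d(1) B] by blast
      then have aBC: "ind (set a) B C'" using a by (rule ind_mono) (use CB in auto)
      have aBE: "ind (set a) B ?E" using aBC a by (rule ind_mono) auto
      have "ind (els bs) (C \<union> set a \<union> B) C'"
      proof (rule ind_base_left[of "B \<union> els bs" "C \<union> set a"])
        show "ind (B \<union> els bs) (C \<union> set a) C'" using free by (rule ind_mono) (use BU bsU' in auto)
      qed (use B bs_s C as d in \<open>auto simp: small_Un_iff\<close>)
      then have "ind C' (C \<union> set a \<union> B) (els bs)" by (rule symmetry) (use B bs_s C as d in \<open>auto simp: small_Un_iff\<close>)
      moreover have "C \<union> set a \<union> B = B \<union> set a" using CB by blast
      moreover have "ind C' B (set a)" by (rule symmetry[OF aBC]) (use as B d in auto)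
      ultimately have "ind C' B (set a \<union> els bs)" using ind_trans[OF _ _ d(1) B as bs_s] by simp
      then have "ind C' B (els bs)" using smallD[OF d(1)] by (rule ind_mono) auto
      then have seq: "indseq ?E bs" by (intro indseq_Un[OF seqB]) (use bsU B d in auto)
      have nE: "\<not> ind (set a) ?E (set b)" if b: "b \<in> set bs" for b
      proof
        assume "ind (set a) ?E (set b)"
        then have "ind (set a) B (?E \<union> set b)"
          using ind_trans'[OF aBE _ _ as E] b bsU small_set by blast
        then have "ind (set a) B (set b)" using a by (rule ind_mono) auto
        then show False using weighsD(3)[OF w b] by blast
      qed
      have "ind (set d) C' B"
      proof (rule symmetry)
        show "ind B C' (set d)" using BC' BU by (rule ind_mono) auto
      qed (use B d ds in auto)
      then have dE: "ind (set d) C' ?E" using d(3) by (rule ind_mono) auto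
      have w1E: "weight1 d ?E" by (rule weight1_extension[OF w1 dE _ E d(3)]) auto
      have "ind B ?D (set a)" using BC' BU by (rule ind_mono) auto
      then have "ind (set a) ?D B" by (rule symmetry) (use B D as in auto)
      then have aD: "ind (set a) ?D (?E \<union> set d)" using a by (rule ind_mono) auto
      have Ed: "sml (?E \<union> set d)" using E ds by (rule small_Un)
      have block: "length cs \<le> m" if cs: "set cs \<subseteq> set bs" "indseq ?E cs" "ind (set d) ?E (els cs)" for cs
      proof (rule m, unfold weight_ge_def, intro exI conjI)
        have csU: "\<forall>x\<in>set cs. set x \<subseteq> U" using cs(1) bsU by blast
        show "sml (?E \<union> set d)" by fact
        show "ind (set a) ?D (?E \<union> set d)" by fact
        show "length cs = length cs" by simp
        show "weighs a (?E \<union> set d) cs"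
          unfolding weighs_def
        proof (intro conjI ballI notI)
          show "indseq (?E \<union> set d) cs" using cs(2,3) csU E ds by (rule indseq_Un)
          fix b assume b: "b \<in> set cs"
          show bU: "set b \<subseteq> U" using b csU by blast
          assume *: "ind (set a) (?E \<union> set d) (set b)"
          have "ind (set d) ?E (set b)" using cs(3) d(3) by (rule ind_mono) (use els_member[OF b] in auto)
          then have "ind (set d \<union> set a) ?E (set b)" using * ds as E small_set[OF bU] by (rule left_transitivity)
          then have "ind (set a) ?E (set b)" by (rule ind_mono) (use a d(3) in auto)
          then show False using nE b cs(1) by blast
        qed
      qed auto
      let ?c1 = "take (m + 1) bs" and ?c2 = "drop (m + 1) bs"
      note td = indseq_take_drop[OF seq bsU E, of "m + 1"]
      have "length ?c1 = m + 1" "length ?c2 > m" using lbs n(1) by auto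
      then have n1: "\<not> ind (set d) ?E (els ?c1)" and n2: "\<not> ind (set d) ?E (els ?c2)"
        using block[of ?c1, OF set_take_subset td(1)] block[of ?c2, OF set_drop_subset td(2)] by auto
      have "ind (set d) ?E (set (concat ?c2))"
      proof (rule weight1D[OF w1E E d(3), of "concat ?c1"])
        show "set (concat ?c1) \<subseteq> U" "set (concat ?c2) \<subseteq> U"
          using bsU by (auto dest: in_set_takeD in_set_dropD)
        show "ind (set (concat ?c1)) ?E (set (concat ?c2))" using td(3) by (simp only: set_concat_els)
        show "\<not> ind (set d) ?E (set (concat ?c1))" using n1 unfolding set_concat_els .
      qed
      then show False using n2 by (simp only: set_concat_els)
    qed
  qed
  from this[OF assms(1)] assms(2,3) show ?thesis by simp
qed

section \<open>Decomposition into regular types\<close>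

definition dominates :: "'a set \<Rightarrow> 'a set \<Rightarrow> 'a set \<Rightarrow> bool" where
  "dominates C A B \<longleftrightarrow> (\<forall>c. set c \<subseteq> U \<longrightarrow> ind (set c) C A \<longrightarrow> ind (set c) C B)"

lemma dominatesD:
  assumes "dominates C A B" "ind X C A" "X \<subseteq> U" "C \<union> B \<subseteq> U"
  shows "ind X C B"
  unfolding ind_def
proof (intro allI impI)
  fix c assume c: "set c \<subseteq> X"
  then have cU: "set c \<subseteq> U" using assms(3) by blast
  have "ind (set c) C A" using assms(2,3) c by (rule ind_mono) auto
  then have "ind (set c) C B" using assms(1) cU unfolding dominates_def by blast
  then show "thorn_indep \<kappa> M c C B" by (auto simp: ind_def)
qed

text \<open>The intermediate states of the decomposition of \<open>a\<close>. It is essential that \<open>a\<close> dominates \<open>a\<close>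
  together with \<open>bs\<close>: then any \<open>C' \<supseteq> C\<close> independent from \<open>a\<close> over \<open>C\<close> is also independent from
  \<open>a\<close> and \<open>bs\<close>, and all conditions on \<open>bs\<close> remain true over \<open>C'\<close>.\<close>

definition decomp :: "'a list \<Rightarrow> 'a set \<Rightarrow> 'a set \<Rightarrow> 'a list list \<Rightarrow> bool" where
  "decomp a A C bs \<longleftrightarrow> sml C \<and> A \<subseteq> C \<and> ind (set a) A C \<and> indseq C bs \<and>
     (\<forall>b\<in>set bs. set b \<subseteq> U \<and> regular b C \<and> \<not> ind (set a) C (set b)) \<and>
     dominates C (set a) (set a \<union> els bs)"

text \<open>By \<open>regular_exists\<close> there are \<open>C1\<close> and a tuple \<open>d'\<close> with a regular type over \<open>C1\<close>, forking with \<open>a\<close>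
  and independent from \<open>bs\<close>. Among the bases \<open>D \<supseteq> C1\<close> for which this remains true and \<open>a\<close> is
  independent from \<open>D\<close>, choose one where the type of \<open>d'\<close> over \<open>D a bs\<close> is minimal for forking
  extension. If \<open>a\<close> did not dominate \<open>a bs d'\<close> over \<open>D\<close>, there would be \<open>c\<close> independent from \<open>a\<close>, and so
  from \<open>a bs\<close>, but not from \<open>a bs d'\<close>. Then \<open>d'\<close> forks with \<open>c\<close> over \<open>D a bs\<close>. But \<open>d'\<close> has
  weight one and forks with \<open>a\<close>, both over \<open>D\<close> and over \<open>D bs\<close>, and so it is independent from \<open>c\<close>
  there. Hence \<open>Dc\<close> is again such a base, against minimality.\<close>

lemma decomp_extend:
  assumes acc: "\<And>C d. sml C \<Longrightarrow> set d \<subseteq> U \<Longrightarrow> (C, d) \<in> Wellfounded.acc below"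
    and dec: "decomp a A C bs" and a: "set a \<subseteq> U" and A: "sml A"
    and d: "set d \<subseteq> U" "ind (set d) C (els bs)" "\<not> ind (set d) C (set a)"
  obtains C' d' where "decomp a A C' (d' # bs)"
proof -
  have C: "sml C" "A \<subseteq> C" "ind (set a) A C" "indseq C bs"
    "\<And>b. b \<in> set bs \<Longrightarrow> set b \<subseteq> U \<and> regular b C \<and> \<not> ind (set a) C (set b)"
    "dominates C (set a) (set a \<union> els bs)"
    using dec by (auto simp: decomp_def)
  have CU: "C \<subseteq> U" using C(1) by (rule smallD)
  have bsU: "\<forall>b\<in>set bs. set b \<subseteq> U" using C(5) by blast
  have bs_s: "sml (els bs)" using bsU by (rule small_els)
  have bsU': "els bs \<subseteq> U" using bs_s by (rule smallD)
  have as: "sml (set a)" using a by (rule small_set)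
  obtain C1 d' where r: "sml C1" "C \<subseteq> C1" "set d' \<subseteq> U" "ind (set a) C C1" "\<not> ind (set d') C1 (set a)"
    "ind (set d') C1 (els bs)" "regular d' C1"
    by (rule regular_exists[OF acc[OF C(1) d(1)] C(1) d(1) a bs_s d(3,2)])
  have ds: "sml (set d')" using r(3) by (rule small_set)
  define P where "P D \<longleftrightarrow> sml D \<and> C1 \<subseteq> D \<and> ind (set a) C1 D \<and> \<not> ind (set d') D (set a) \<and>
    ind (set d') D (els bs) \<and> regular d' D" for D
  define Q where "Q p \<longleftrightarrow> (\<exists>D. P D \<and> fst p = D \<union> set a \<union> els bs \<and> snd p = d')" for p
  have "ind (set a) C1 C1" using r(1) a by (rule existence) simp
  then have "P C1" using r by (auto simp: P_def)
  then have "Q (C1 \<union> set a \<union> els bs, d')" by (auto simp: Q_def)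
  moreover have "sml (C1 \<union> set a \<union> els bs)" using r(1) as bs_s by (intro small_Un)
  ultimately obtain p where p: "Q p" "\<And>q. (q, p) \<in> below \<Longrightarrow> \<not> Q q"
    using acc_minimal[OF acc[OF _ r(3)], of _ Q] by metis
  then obtain D where PD: "P D" and pD: "p = (D \<union> set a \<union> els bs, d')" unfolding Q_def by (metis prod.collapse)
  have D: "sml D" "C1 \<subseteq> D" "ind (set a) C1 D" "\<not> ind (set d') D (set a)" "ind (set d') D (els bs)" "regular d' D"
    using PD by (auto simp: P_def)
  have DU: "D \<subseteq> U" using D(1) by (rule smallD)
  have CD: "C \<subseteq> D" using r(2) D(2) by blast
  have w1: "weight1 d' D" using D(6,1) r(3) by (rule regular_weight1)
  have "ind (set a) C (C1 \<union> D)" by (rule ind_trans'[OF r(4) D(3) r(2) as r(1) D(1)])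
  then have aCD: "ind (set a) C D" using a by (rule ind_mono) auto
  then have "ind D C (set a)" by (rule symmetry) (use as C D in auto)
  then have DCab: "ind D C (set a \<union> els bs)" by (rule dominatesD[OF C(6)]) (use DU CU a bsU' in auto)
  have bsD: "indseq D bs" using C(4) CD
  proof (rule indseq_base)
    show "ind D C (els bs)" using DCab DU by (rule ind_mono) auto
  qed (use bsU D in auto)
  have dom: "dominates D (set a) (set a \<union> els bs)"
    unfolding dominates_def
  proof (intro allI impI)
    fix c assume cU: "set c \<subseteq> U" and c: "ind (set c) D (set a)"
    have cs: "sml (set c)" using cU by (rule small_set)
    have "C \<union> D = D" using CD by blast
    then have "ind (D \<union> set c) C (set a)"
      using left_transitivity[OF \<open>ind D C (set a)\<close> _ D(1) cs C(1) as] c by simp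
    then have "ind (D \<union> set c) C (set a \<union> els bs)"
      by (rule dominatesD[OF C(6)]) (use DU cU CU a bsU' in auto)
    then show "ind (set c) D (set a \<union> els bs)"
      by (rule ind_base_left) (use CD D cs C as bs_s in \<open>auto simp: small_Un_iff\<close>)
  qed
  have dom': "dominates D (set a) (set a \<union> els (d' # bs))"
    unfolding dominates_def
  proof (intro allI impI, rule ccontr)
    fix c assume cU: "set c \<subseteq> U" and c: "ind (set c) D (set a)"
      and neg: "\<not> ind (set c) D (set a \<union> els (d' # bs))"
    have cs: "sml (set c)" using cU by (rule small_set)
    let ?S = "set a \<union> els bs"
    have S: "sml ?S" using as bs_s by (rule small_Un)
    have cS: "ind (set c) D ?S" using dom cU c unfolding dominates_def by blast
    have nd: "\<not> ind (set d') (D \<union> ?S) (set c)"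
    proof
      assume "ind (set d') (D \<union> ?S) (set c)"
      then have "ind (set c) (D \<union> ?S) (set d')" by (rule symmetry) (use ds D S cs small_Un in auto)
      then have "ind (set c) D (?S \<union> set d')" using ind_trans[OF cS _ cs D(1) S ds] by blast
      moreover have "?S \<union> set d' = set a \<union> els (d' # bs)" by auto
      ultimately show False using neg by simp
    qed
    let ?D = "D \<union> set c"
    have D': "sml ?D" using D(1) cs by (rule small_Un)
    have ac: "ind (set a) D (set c)" by (rule symmetry[OF c]) (use cs D as in auto)
    have da: "\<not> ind (set d') D (set a)" by fact
    have dc: "ind (set d') D (set c)" using w1 D(1) r(3) a cU ac da by (rule weight1D)
    have "ind (set d') D ?D" using dc r(3) by (rule ind_mono) auto
    then have reg: "regular d' ?D" using regular_extension[OF D(6)] D' r(3) by blast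
    have "ind (set a) C1 (D \<union> set c)" by (rule ind_trans'[OF D(3) ac D(2) as D(1) cs])
    moreover have "\<not> ind (set d') ?D (set a)"
    proof
      assume "ind (set d') ?D (set a)"
      then have "ind (set d') D (set c \<union> set a)" by (rule ind_trans[OF dc]) (use ds D cs as in auto)
      then have "ind (set d') D (set a)" using r(3) by (rule ind_mono) auto
      then show False using da by blast
    qed
    moreover have "ind (set d') ?D (els bs)"
    proof -
      let ?B = "D \<union> els bs"
      have B: "sml ?B" using D(1) bs_s by (rule small_Un)
      have "ind (set d') D ?B" using D(5) r(3) by (rule ind_mono) auto
      then have wB: "weight1 d' ?B" by (rule weight1_extension[OF w1 _ _ B r(3)]) auto
      have "\<not> ind (set d') ?B (set a)"
      proof
        assume "ind (set d') ?B (set a)"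
        then have "ind (set d') D (els bs \<union> set a)" by (rule ind_trans[OF D(5)]) (use ds D bs_s as in auto)
        then have "ind (set d') D (set a)" using r(3) by (rule ind_mono) auto
        then show False using da by blast
      qed
      moreover have "ind (set a) ?B (set c)"
      proof (rule symmetry)
        show "ind (set c) ?B (set a)" using cS cU by (rule ind_mono) auto
      qed (use cs B as in auto)
      ultimately have "ind (set d') ?B (set c)" using weight1D[OF wB B r(3) a cU] by blast
      then have "ind (set d') D (els bs \<union> set c)" by (rule ind_trans[OF D(5)]) (use ds D bs_s cs in auto)
      then show ?thesis using r(3) by (rule ind_mono) auto
    qed
    ultimately have "P ?D" using D' D(2) reg unfolding P_def by blast
    then have "Q (?D \<union> set a \<union> els bs, d')" by (auto simp: Q_def)
    moreover have "((?D \<union> set a \<union> els bs, d'), p) \<in> below"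
      unfolding pD
    proof (rule belowI)
      show "sml (?D \<union> set a \<union> els bs)" by (rule small_Un[OF small_Un[OF D' as] bs_s])
      show "conjugate (D \<union> set a \<union> els bs) d' d'" by (rule conjugate_refl)
      show "\<not> ind (set d') (D \<union> set a \<union> els bs) (?D \<union> set a \<union> els bs)"
      proof
        assume "ind (set d') (D \<union> set a \<union> els bs) (?D \<union> set a \<union> els bs)"
        then have "ind (set d') (D \<union> ?S) (set c)" using r(3) by (rule ind_mono) auto
        then show False using nd by blast
      qed
    qed auto
    ultimately show False using p(2) by blast
  qed
  have "ind (set a) A (C \<union> D)" by (rule ind_trans'[OF C(3) aCD C(2) as C(1) D(1)])
  then have aAD: "ind (set a) A D" using a by (rule ind_mono) auto
  have adep: "\<not> ind (set a) D (set d')"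
  proof
    assume "ind (set a) D (set d')"
    then have "ind (set d') D (set a)" by (rule symmetry) (use as D ds in auto)
    then show False using D(4) by blast
  qed
  have "\<forall>b\<in>set bs. set b \<subseteq> U \<and> regular b D \<and> \<not> ind (set a) D (set b)"
  proof
    fix b assume b: "b \<in> set bs"
    have bU: "set b \<subseteq> U" using b bsU by blast
    have bss: "sml (set b)" using bU by (rule small_set)
    have "ind D C (set b)" using DCab DU by (rule ind_mono) (use els_member[OF b] in auto)
    then have "ind (set b) C D" by (rule symmetry) (use bss C D in auto)
    then have "regular b D" using regular_extension[of b C D] C(5)[OF b] CD D(1) by blast
    moreover have "\<not> ind (set a) D (set b)"
    proof
      assume "ind (set a) D (set b)"
      then have "ind (set a) C (D \<union> set b)" using ind_trans'[OF aCD _ CD as D(1) bss] by blast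
      then have "ind (set a) C (set b)" using a by (rule ind_mono) auto
      then show False using C(5)[OF b] by blast
    qed
    ultimately show "set b \<subseteq> U \<and> regular b D \<and> \<not> ind (set a) D (set b)" using bU by blast
  qed
  then have "decomp a A D (d' # bs)"
    unfolding decomp_def using D(1,5,6) C(2) CD aAD bsD r(3) adep dom' by auto
  then show ?thesis by (rule that)
qed

text \<open>Start from a base \<open>B\<close> over which the weight of \<open>a\<close> is attained and take a state with \<open>bs\<close> as long
  as possible. Then \<open>bs\<close> dominates \<open>a\<close>, for otherwise \<open>decomp_extend\<close> applies. A family \<open>ds\<close> that
  attains the weight over \<open>B\<close> can be moved over \<open>Ba\<close> so as to be independent from \<open>C\<close>; it is then
  an independent family over \<open>C\<close> whose members fork with \<open>a\<close>, hence with \<open>bs\<close>, and \<open>weight_le_length\<close>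
  bounds its length by that of \<open>bs\<close>.\<close>

theorem regular_decomposition:
  assumes acc: "\<And>C d. sml C \<Longrightarrow> set d \<subseteq> U \<Longrightarrow> (C, d) \<in> Wellfounded.acc below"
    and a: "set a \<subseteq> U" and A: "sml A"
    and w: "weight_ge a A n" and wmax: "\<And>m. weight_ge a A m \<Longrightarrow> m \<le> n"
  obtains C bs where "sml C" "A \<subseteq> C" "ind (set a) A C" "length bs = n" "indseq C bs"
    "\<And>b. b \<in> set bs \<Longrightarrow> set b \<subseteq> U \<and> regular b C"
    "dominates C (set a) (els bs)" "dominates C (els bs) (set a)"
proof -
  have as: "sml (set a)" using a by (rule small_set)
  have AU: "A \<subseteq> U" using A by (rule smallD)
  obtain B ds where B: "sml B" "A \<subseteq> B" "ind (set a) A B" "length ds = n" "weighs a B ds"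
    using w unfolding weight_ge_def by blast
  have BU: "B \<subseteq> U" using B(1) by (rule smallD)
  have dsU: "\<forall>b\<in>set ds. set b \<subseteq> U" using weighsD(2)[OF B(5)] by blast
  have ds_s: "sml (els ds)" using dsU by (rule small_els)
  have dsU': "els ds \<subseteq> U" using ds_s by (rule smallD)
  have "ind (set a) B B" using B(1) a by (rule existence) simp
  then have start: "decomp a B B []" using B(1) by (auto simp: decomp_def dominates_def)
  have bound: "length bs \<le> n" if "decomp a B C bs" for C bs
  proof (rule wmax)
    have C: "sml C" "B \<subseteq> C" "ind (set a) B C" "indseq C bs"
      "\<forall>b\<in>set bs. set b \<subseteq> U \<and> regular b C \<and> \<not> ind (set a) C (set b)"
      using that by (auto simp: decomp_def)
    have "ind (set a) A (B \<union> C)" by (rule ind_trans'[OF B(3) C(3) B(2) as B(1) C(1)])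
    then have "ind (set a) A C" using a by (rule ind_mono) auto
    then show "weight_ge a A (length bs)" unfolding weight_ge_def weighs_def using C B(2) by blast
  qed
  have "\<exists>x. decomp a B (fst x) (snd x) \<and> (\<forall>y. decomp a B (fst y) (snd y) \<longrightarrow> length (snd y) \<le> length (snd x))"
    by (rule ex_has_greatest_nat[of _ "(B, [])" _ "Suc n"]) (use start in \<open>auto dest: bound simp: less_Suc_eq_le\<close>)
  then obtain C bs where dec: "decomp a B C bs" and max: "\<And>C' bs'. decomp a B C' bs' \<Longrightarrow> length bs' \<le> length bs"
    by fastforce
  have C: "sml C" "B \<subseteq> C" "ind (set a) B C" "indseq C bs"
    "\<And>b. b \<in> set bs \<Longrightarrow> set b \<subseteq> U \<and> regular b C \<and> \<not> ind (set a) C (set b)"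
    "dominates C (set a) (set a \<union> els bs)"
    using dec by (auto simp: decomp_def)
  have CU: "C \<subseteq> U" using C(1) by (rule smallD)
  have bsU: "\<forall>b\<in>set bs. set b \<subseteq> U" using C(5) by blast
  have bs_s: "sml (els bs)" using bsU by (rule small_els)
  have dom2: "dominates C (els bs) (set a)"
    unfolding dominates_def
  proof (intro allI impI, rule ccontr)
    fix c assume c: "set c \<subseteq> U" "ind (set c) C (els bs)" "\<not> ind (set c) C (set a)"
    obtain C' d' where "decomp a B C' (d' # bs)"
      by (rule decomp_extend[OF acc dec a B(1) c]) auto
    then show False using max[of C' "d' # bs"] by simp
  qed
  have dom1: "dominates C (set a) (els bs)"
    unfolding dominates_def
  proof (intro allI impI)
    fix c assume c: "set c \<subseteq> U" "ind (set c) C (set a)"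
    then have "ind (set c) C (set a \<union> els bs)" using C(6) unfolding dominates_def by blast
    then show "ind (set c) C (els bs)" using c(1) by (rule ind_mono) auto
  qed
  have "n \<le> length bs"
  proof -
    have Ba: "sml (B \<union> set a)" using B(1) as by (rule small_Un)
    have "ind (els ds) (B \<union> set a) {}" using Ba dsU' by (rule existence) simp
    then obtain g where g: "aut ((B \<union> set a) \<union> {}) g" "ind (g ` els ds) (B \<union> set a) C"
      using ds_s Ba small_finite[OF finite.emptyI] C(1) by (rule extension) auto
    have ga: "automorphism M g" using g(1) by (rule aut_automorphism)
    have gB: "g ` B = B" "g ` set a = set a" using aut_image[OF g(1)] by auto
    define es where "es = map (map g) ds"
    have es_els: "els es = g ` els ds" by (simp add: es_def els_map)
    have gma: "map g a = a" by (rule aut_map[OF g(1)]) auto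
    have es: "weighs a B es" using weighs_image[OF B(5) ga a BU] unfolding gma gB es_def .
    have esU: "\<forall>b\<in>set es. set b \<subseteq> U" using weighsD(2)[OF es] by blast
    have es_s: "sml (els es)" using esU by (rule small_els)
    have seqB: "indseq B es" by (rule weighsD(1)[OF es])
    have "ind C B (set a)" by (rule symmetry[OF C(3)]) (use as B C in auto)
    moreover have "ind C (B \<union> set a) (els es)"
      by (rule symmetry[OF g(2)[folded es_els]]) (use es_s Ba C in auto)
    ultimately have Cfree: "ind C B (set a \<union> els es)" using C(1) B(1) as es_s by (rule ind_trans)
    have seqC: "indseq C es" using seqB C(2)
    proof (rule indseq_base)
      show "ind C B (els es)" using Cfree CU by (rule ind_mono) auto
    qed (use esU C in auto)
    have "length es \<le> length bs"
    proof (rule weight_le_length[OF C(4) _ C(1) seqC])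
      show "\<forall>b\<in>set bs. set b \<subseteq> U \<and> weight1 b C" using C(5) C(1) regular_weight1 by blast
      show "\<forall>d\<in>set es. set d \<subseteq> U \<and> \<not> ind (set d) C (els bs)"
      proof (intro ballI conjI notI)
        fix d assume d: "d \<in> set es"
        show dU: "set d \<subseteq> U" using d esU by blast
        have dss: "sml (set d)" using dU by (rule small_set)
        assume "ind (set d) C (els bs)"
        then have "ind (set d) C (set a)" using dom2 dU unfolding dominates_def by blast
        then have "ind (set a) C (set d)" by (rule symmetry) (use dss C as in auto)
        then have "ind (set a) B (C \<union> set d)" using ind_trans'[OF C(3) _ C(2) as C(1) dss] by blast
        then have "ind (set a) B (set d)" using a by (rule ind_mono) auto
        then show False using weighsD(3)[OF es d] by blast
      qed
    qed
    then show ?thesis using B(4) by (simp add: es_def)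
  qed
  moreover have "length bs \<le> n" using bound dec .
  ultimately have lb: "length bs = n" by simp
  have "ind (set a) A (B \<union> C)" by (rule ind_trans'[OF B(3) C(3) B(2) as B(1) C(1)])
  then have "ind (set a) A C" using a by (rule ind_mono) auto
  then show ?thesis using that[of C bs] C(1,2,4,5) B(2) lb dom1 dom2 by blast
qed

end

context monster
begin

section \<open>Complete types and their realizations\<close>

lemma realizes_ctype:
  assumes q: "q \<in> ctypes M \<Gamma> B" and a: "realizes M \<Gamma> a q"
  shows "set a \<subseteq> U" "map srt a = \<Gamma>" "tp M a B = q"
proof -
  show "set a \<subseteq> U" and s: "map srt a = \<Gamma>" using a by (auto simp: realizes_def tuples_def)
  show "tp M a B = q"
  proof
    show "q \<subseteq> tp M a B" using q a s by (auto simp: ctypes_def tp_def realizes_def)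
    show "tp M a B \<subseteq> q"
    proof
      fix \<chi> assume \<chi>: "\<chi> \<in> tp M a B"
      obtain \<phi> b where \<chi>': "\<chi> = (\<phi>, b)" by force
      have f: "(\<phi>, b) \<in> fms_over M \<Gamma> B" and h: "sat M (a @ b) \<phi>" using \<chi> s by (auto simp: tp_def \<chi>')
      have "(Neg \<phi>, b) \<notin> q" using a h by (auto simp: realizes_def)
      moreover have "(\<phi>, b) \<in> q \<or> (Neg \<phi>, b) \<in> q" using q f by (auto simp: ctypes_def)
      ultimately show "\<chi> \<in> q" using \<chi>' by blast
    qed
  qed
qed

lemma realizes_tp_self: "set a \<subseteq> U \<Longrightarrow> realizes M (map srt a) a (tp M a B)"
  by (auto simp: realizes_def tp_def tuples_def)

lemma tp_in_ctypes: "set a \<subseteq> U \<Longrightarrow> tp M a B \<in> ctypes M (map srt a) B"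
  using realizes_tp_self[of a B] unfolding ctypes_def
  by (auto simp: tp_def realizes_def fms_over_def)

lemma ctype_realized:
  assumes "p \<in> ctypes M \<Gamma> A" "sml A"
  obtains a where "set a \<subseteq> U" "map srt a = \<Gamma>" "p = tp M a A"
proof -
  obtain a where "realizes M \<Gamma> a p" using assms saturated unfolding saturated_def by blast
  then show ?thesis using that realizes_ctype[OF assms(1)] by blast
qed

lemma tp_mono: "A \<subseteq> B \<Longrightarrow> tp M a A \<subseteq> tp M a B"
  by (auto simp: tp_def fms_over_def)

lemma tp_subset_conjugate:
  assumes "tp M a A \<subseteq> tp M b B" "sml A" "set a \<subseteq> U" "set b \<subseteq> U" "map srt b = map srt a"
  shows "conjugate A a b"
proof -
  have "realizes M (map srt a) b (tp M a A)"
    using assms by (auto simp: realizes_def tp_def tuples_def)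
  then show ?thesis using realizes_tp_iff[OF assms(2,3)] by blast
qed

lemma conjugate_tp:
  assumes "conjugate A a b" "sml A" "set a \<subseteq> U"
  shows "tp M b A = tp M a A"
proof (rule realizes_ctype(3)[OF tp_in_ctypes[OF assms(3)]])
  show "realizes M (map srt a) b (tp M a A)" using realizes_tp_iff[OF assms(2,3)] assms(1) by blast
qed

lemma thorn_forks_tp:
  assumes "A \<subseteq> B"
  shows "thorn_forks \<kappa> M (map srt a) A (tp M a B) \<longleftrightarrow> \<not> thorn_indep \<kappa> M a A B"
  using assms by (simp add: thorn_indep_def Un_absorb1)

lemma ind_set_eq: "set a \<subseteq> U \<Longrightarrow> sml C \<Longrightarrow> sml B \<Longrightarrow> thorn_indep \<kappa> M a C B \<longleftrightarrow> ind (set a) C B"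
  using ind_set_iff[of a C B] smallD by blast

lemma nonforking_ext_tp:
  assumes "conjugate A a b" "sml B" "A \<subseteq> B" "set a \<subseteq> U" "ind (set b) A B"
  shows "thorn_nonforking_ext \<kappa> M (map srt a) A (tp M a A) B (tp M b B)"
proof -
  have A: "sml A" by (rule small_subset[OF assms(2,3)])
  have bU: "set b \<subseteq> U" and s: "map srt b = map srt a"
    using conjugate_set[OF assms(1,4)] conjugate_sort[OF assms(1,4)] by auto
  have "\<not> thorn_forks \<kappa> M (map srt a) A (tp M b B)"
    using thorn_forks_tp[OF assms(3), of b] ind_set_eq[OF bU A assms(2)] assms(5) unfolding s by simp
  moreover have "tp M a A \<subseteq> tp M b B" using conjugate_tp[OF assms(1) A assms(4)] tp_mono[OF assms(3)] by blast
  moreover have "tp M b B \<in> ctypes M (map srt a) B" using tp_in_ctypes[OF bU] unfolding s .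
  ultimately show ?thesis unfolding thorn_nonforking_ext_def using assms(2,3) by blast
qed

section \<open>Ranks and accessibility\<close>

definition forking_exts :: "'s list \<Rightarrow>
    (('a set \<times> ('s, 'f, 'r, 'a) pfm set) \<times> ('a set \<times> ('s, 'f, 'r, 'a) pfm set)) set" where
  "forking_exts \<Gamma> = {((B, q), (A, p)). thorn_forking_ext \<kappa> M \<Gamma> A p B q}"

text \<open>A type outside the well-founded part has a forking extension outside the well-founded part.
  So, by induction on \<open>\<alpha>\<close>, all such types have rank at least \<open>\<alpha>\<close>.\<close>

lemma Uth_ge_of_not_accessible:
  assumes "\<alpha> \<in> Field (rank_ordinals \<kappa> M \<Gamma>)" "(A, p) \<notin> Wellfounded.acc (forking_exts \<Gamma>)"
  shows "Uth_ge \<kappa> M \<Gamma> \<alpha> A p"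
proof -
  let ?r = "rank_ordinals \<kappa> M \<Gamma>"
  have "Well_order ?r"
    unfolding rank_ordinals_def using cardSuc_Card_order[OF card_of_Card_order] by (rule card_order_on_well_order_on)
  then have "wf (?r - Id)" by (simp add: well_order_on_def)
  then have "\<forall>A p. \<alpha> \<in> Field ?r \<longrightarrow> (A, p) \<notin> Wellfounded.acc (forking_exts \<Gamma>) \<longrightarrow> Uth_ge \<kappa> M \<Gamma> \<alpha> A p"
  proof (induction \<alpha> rule: wf_induct_rule)
    case (less \<alpha>)
    show ?case
    proof (intro allI impI)
      fix A p assume \<alpha>: "\<alpha> \<in> Field ?r" and na: "(A, p) \<notin> Wellfounded.acc (forking_exts \<Gamma>)"
      have IH: "Uth_ge \<kappa> M \<Gamma> \<beta> B q" if "lt_in ?r \<beta> \<alpha>" "(B, q) \<notin> Wellfounded.acc (forking_exts \<Gamma>)" for \<beta> B q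
      proof -
        have "(\<beta>, \<alpha>) \<in> ?r - Id" "\<beta> \<in> Field ?r" using that(1) by (auto simp: lt_in_def Field_def)
        then show ?thesis using less.IH[of \<beta>] that(2) by blast
      qed
      show "Uth_ge \<kappa> M \<Gamma> \<alpha> A p"
      proof (cases "is_zero_in ?r \<alpha>")
        case True
        then show ?thesis by (rule Uth_ge.zero)
      next
        case nz: False
        show ?thesis
        proof (cases "\<exists>\<beta>. is_succ_in ?r \<beta> \<alpha>")
          case True
          then obtain \<beta> where \<beta>: "is_succ_in ?r \<beta> \<alpha>" ..
          have "\<exists>y. (y, (A, p)) \<in> forking_exts \<Gamma> \<and> y \<notin> Wellfounded.acc (forking_exts \<Gamma>)"
            using na by (meson acc.accI)
          then obtain B q where Bq: "((B, q), (A, p)) \<in> forking_exts \<Gamma>" "(B, q) \<notin> Wellfounded.acc (forking_exts \<Gamma>)"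
            by auto
          have "thorn_forking_ext \<kappa> M \<Gamma> A p B q" using Bq(1) by (simp add: forking_exts_def)
          moreover have "Uth_ge \<kappa> M \<Gamma> \<beta> B q" using IH Bq(2) \<beta> by (simp add: is_succ_in_def)
          ultimately show ?thesis by (rule Uth_ge.succ[OF \<beta>])
        next
          case False
          then have "is_limit_in ?r \<alpha>" using \<alpha> nz by (auto simp: is_limit_in_def)
          then show ?thesis using IH[OF _ na] by (rule Uth_ge.limit)
        qed
      qed
    qed
  qed
  then show ?thesis using assms by blast
qed

lemma superrosy_accessible: "superrosy_type \<kappa> M \<Gamma> A p \<Longrightarrow> (A, p) \<in> Wellfounded.acc (forking_exts \<Gamma>)"
  using Uth_ge_of_not_accessible unfolding superrosy_type_def by blast

lemma formulas_card_ge_finite: "finite A \<Longrightarrow> |A| \<le>o |formulas M|"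
  using infinite_formulas
  by (metis card_of_Well_order card_of_ordLeq_finite ordLeq_total)

text \<open>Among the types of \<open>a\<close> over finite subsets of \<open>B\<close> take one, over \<open>B0\<close>, that is minimal for forking
  extension. If \<open>a\<close> forked with \<open>B\<close> over \<open>B0\<close>, then already with the parameters of one formula, and
  adding these to \<open>B0\<close> would contradict minimality.\<close>

lemma superrosy_rosy:
  assumes "superrosy \<kappa> M"
  shows "rosy \<kappa> M"
  unfolding rosy_def
proof (intro allI impI)
  fix a B assume "set a \<subseteq> U \<and> sml B"
  then have a: "set a \<subseteq> U" and B: "sml B" by auto
  let ?\<Gamma> = "map srt a"
  define Q where "Q x \<longleftrightarrow> (\<exists>B0. finite B0 \<and> B0 \<subseteq> B \<and> x = (B0, tp M a B0))" for x
  have "superrosy_type \<kappa> M ?\<Gamma> {} (tp M a {})"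
    using assms tp_in_ctypes[OF a] small_finite[OF finite.emptyI] unfolding superrosy_def by blast
  then have "({}, tp M a {}) \<in> Wellfounded.acc (forking_exts ?\<Gamma>)" by (rule superrosy_accessible)
  moreover have "Q ({}, tp M a {})" by (auto simp: Q_def)
  ultimately obtain x where x: "Q x" "\<And>y. (y, x) \<in> forking_exts ?\<Gamma> \<Longrightarrow> \<not> Q y"
    by (rule acc_minimal) blast
  then obtain B0 where B0: "finite B0" "B0 \<subseteq> B" "x = (B0, tp M a B0)" by (auto simp: Q_def)
  have BU: "B \<subseteq> U" using B by (rule smallD)
  have "thorn_indep \<kappa> M a B0 B"
  proof (rule ccontr)
    assume "\<not> thorn_indep \<kappa> M a B0 B"
    then obtain \<chi> where \<chi>: "\<chi> \<in> tp M a (B0 \<union> B)" "thorn_forks_fm \<kappa> M ?\<Gamma> B0 \<chi>"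
      unfolding thorn_indep_def thorn_forks_def by blast
    obtain \<phi> c where c: "\<chi> = (\<phi>, c)" by force
    let ?B1 = "B0 \<union> set c"
    have cB: "set c \<subseteq> B" using \<chi>(1) B0(2) by (auto simp: tp_def fms_over_def c)
    have "\<chi> \<in> tp M a ?B1" using \<chi>(1) by (auto simp: tp_def fms_over_def c)
    then have "thorn_forks \<kappa> M ?\<Gamma> B0 (tp M a ?B1)" using \<chi>(2) unfolding thorn_forks_def by blast
    moreover have "sml ?B1" using B0(1,2) cB BU by (intro small_finite) auto
    ultimately have "((?B1, tp M a ?B1), x) \<in> forking_exts ?\<Gamma>"
      using tp_in_ctypes[OF a] tp_mono[of B0 ?B1 a] unfolding forking_exts_def thorn_forking_ext_def B0(3) by auto
    moreover have "Q (?B1, tp M a ?B1)" using B0(1,2) cB by (auto simp: Q_def)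
    ultimately show False using x(2) by blast
  qed
  then show "\<exists>B0\<subseteq>B. |B0| \<le>o |formulas M| \<and> thorn_indep \<kappa> M a B0 B"
    using B0 formulas_card_ge_finite by blast
qed

end

context rosy_monster
begin

lemma below_accessible:
  assumes "(C, tp M d C) \<in> Wellfounded.acc (forking_exts (map srt d))" "sml C" "set d \<subseteq> U"
  shows "(C, d) \<in> Wellfounded.acc below"
proof -
  let ?\<Gamma> = "map srt d"
  have "\<forall>C d. x = (C, tp M d C) \<longrightarrow> sml C \<longrightarrow> set d \<subseteq> U \<longrightarrow> map srt d = ?\<Gamma> \<longrightarrow> (C, d) \<in> Wellfounded.acc below"
    if "x \<in> Wellfounded.acc (forking_exts ?\<Gamma>)" for x
    using that
  proof (induction x rule: acc_induct_rule)
    case (1 x)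
    show ?case
    proof (intro allI impI, rule acc.accI)
      fix C d y assume x: "x = (C, tp M d C)" and C: "sml C" and d: "set d \<subseteq> U" "map srt d = ?\<Gamma>"
        and "(y, (C, d)) \<in> below"
      then obtain B d1 where y: "y = (B, d1)" "sml B" "C \<subseteq> B" "conjugate C d d1" "\<not> ind (set d1) C B"
        by (auto simp: below_def)
      have d1: "set d1 \<subseteq> U" "map srt d1 = ?\<Gamma>"
        using conjugate_set[OF y(4) d(1)] conjugate_sort[OF y(4) d(1)] d(2) by auto
      have "\<not> thorn_indep \<kappa> M d1 C B" using ind_set_eq[OF d1(1) C y(2)] y(5) by blast
      then have "thorn_forks \<kappa> M ?\<Gamma> C (tp M d1 B)" using thorn_forks_tp[OF y(3), of d1] unfolding d1(2) by blast
      moreover have "tp M d1 B \<in> ctypes M ?\<Gamma> B" using tp_in_ctypes[OF d1(1)] unfolding d1(2) .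
      moreover have "tp M d C \<subseteq> tp M d1 B" using conjugate_tp[OF y(4) C d(1)] tp_mono[OF y(3)] by blast
      ultimately have "((B, tp M d1 B), x) \<in> forking_exts ?\<Gamma>"
        using y(2,3) by (simp add: x forking_exts_def thorn_forking_ext_def)
      from 1(2)[OF this] show "y \<in> Wellfounded.acc below" using y(1,2) d1 by blast
    qed
  qed
  from this[OF assms(1)] assms(2,3) show ?thesis by blast
qed

section \<open>Weight, regularity and domination of types\<close>

lemma family_union:
  "(\<Union>j\<in>{..<length bs} - {i}. set (bs ! j)) = els (take i bs) \<union> els (drop (Suc i) bs)" if "i < length bs"
proof -
  have "{..<length bs} - {i} = {..<i} \<union> {Suc i..<length bs}" using that by auto
  then have "(\<Union>j\<in>{..<length bs} - {i}. set (bs ! j)) =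
      \<Union>(set ` (nth bs ` {..<i})) \<union> \<Union>(set ` (nth bs ` {Suc i..<length bs}))" by auto
  moreover have "nth bs ` {..<i} = set (take i bs)"
    using nth_image[of i bs] that by (simp add: lessThan_atLeast0)
  moreover have "nth bs ` {Suc i..<length bs} = set (drop (Suc i) bs)"
  proof -
    have "map (nth bs) [Suc i..<length bs] = drop (Suc i) bs" by (intro nth_equalityI) auto
    from arg_cong[OF this, of set] show ?thesis by simp
  qed
  ultimately show ?thesis by (simp add: els_def)
qed

lemma indseq_iff_family:
  assumes bs: "\<forall>b\<in>set bs. set b \<subseteq> U" and B: "sml B"
  shows "thorn_indep_family \<kappa> M B bs \<longleftrightarrow> indseq B bs"
proof -
  have rest: "sml (els (take i bs) \<union> els (drop (Suc i) bs))" for i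
    using bs by (intro small_Un small_els) (auto dest: in_set_takeD in_set_dropD)
  have "thorn_indep_family \<kappa> M B bs \<longleftrightarrow>
      (\<forall>i<length bs. ind (set (bs ! i)) B (els (take i bs) \<union> els (drop (Suc i) bs)))"
    unfolding thorn_indep_family_def using family_union ind_set_eq[OF _ B rest] bs by (metis nth_mem)
  also have "\<dots> \<longleftrightarrow> indseq B bs"
  proof
    assume *: "\<forall>i<length bs. ind (set (bs ! i)) B (els (take i bs) \<union> els (drop (Suc i) bs))"
    have "\<forall>i<length bs. ind (set (bs ! i)) B (els (drop (Suc i) bs))"
    proof (intro allI impI)
      fix i assume i: "i < length bs"
      have iU: "set (bs ! i) \<subseteq> U" using bs i by simp
      show "ind (set (bs ! i)) B (els (drop (Suc i) bs))"
        by (rule ind_mono[OF _ iU order_refl order_refl]) (use * i in auto)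
    qed
    then show "indseq B bs"
    proof (induction bs)
      case (Cons b bs)
      have "ind (set b) B (els bs)" using Cons.prems by force
      moreover have "\<forall>i<length bs. ind (set (bs ! i)) B (els (drop (Suc i) bs))" using Cons.prems by force
      ultimately show ?case using Cons.IH by simp
    qed simp
  next
    assume "indseq B bs"
    then show "\<forall>i<length bs. ind (set (bs ! i)) B (els (take i bs) \<union> els (drop (Suc i) bs))"
      using family_of_indseq bs B by blast
  qed
  finally show ?thesis .
qed

text \<open>The realization of the type may be prescribed, as any other one, with the family witnessing its
  weight, can be moved to it by an automorphism.\<close>

lemma thorn_weight_ge_iff:
  assumes a: "set a \<subseteq> U" and A: "sml A"
  shows "thorn_weight_ge \<kappa> M (map srt a) A (tp M a A) n \<longleftrightarrow> weight_ge a A n"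
proof
  assume "thorn_weight_ge \<kappa> M (map srt a) A (tp M a A) n"
  then obtain a' B bs where w: "realizes M (map srt a) a' (tp M a A)" "sml B" "A \<subseteq> B" "thorn_indep \<kappa> M a' A B"
    "length bs = n" "\<forall>b\<in>set bs. set b \<subseteq> U" "thorn_indep_family \<kappa> M B bs"
    "\<forall>b\<in>set bs. \<not> thorn_indep \<kappa> M a' B (set b)"
    unfolding thorn_weight_ge_def by blast
  have AU: "A \<subseteq> U" and BU: "B \<subseteq> U" using A w(2) smallD by blast+
  have c: "conjugate A a a'" using w(1) realizes_tp_iff[OF A a] by blast
  have a'U: "set a' \<subseteq> U" using conjugate_set[OF c a] .
  obtain g where g: "aut A g" "a = map g a'" using conjugate_sym[OF c AU a] by (auto simp: conjugate_def)
  have ga: "automorphism M g" using g(1) by (rule aut_automorphism)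
  have gA: "g ` A = A" by (rule aut_image[OF g(1) order_refl])
  have "ind (set a') A B" using w(4) ind_set_eq[OF a'U A w(2)] by blast
  then have "ind (set a) A (g ` B)" using ind_image[OF _ ga a'U AU BU] unfolding gA g(2) set_map by blast
  moreover have "weighs a' B bs"
    unfolding weighs_def using w(6-8) indseq_iff_family[OF w(6,2)] ind_set_eq[OF a'U w(2) small_set] by blast
  then have "weighs a (g ` B) (map (map g) bs)" unfolding g(2) using ga a'U BU by (rule weighs_image)
  moreover have "sml (g ` B)" using small_image[OF ga w(2)] .
  moreover have "A \<subseteq> g ` B" using w(3) gA by blast
  moreover have "length (map (map g) bs) = n" using w(5) by simp
  ultimately show "weight_ge a A n" unfolding weight_ge_def by blast
next
  assume "weight_ge a A n"
  then obtain B bs where w: "sml B" "A \<subseteq> B" "ind (set a) A B" "length bs = n"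
    "\<forall>b\<in>set bs. set b \<subseteq> U \<and> \<not> ind (set a) B (set b)" "indseq B bs"
    unfolding weight_ge_def weighs_def by blast
  have bsU: "\<forall>b\<in>set bs. set b \<subseteq> U" using w(5) by blast
  show "thorn_weight_ge \<kappa> M (map srt a) A (tp M a A) n"
    unfolding thorn_weight_ge_def
  proof (intro exI conjI)
    show "realizes M (map srt a) a (tp M a A)" by (rule realizes_tp_self[OF a])
    show "thorn_indep \<kappa> M a A B" using ind_set_eq[OF a A w(1)] w(3) by blast
    show "thorn_indep_family \<kappa> M B bs" using indseq_iff_family[OF bsU w(1)] w(6) by blast
    show "\<forall>b\<in>set bs. \<not> thorn_indep \<kappa> M a B (set b)"
      using ind_set_eq[OF a w(1)] small_set w(5) by blast
  qed (use w bsU in auto)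
qed

lemma regular_thorn_regular:
  assumes reg: "regular d C" and C: "sml C" and d: "set d \<subseteq> U"
  shows "thorn_regular \<kappa> M (map srt d) C (tp M d C)"
  unfolding thorn_regular_def weakly_thorn_orthogonal_def
proof (intro allI impI, elim conjE)
  fix B p q d1 d2
  assume q: "thorn_forking_ext \<kappa> M (map srt d) C (tp M d C) B q"
    and p: "thorn_nonforking_ext \<kappa> M (map srt d) C (tp M d C) B p"
    and d1: "realizes M (map srt d) d1 q" and d2: "realizes M (map srt d) d2 p"
  have B: "sml B" "C \<subseteq> B" using q by (auto simp: thorn_forking_ext_def)
  have q': "q \<in> ctypes M (map srt d) B" "tp M d C \<subseteq> q" "thorn_forks \<kappa> M (map srt d) C q"
    using q by (auto simp: thorn_forking_ext_def)
  have p': "p \<in> ctypes M (map srt d) B" "tp M d C \<subseteq> p" "\<not> thorn_forks \<kappa> M (map srt d) C p"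
    using p by (auto simp: thorn_nonforking_ext_def)
  note r1 = realizes_ctype[OF q'(1) d1] and r2 = realizes_ctype[OF p'(1) d2]
  have "conjugate C d d1"
    using q'(2) unfolding r1(3)[symmetric] by (rule tp_subset_conjugate) (use C d r1 in auto)
  moreover have "conjugate C d d2"
    using p'(2) unfolding r2(3)[symmetric] by (rule tp_subset_conjugate) (use C d r2 in auto)
  moreover have "\<not> thorn_indep \<kappa> M d1 C B"
    using thorn_forks_tp[OF B(2), of d1] q'(3) unfolding r1 by blast
  then have "\<not> ind (set d1) C B" using ind_set_eq[OF r1(1) C B(1)] by blast
  moreover have "thorn_indep \<kappa> M d2 C B"
    using thorn_forks_tp[OF B(2), of d2] p'(3) unfolding r2 by blast
  then have "ind (set d2) C B" using ind_set_eq[OF r2(1) C B(1)] by blast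
  ultimately have "ind (set d1) B (set d2)" using reg B unfolding regular_def by blast
  then show "thorn_indep \<kappa> M d1 B (set d2)" using ind_set_eq[OF r1(1) B(1) small_set[OF r2(1)]] by blast
qed

lemma thorn_dominates_iff:
  assumes "set a \<subseteq> U" "set b \<subseteq> U" "sml C"
  shows "thorn_dominates \<kappa> M C a b \<longleftrightarrow> dominates C (set a) (set b)"
proof -
  have eq: "thorn_indep \<kappa> M x C (set c) \<longleftrightarrow> ind (set c) C (set x)" if "set x \<subseteq> U" "set c \<subseteq> U" for x c
    using ind_set_eq[OF that(1) assms(3) small_set[OF that(2)]] symmetry[of "set x" C "set c"]
      symmetry[of "set c" C "set x"] small_set that assms(3) by blast
  show ?thesis unfolding thorn_dominates_def dominates_def using eq assms(1,2) by blast
qed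

theorem finite_weight:
  assumes A: "sml A" and p: "p \<in> ctypes M \<Gamma> A" and sr: "superrosy_type \<kappa> M \<Gamma> A p"
  shows "finite_thorn_weight \<kappa> M \<Gamma> A p"
proof -
  obtain a where a: "set a \<subseteq> U" "map srt a = \<Gamma>" "p = tp M a A" by (rule ctype_realized[OF p A])
  have "(A, tp M a A) \<in> Wellfounded.acc (forking_exts (map srt a))"
    using superrosy_accessible[OF sr] a(2,3) by simp
  then have "(A, a) \<in> Wellfounded.acc below" using A a(1) by (rule below_accessible)
  then obtain N where N: "\<And>n. weight_ge a A n \<Longrightarrow> n \<le> N" using weight_bounded[OF _ A a(1)] by blast
  have "ind (set a) A A" using A a(1) by (rule existence) simp
  then have "weight_ge a A 0" unfolding weight_ge_def weighs_def using A by (intro exI[of _ A] exI[of _ "[]"]) simp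
  then have "\<exists>n. weight_ge a A n \<and> (\<forall>m. weight_ge a A m \<longrightarrow> m \<le> n)"
    using ex_has_greatest_nat[of "weight_ge a A" 0 "\<lambda>n. n" "Suc N"] N by (simp add: less_Suc_eq_le)
  then show ?thesis
    unfolding finite_thorn_weight_def thorn_weight_eq_def a(2)[symmetric] a(3) thorn_weight_ge_iff[OF a(1) A] .
qed

theorem type_decomposition:
  assumes sr: "superrosy \<kappa> M" and A: "sml A" and p: "p \<in> ctypes M \<Gamma> A"
  shows "\<exists>n. thorn_weight_eq \<kappa> M \<Gamma> A p n \<and>
    (\<exists>B bs. sml B \<and> A \<subseteq> B \<and> length bs = n \<and> (\<forall>b\<in>set bs. set b \<subseteq> U) \<and>
       thorn_indep_family \<kappa> M B bs \<and>
       thorn_equidominant \<kappa> M \<Gamma> A p (map srt (concat bs)) B (tp M (concat bs) B) \<and>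
       (\<forall>b\<in>set bs. thorn_regular \<kappa> M (map srt b) B (tp M b B)))"
proof -
  obtain a where a: "set a \<subseteq> U" "map srt a = \<Gamma>" "p = tp M a A" by (rule ctype_realized[OF p A])
  have acc: "(C, d) \<in> Wellfounded.acc below" if "sml C" "set d \<subseteq> U" for C d
  proof (rule below_accessible[OF superrosy_accessible that])
    show "superrosy_type \<kappa> M (map srt d) C (tp M d C)"
      using sr that tp_in_ctypes unfolding superrosy_def by blast
  qed
  have "superrosy_type \<kappa> M \<Gamma> A p" using sr A p unfolding superrosy_def by blast
  then obtain n where n: "thorn_weight_eq \<kappa> M \<Gamma> A p n"
    using finite_weight[OF A p] unfolding finite_thorn_weight_def by blast
  have w: "weight_ge a A n" "\<And>m. weight_ge a A m \<Longrightarrow> m \<le> n"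
    using n unfolding thorn_weight_eq_def a(2)[symmetric] a(3) thorn_weight_ge_iff[OF a(1) A] by blast+
  obtain B bs where B: "sml B" "A \<subseteq> B" "ind (set a) A B" "length bs = n" "indseq B bs"
    "\<And>b. b \<in> set bs \<Longrightarrow> set b \<subseteq> U \<and> regular b B"
    "dominates B (set a) (els bs)" "dominates B (els bs) (set a)"
    by (rule regular_decomposition[OF acc a(1) A w]) blast+
  have bsU: "\<forall>b\<in>set bs. set b \<subseteq> U" using B(6) by blast
  have cU: "set (concat bs) \<subseteq> U" using bsU by auto
  let ?b = "concat bs"
  have "ind (set ?b) B B" using B(1) cU by (rule existence) simp
  then have 1: "thorn_nonforking_ext \<kappa> M (map srt ?b) B (tp M ?b B) B (tp M ?b B)"
    using B(1) cU conjugate_refl by (intro nonforking_ext_tp) auto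
  have 2: "thorn_nonforking_ext \<kappa> M \<Gamma> A p B (tp M a B)"
    using nonforking_ext_tp[OF conjugate_refl B(1,2) a(1) B(3)] a(2,3) by simp
  have 3: "realizes M \<Gamma> a (tp M a B)" using realizes_tp_self[OF a(1)] a(2) by simp
  have 4: "realizes M (map srt ?b) ?b (tp M ?b B)" by (rule realizes_tp_self[OF cU])
  have 5: "thorn_dom_equivalent \<kappa> M B a ?b"
    unfolding thorn_dom_equivalent_def thorn_dominates_iff[OF a(1) cU B(1)] thorn_dominates_iff[OF cU a(1) B(1)]
      set_concat_els using B(7,8) by blast
  have "thorn_equidominant \<kappa> M \<Gamma> A p (map srt ?b) B (tp M ?b B)"
    unfolding thorn_equidominant_def using 1 2 3 4 5 by blast
  moreover have "thorn_indep_family \<kappa> M B bs" using indseq_iff_family[OF bsU B(1)] B(5) by blast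
  moreover have "\<forall>b\<in>set bs. thorn_regular \<kappa> M (map srt b) B (tp M b B)"
    using B(6) regular_thorn_regular[OF _ B(1)] by blast
  ultimately show ?thesis using n B(1,2,4) bsU by blast
qed

end

theorem theorem3p5:
  fixes \<kappa> :: "'k rel"
    and T :: "('s, 'f, 'r) fm set"
    and M :: "('s, 'f, 'r, 'a) fo_structure"
  assumes "monster_model \<kappa> T M" and "eq_closed M"
  shows
    "(rosy \<kappa> M \<longrightarrow>
        (\<forall>\<Gamma> A p. small \<kappa> M A \<and> p \<in> ctypes M \<Gamma> A \<and> superrosy_type \<kappa> M \<Gamma> A p \<longrightarrow>
           finite_thorn_weight \<kappa> M \<Gamma> A p))
     \<and>
     (superrosy \<kappa> M \<longrightarrow>
        (\<forall>\<Gamma> A p. small \<kappa> M A \<and> p \<in> ctypes M \<Gamma> A \<longrightarrow>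
           (\<exists>n. thorn_weight_eq \<kappa> M \<Gamma> A p n \<and>
              (\<exists>B bs. small \<kappa> M B \<and> A \<subseteq> B \<and>
                 length bs = n \<and> (\<forall>b\<in>set bs. set b \<subseteq> univ M) \<and>
                 thorn_indep_family \<kappa> M B bs \<and>
                 thorn_equidominant \<kappa> M \<Gamma> A p
                   (map (sort_of M) (concat bs)) B (tp M (concat bs) B) \<and>
                 (\<forall>b\<in>set bs. thorn_regular \<kappa> M (map (sort_of M) b) B (tp M b B))))))"
proof -
  interpret monster \<kappa> T M by unfold_locales (rule assms(1))
  show ?thesis
  proof (intro conjI impI allI)
    fix \<Gamma> A p
    assume "rosy \<kappa> M" and *: "small \<kappa> M A \<and> p \<in> ctypes M \<Gamma> A \<and> superrosy_type \<kappa> M \<Gamma> A p"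
    then interpret rosy_monster \<kappa> T M by unfold_locales
    show "finite_thorn_weight \<kappa> M \<Gamma> A p" using finite_weight * by blast
  next
    fix \<Gamma> A p
    assume sr: "superrosy \<kappa> M" and *: "small \<kappa> M A \<and> p \<in> ctypes M \<Gamma> A"
    interpret rosy_monster \<kappa> T M by unfold_locales (rule superrosy_rosy[OF sr])
    show "\<exists>n. thorn_weight_eq \<kappa> M \<Gamma> A p n \<and>
              (\<exists>B bs. small \<kappa> M B \<and> A \<subseteq> B \<and>
                 length bs = n \<and> (\<forall>b\<in>set bs. set b \<subseteq> univ M) \<and>
                 thorn_indep_family \<kappa> M B bs \<and>
                 thorn_equidominant \<kappa> M \<Gamma> A p
                   (map (sort_of M) (concat bs)) B (tp M (concat bs) B) \<and>
                 (\<forall>b\<in>set bs. thorn_regular \<kappa> M (map (sort_of M) b) B (tp M b B)))"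
      using type_decomposition[OF sr] * by blast
  qed
qed

end
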